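(* Let $(G_n)_{n\ge1}$ be a random sequence in $\Pi(\mathcal K)$ such that $|V(G_n)|\to\infty$ in probability. Then the following are equivalent: (1) $\tau^+(G_n)$ converges in distribution in $\overline{\Pi(\mathcal K)^+}$; (2) for every $F\in\Pi(\mathcal F)$ the sequence $t(F,G_n)$ converges in distribution; (3) for every $F\in\Pi(\mathcal C)$ the sequence $t(F,G_n)$ converges in distribution; (4) for every $k\ge1$ the sequence $\mathbb G(k,G_n)$ of random elements of $\Pi(\mathcal K)$ converges in distribution. If any of these holds, then the limits in (2) and (3) are $t(F,\Gamma)$, where $\Gamma$ is the random element of $\overline{\Pi(\mathcal K)^+}$ which is the distributional limit in (1), and $\Gamma\in\overline{\Pi(\mathcal K)^+}\setminus\Pi(\mathcal K)^+$ almost surely. If in (2) and (3) $t(F,G_n)$ is replaced by $t_{\mathrm{inj}}(F,G_n)$, the four statements remain equivalent and the limits in (2) and (3) are again $t(F,\Gamma)$. If every $G_n$ is deterministic (concentrated on one element of $\Pi(\mathcal K)$), the equivalence holds with the sequences in (1), (2), (3) being ordinary (numerical) convergent sequences, while (4) remains unchanged.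
   Context: Fix an integer $r\ge1$ and a compact Polish space $\mathcal K$. Let $\mathcal C$ be the space of continuous real-valued functions on $\mathcal K$, and let $\mathcal F\subset\mathcal C$ be a countable set with $\|f\|_\infty\le1$ for all $f\in\mathcal F$ whose linear span is dense in $\mathcal C$ in the sup norm. For a set $S$, an $S$-decorated directed $r$-uniform hypergraph $G$ consists of a finite vertex set $V(G)$ and an $r$-array $G:V(G)^r\to S$, $(v_1,\dots,v_r)\mapsto G_{v_1,\dots,v_r}$; $\Pi(S)$ denotes the set of isomorphism classes (unlabeled objects), and $\Pi^k(S)$ those with $k$ vertices. For $F\in\Pi(\mathcal C)$ with $V(F)=[k]$ and $G\in\Pi(\mathcal K)$ the homomorphism density is $t(F,G)=|V(G)|^{-k}\sum_{\phi:[k]\to V(G)}\prod_{(i_1,\dots,i_r)\in[k]^r}F_{i_1,\dots,i_r}(G_{\phi(i_1),\dots,\phi(i_r)})$, and the injective density $t_{\mathrm{inj}}(F,G)$ is the same average taken only over injective maps $\phi$. Let $\tau^+(G)=\big((t(F,G))_{F\in\Pi(\mathcal F)},1/|V(G)|\big)$, an element of the compact product space $[-1,1]^{\Pi(\mathcal F)}\times[0,1]$; $\Pi(\mathcal K)^+=\tau^+(\Pi(\mathcal K))$ and $\overline{\Pi(\mathcal K)^+}$ is its closure. For $\Gamma\in\overline{\Pi(\mathcal K)^+}$ and $F\in\Pi(\mathcal F)$, $t(F,\Gamma)$ denotes the $F$-coordinate of $\Gamma$ (the continuous extension of $t(F,\cdot)$); for $F\in\Pi(\mathcal C)$, $t(F,\Gamma)$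 denotes the continuous extension of $t(F,\cdot)$ to the closure. For $G\in\Pi(\mathcal K)$ and $k\ge1$, $\mathbb G(k,G)$ is the random induced sub-hypergraph of $G$ on a vertex subset chosen uniformly among all $k$-element subsets of $V(G)$. *)

theory Defs
  imports "HOL-Probability.Probability"
begin

section \<open>Decorated directed uniform hypergraphs\<close>

text \<open>
  A labelled hypergraph is a pair of a finite nonempty vertex set and an array on its r-tuples.
  Tuples are lists of length r, and arrays are extensional functions on them, so that equality of
  pairs is equality of hypergraphs.  Taking the vertices to be natural numbers is no restriction,
  as only isomorphism classes matter.  Hypergraphs have at least one vertex, as is needed for
  \<open>1 / |V(G)|\<close> and for the densities to make sense.
\<close>

type_synonym 's hypergraph = "nat set \<times> (nat list \<Rightarrow> 's)"

definition tuples :: "nat \<Rightarrow> nat set \<Rightarrow> nat list set" where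
  "tuples r V = {i. set i \<subseteq> V \<and> length i = r}"

definition hypergraphs :: "nat \<Rightarrow> 's set \<Rightarrow> 's hypergraph set" where
  "hypergraphs r S = (SIGMA V : {V. finite V \<and> V \<noteq> {}}. tuples r V \<rightarrow>\<^sub>E S)"

definition hypergraph_iso :: "nat \<Rightarrow> ('s hypergraph \<times> 's hypergraph) set" where
  "hypergraph_iso r = {(G, H). G \<in> hypergraphs r UNIV \<and> H \<in> hypergraphs r UNIV \<and>
     (\<exists>\<sigma>. bij_betw \<sigma> (fst G) (fst H) \<and> (\<forall>i\<in>tuples r (fst G). snd H (map \<sigma> i) = snd G i))}"

definition iso_class :: "nat \<Rightarrow> 's hypergraph \<Rightarrow> 's hypergraph set" where
  "iso_class r G = hypergraph_iso r `` {G}"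

definition unlabelled :: "nat \<Rightarrow> 's set \<Rightarrow> 's hypergraph set set" where
  "unlabelled r S = hypergraphs r S // hypergraph_iso r"

text \<open>
  Functions of unlabelled hypergraphs are evaluated at an arbitrary representative; all the
  functions below that are used in this way are invariant under isomorphism.
\<close>

definition rep :: "'s hypergraph set \<Rightarrow> 's hypergraph" where
  "rep C = (SOME G. G \<in> C)"

definition num_vertices :: "'s hypergraph set \<Rightarrow> nat" where
  "num_vertices G = card (fst (rep G))"


section \<open>Densities\<close>

definition hom_sum ::
  "nat \<Rightarrow> (nat \<Rightarrow> nat) set \<Rightarrow> ('k::topological_space \<Rightarrow>\<^sub>C real) hypergraph \<Rightarrow> 'k hypergraph \<Rightarrow> real"
  where "hom_sum r \<Phi> F G =
    (\<Sum>\<phi>\<in>\<Phi>. \<Prod>i\<in>tuples r (fst F). apply_bcontfun (snd F i) (snd G (map \<phi> i)))"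

definition lab_hom_density ::
  "nat \<Rightarrow> ('k::topological_space \<Rightarrow>\<^sub>C real) hypergraph \<Rightarrow> 'k hypergraph \<Rightarrow> real" where
  "lab_hom_density r F G =
    hom_sum r (fst F \<rightarrow>\<^sub>E fst G) F G / real (card (fst G)) ^ card (fst F)"

text \<open>If there are no injective maps, then the following average is \<open>0 / 0 = 0\<close>.\<close>

definition lab_inj_density ::
  "nat \<Rightarrow> ('k::topological_space \<Rightarrow>\<^sub>C real) hypergraph \<Rightarrow> 'k hypergraph \<Rightarrow> real" where
  "lab_inj_density r F G =
    (let \<Phi> = {\<phi> \<in> fst F \<rightarrow>\<^sub>E fst G. inj_on \<phi> (fst F)} in hom_sum r \<Phi> F G / real (card \<Phi>))"

definition hom_density ::
  "nat \<Rightarrow> ('k::topological_space \<Rightarrow>\<^sub>C real) hypergraph set \<Rightarrow> 'k hypergraph set \<Rightarrow> real" where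
  "hom_density r F G = lab_hom_density r (rep F) (rep G)"

definition inj_density ::
  "nat \<Rightarrow> ('k::topological_space \<Rightarrow>\<^sub>C real) hypergraph set \<Rightarrow> 'k hypergraph set \<Rightarrow> real" where
  "inj_density r F G = lab_inj_density r (rep F) (rep G)"


section \<open>The space of limits\<close>

definition tau_plus ::
  "nat \<Rightarrow> ('k::topological_space \<Rightarrow>\<^sub>C real) set \<Rightarrow> 'k hypergraph set
    \<Rightarrow> (('k \<Rightarrow>\<^sub>C real) hypergraph set \<Rightarrow> real) \<times> real" where
  "tau_plus r \<F> G = (\<lambda>F\<in>unlabelled r \<F>. hom_density r F G, 1 / real (num_vertices G))"

definition tau_image ::
  "nat \<Rightarrow> ('k::topological_space \<Rightarrow>\<^sub>C real) set
    \<Rightarrow> ((('k \<Rightarrow>\<^sub>C real) hypergraph set \<Rightarrow> real) \<times> real) set" where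
  "tau_image r \<F> = tau_plus r \<F> ` unlabelled r UNIV"

definition cube_topology ::
  "nat \<Rightarrow> ('k::topological_space \<Rightarrow>\<^sub>C real) set
    \<Rightarrow> ((('k \<Rightarrow>\<^sub>C real) hypergraph set \<Rightarrow> real) \<times> real) topology" where
  "cube_topology r \<F> = prod_topology
     (product_topology (\<lambda>_. top_of_set {-1..1}) (unlabelled r \<F>)) (top_of_set {0..1})"

definition limit_topology ::
  "nat \<Rightarrow> ('k::topological_space \<Rightarrow>\<^sub>C real) set
    \<Rightarrow> ((('k \<Rightarrow>\<^sub>C real) hypergraph set \<Rightarrow> real) \<times> real) topology" where
  "limit_topology r \<F> =
     subtopology (cube_topology r \<F>) (cube_topology r \<F> closure_of tau_image r \<F>)"

text \<open>
  The continuous extension of \<open>t(F, \<cdot>)\<close> to the closure, for an arbitrary array \<open>F\<close> of continuous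
  functions.  On the closure it is unique since the image of \<open>tau_plus\<close> is dense there.
\<close>

definition density_ext ::
  "nat \<Rightarrow> ('k::topological_space \<Rightarrow>\<^sub>C real) set \<Rightarrow> ('k \<Rightarrow>\<^sub>C real) hypergraph set
    \<Rightarrow> (('k \<Rightarrow>\<^sub>C real) hypergraph set \<Rightarrow> real) \<times> real \<Rightarrow> real" where
  "density_ext r \<F> F = (SOME g. continuous_map (limit_topology r \<F>) euclideanreal g \<and>
     (\<forall>G\<in>unlabelled r UNIV. g (tau_plus r \<F> G) = hom_density r F G))"


section \<open>Unlabelled hypergraphs as a topological space\<close>

text \<open>
  The labelled hypergraphs form the disjoint union over all vertex sets of the spaces of arrays,
  and the unlabelled ones carry the quotient topology.  Equivalently, the classes with k vertices
  form the quotient of the product space of arrays on \<open>[k]\<close> by the symmetric group, and the whole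
  space is the disjoint union of these over k.
\<close>

definition labelled_topology :: "nat \<Rightarrow> 'k::topological_space hypergraph topology" where
  "labelled_topology r =
     sum_topology (\<lambda>V. product_topology (\<lambda>_. euclidean) (tuples r V)) {V. finite V \<and> V \<noteq> {}}"

definition unlabelled_topology :: "nat \<Rightarrow> 'k::topological_space hypergraph set topology" where
  "unlabelled_topology r = topology (\<lambda>U. U \<subseteq> unlabelled r UNIV \<and>
     openin (labelled_topology r) {G \<in> hypergraphs r UNIV. iso_class r G \<in> U})"


section \<open>Convergence in distribution\<close>

definition borel_of :: "'a topology \<Rightarrow> 'a measure" where
  "borel_of T = sigma (topspace T) {U. openin T U}"

definition weak_limit :: "'a topology \<Rightarrow> (nat \<Rightarrow> 'a measure) \<Rightarrow> 'a measure \<Rightarrow> bool" where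
  "weak_limit T \<mu> N \<longleftrightarrow> prob_space N \<and> sets N = sets (borel_of T) \<and>
     (\<forall>f. continuous_map T euclideanreal f \<and> bounded (f ` topspace T) \<longrightarrow>
        (\<lambda>n. \<integral>x. f x \<partial>\<mu> n) \<longlonglongrightarrow> (\<integral>x. f x \<partial>N))"

definition real_converges_in_distribution ::
  "(nat \<Rightarrow> 'w measure) \<Rightarrow> (nat \<Rightarrow> 'w \<Rightarrow> real) \<Rightarrow> bool" where
  "real_converges_in_distribution M Y \<longleftrightarrow>
     (\<exists>\<mu>. real_distribution \<mu> \<and> weak_conv_m (\<lambda>n. distr (M n) borel (Y n)) \<mu>)"


section \<open>Random induced sub-hypergraphs\<close>

definition induced :: "nat \<Rightarrow> 's hypergraph \<Rightarrow> nat set \<Rightarrow> 's hypergraph" where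
  "induced r G W = (W, restrict (snd G) (tuples r W))"

text \<open>
  The law of a uniformly random induced sub-hypergraph with k vertices.  If the hypergraph has
  fewer than k vertices, then all of its vertices are taken.
\<close>

definition sample ::
  "nat \<Rightarrow> nat \<Rightarrow> 'k::topological_space hypergraph set \<Rightarrow> 'k hypergraph set measure" where
  "sample r k G = distr
     (uniform_count_measure {W. W \<subseteq> fst (rep G) \<and> card W = min k (card (fst (rep G)))})
     (borel_of (unlabelled_topology r))
     (\<lambda>W. iso_class r (induced r (rep G) W))"


section \<open>Sanity checks\<close>

lemma map_tuples: "f ` V \<subseteq> W \<Longrightarrow> i \<in> tuples r V \<Longrightarrow> map f i \<in> tuples r W"
  unfolding tuples_def by auto

lemma equiv_hypergraph_iso: "equiv (hypergraphs r UNIV) (hypergraph_iso r)"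
proof (rule equivI)
  show "hypergraph_iso r \<subseteq> hypergraphs r UNIV \<times> hypergraphs r UNIV"
    unfolding hypergraph_iso_def by auto
  show "refl_on (hypergraphs r UNIV) (hypergraph_iso r)"
  proof (rule refl_onI)
    fix G :: "'s hypergraph" assume G: "G \<in> hypergraphs r UNIV"
    have "bij_betw id (fst G) (fst G) \<and> (\<forall>i\<in>tuples r (fst G). snd G (map id i) = snd G i)"
      by simp
    with G show "(G, G) \<in> hypergraph_iso r" unfolding hypergraph_iso_def by blast
  qed
  show "sym (hypergraph_iso r)"
  proof (rule symI)
    fix G H :: "'s hypergraph" assume "(G, H) \<in> hypergraph_iso r"
    then obtain \<sigma> where GH: "G \<in> hypergraphs r UNIV" "H \<in> hypergraphs r UNIV"
      and b: "bij_betw \<sigma> (fst G) (fst H)"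
      and e: "\<And>i. i \<in> tuples r (fst G) \<Longrightarrow> snd H (map \<sigma> i) = snd G i"
      unfolding hypergraph_iso_def by auto
    let ?\<tau> = "inv_into (fst G) \<sigma>"
    have b': "bij_betw ?\<tau> (fst H) (fst G)" using b by (rule bij_betw_inv_into)
    have "snd G (map ?\<tau> i) = snd H i" if i: "i \<in> tuples r (fst H)" for i
    proof -
      have m: "map ?\<tau> i \<in> tuples r (fst G)"
        using map_tuples[of ?\<tau> "fst H" "fst G"] b' i by (auto simp: bij_betw_def)
      have "map \<sigma> (map ?\<tau> i) = i"
        using i b by (auto simp: tuples_def intro!: map_idI bij_betw_inv_into_right)
      with e[OF m] show ?thesis by simp
    qed
    with GH b' show "(H, G) \<in> hypergraph_iso r" unfolding hypergraph_iso_def by blast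
  qed
  show "trans (hypergraph_iso r)"
  proof (rule transI)
    fix G H K :: "'s hypergraph"
    assume "(G, H) \<in> hypergraph_iso r" "(H, K) \<in> hypergraph_iso r"
    then obtain \<sigma> \<tau> where GK: "G \<in> hypergraphs r UNIV" "K \<in> hypergraphs r UNIV"
      and b: "bij_betw \<sigma> (fst G) (fst H)" "bij_betw \<tau> (fst H) (fst K)"
      and e: "\<And>i. i \<in> tuples r (fst G) \<Longrightarrow> snd H (map \<sigma> i) = snd G i"
        "\<And>i. i \<in> tuples r (fst H) \<Longrightarrow> snd K (map \<tau> i) = snd H i"
      unfolding hypergraph_iso_def by auto
    have "snd K (map (\<tau> \<circ> \<sigma>) i) = snd G i" if i: "i \<in> tuples r (fst G)" for i
      using e(1)[OF i] e(2)[OF map_tuples[of \<sigma> "fst G" "fst H", OF _ i]] b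
      by (auto simp: bij_betw_def)
    with GK bij_betw_trans[OF b] show "(G, K) \<in> hypergraph_iso r"
      unfolding hypergraph_iso_def by blast
  qed
qed

lemma openin_unlabelled_topology:
  fixes U :: "'k::topological_space hypergraph set set"
  shows "openin (unlabelled_topology r) U \<longleftrightarrow> U \<subseteq> unlabelled r UNIV \<and>
     openin (labelled_topology r) {G \<in> hypergraphs r UNIV. iso_class r G \<in> U}"
proof -
  have "istopology (\<lambda>U :: 'k hypergraph set set. U \<subseteq> unlabelled r UNIV \<and>
     openin (labelled_topology r) {G \<in> hypergraphs r UNIV. iso_class r G \<in> U})"
  proof -
    have 1: "{G \<in> hypergraphs r UNIV. iso_class r G \<in> S \<inter> T} =
       {G \<in> hypergraphs r UNIV. iso_class r G \<in> S} \<inter> {G \<in> hypergraphs r UNIV. iso_class r G \<in> T}"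
      for S T :: "'k hypergraph set set" by auto
    have 2: "{G \<in> hypergraphs r UNIV. iso_class r G \<in> \<Union>\<K>} =
       (\<Union>K\<in>\<K>. {G \<in> hypergraphs r UNIV. iso_class r G \<in> K})"
      for \<K> :: "'k hypergraph set set set" by auto
    show ?thesis unfolding istopology_def 1 2 by (blast intro: openin_Int openin_Union)
  qed
  then show ?thesis unfolding unlabelled_topology_def by (simp add: topology_inverse')
qed

lemma topspace_labelled_topology: "topspace (labelled_topology r) = hypergraphs r UNIV"
  by (auto simp: labelled_topology_def hypergraphs_def)

lemma topspace_unlabelled_topology: "topspace (unlabelled_topology r) = unlabelled r UNIV"
proof -
  have "{G \<in> hypergraphs r UNIV. iso_class r G \<in> unlabelled r UNIV} = hypergraphs r UNIV"
    by (auto simp: iso_class_def unlabelled_def intro: quotientI)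
  then have "openin (unlabelled_topology r) (unlabelled r UNIV)"
    unfolding openin_unlabelled_topology
    by (metis openin_topspace subset_refl topspace_labelled_topology)
  then show ?thesis
    by (meson openin_subset openin_topspace openin_unlabelled_topology subset_antisym)
qed

lemma quotient_map_iso_class:
  "quotient_map (labelled_topology r) (unlabelled_topology r) (iso_class r)"
  by (auto simp: quotient_map_def topspace_labelled_topology topspace_unlabelled_topology
      openin_unlabelled_topology unlabelled_def quotient_def iso_class_def)

text \<open>The densities do not depend on the choice of the representatives.\<close>

lemma hom_sum_cong:
  fixes F F' :: "('k::topological_space \<Rightarrow>\<^sub>C real) hypergraph" and G G' :: "'k hypergraph"
  assumes "(F, F') \<in> hypergraph_iso r" "(G, G') \<in> hypergraph_iso r"
    and P: "P = (\<lambda>_ _. True) \<or> P = inj_on"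
  shows "hom_sum r {\<phi> \<in> fst F \<rightarrow>\<^sub>E fst G. P \<phi> (fst F)} F G =
    hom_sum r {\<phi> \<in> fst F' \<rightarrow>\<^sub>E fst G'. P \<phi> (fst F')} F' G' \<and>
    card {\<phi> \<in> fst F \<rightarrow>\<^sub>E fst G. P \<phi> (fst F)} = card {\<phi> \<in> fst F' \<rightarrow>\<^sub>E fst G'. P \<phi> (fst F')}"
proof -
  obtain \<sigma> \<tau> where b: "bij_betw \<sigma> (fst F) (fst F')" "bij_betw \<tau> (fst G) (fst G')"
    and e: "\<And>i. i \<in> tuples r (fst F) \<Longrightarrow> snd F' (map \<sigma> i) = snd F i"
      "\<And>i. i \<in> tuples r (fst G) \<Longrightarrow> snd G' (map \<tau> i) = snd G i"
    using assms(1,2) unfolding hypergraph_iso_def by auto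
  define A where "A = {\<phi> \<in> fst F \<rightarrow>\<^sub>E fst G. P \<phi> (fst F)}"
  define B where "B = {\<phi> \<in> fst F' \<rightarrow>\<^sub>E fst G'. P \<phi> (fst F')}"
  let ?s = "inv_into (fst F) \<sigma>" and ?t = "inv_into (fst G) \<tau>"
  define f where "f \<phi> = (\<lambda>x\<in>fst F'. \<tau> (\<phi> (?s x)))" for \<phi>
  define g where "g \<psi> = (\<lambda>x\<in>fst F. ?t (\<psi> (\<sigma> x)))" for \<psi>
  have bs: "bij_betw ?s (fst F') (fst F)" and bt: "bij_betw ?t (fst G') (fst G)"
    using b by (auto intro: bij_betw_inv_into)
  note [simp] = bij_betw_inv_into_left[OF b(1)] bij_betw_inv_into_right[OF b(1)]
    bij_betw_inv_into_left[OF b(2)] bij_betw_inv_into_right[OF b(2)]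
  note m = bij_betwE[OF b(1)] bij_betwE[OF b(2)] bij_betwE[OF bs] bij_betwE[OF bt]
  have fA: "f \<phi> \<in> B" if "\<phi> \<in> A" for \<phi>
  proof -
    have p: "\<phi> \<in> fst F \<rightarrow>\<^sub>E fst G" and q: "P \<phi> (fst F)" using that by (auto simp: A_def)
    have "f \<phi> \<in> fst F' \<rightarrow>\<^sub>E fst G'" using p m by (auto simp: f_def PiE_iff)
    moreover have "inj_on (f \<phi>) (fst F')" if "inj_on \<phi> (fst F)"
    proof (rule inj_onI)
      fix x y assume xy: "x \<in> fst F'" "y \<in> fst F'" "f \<phi> x = f \<phi> y"
      then have "\<tau> (\<phi> (?s x)) = \<tau> (\<phi> (?s y))" by (simp add: f_def)
      moreover have "\<phi> (?s x) \<in> fst G" "\<phi> (?s y) \<in> fst G" using p m xy by (auto simp: PiE_iff)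
      ultimately have "\<phi> (?s x) = \<phi> (?s y)" using b(2) by (auto simp: bij_betw_def inj_on_def)
      then have "?s x = ?s y" using that m xy by (auto simp: inj_on_def)
      then show "x = y" using bs xy by (auto simp: bij_betw_def inj_on_def)
    qed
    ultimately show ?thesis using P q by (auto simp: B_def)
  qed
  have gB: "g \<psi> \<in> A" if "\<psi> \<in> B" for \<psi>
  proof -
    have p: "\<psi> \<in> fst F' \<rightarrow>\<^sub>E fst G'" and q: "P \<psi> (fst F')" using that by (auto simp: B_def)
    have "g \<psi> \<in> fst F \<rightarrow>\<^sub>E fst G" using p m by (auto simp: g_def PiE_iff)
    moreover have "inj_on (g \<psi>) (fst F)" if "inj_on \<psi> (fst F')"
    proof (rule inj_onI)
      fix x y assume xy: "x \<in> fst F" "y \<in> fst F" "g \<psi> x = g \<psi> y"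
      then have "?t (\<psi> (\<sigma> x)) = ?t (\<psi> (\<sigma> y))" by (simp add: g_def)
      moreover have "\<psi> (\<sigma> x) \<in> fst G'" "\<psi> (\<sigma> y) \<in> fst G'" using p m xy by (auto simp: PiE_iff)
      ultimately have "\<psi> (\<sigma> x) = \<psi> (\<sigma> y)" using bt by (auto simp: bij_betw_def inj_on_def)
      then have "\<sigma> x = \<sigma> y" using that m xy by (auto simp: inj_on_def)
      then show "x = y" using b(1) xy by (auto simp: bij_betw_def inj_on_def)
    qed
    ultimately show ?thesis using P q by (auto simp: A_def)
  qed
  have gf: "g (f \<phi>) = \<phi>" if "\<phi> \<in> A" for \<phi>
  proof
    fix x
    have "\<phi> \<in> fst F \<rightarrow>\<^sub>E fst G" using that by (auto simp: A_def)
    then show "g (f \<phi>) x = \<phi> x"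
      using m by (cases "x \<in> fst F") (auto simp: f_def g_def PiE_iff extensional_def)
  qed
  have fg: "f (g \<psi>) = \<psi>" if "\<psi> \<in> B" for \<psi>
  proof
    fix x
    have "\<psi> \<in> fst F' \<rightarrow>\<^sub>E fst G'" using that by (auto simp: B_def)
    then show "f (g \<psi>) x = \<psi> x"
      using m by (cases "x \<in> fst F'") (auto simp: f_def g_def PiE_iff extensional_def)
  qed
  have bij: "bij_betw f A B"
    by (rule bij_betw_byWitness[where f' = g]) (use fA gB gf fg in auto)
  have tup: "bij_betw (map \<sigma>) (tuples r (fst F)) (tuples r (fst F'))"
  proof (rule bij_betw_byWitness[where f' = "map ?s"])
    show "\<forall>i\<in>tuples r (fst F). map ?s (map \<sigma> i) = i"
      by (auto simp: tuples_def subset_iff intro!: map_idI)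
    show "\<forall>i\<in>tuples r (fst F'). map \<sigma> (map ?s i) = i"
      by (auto simp: tuples_def subset_iff intro!: map_idI)
    show "map \<sigma> ` tuples r (fst F) \<subseteq> tuples r (fst F')"
      using m by (auto simp: tuples_def subset_iff)
    show "map ?s ` tuples r (fst F') \<subseteq> tuples r (fst F)"
      using m by (auto simp: tuples_def subset_iff)
  qed
  have "(\<Prod>i\<in>tuples r (fst F'). apply_bcontfun (snd F' i) (snd G' (map (f \<phi>) i))) =
        (\<Prod>i\<in>tuples r (fst F). apply_bcontfun (snd F i) (snd G (map \<phi> i)))" if "\<phi> \<in> A" for \<phi>
  proof (subst prod.reindex_bij_betw[OF tup, symmetric], rule prod.cong)
    fix i assume i: "i \<in> tuples r (fst F)"
    have p: "\<phi> \<in> fst F \<rightarrow>\<^sub>E fst G" using that by (auto simp: A_def)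
    have "map (f \<phi>) (map \<sigma> i) = map \<tau> (map \<phi> i)"
      using i m by (auto simp: f_def tuples_def subset_iff)
    moreover have "map \<phi> i \<in> tuples r (fst G)"
      by (rule map_tuples[OF _ i]) (use p in auto)
    ultimately show "apply_bcontfun (snd F' (map \<sigma> i)) (snd G' (map (f \<phi>) (map \<sigma> i))) =
      apply_bcontfun (snd F i) (snd G (map \<phi> i))" using e i by metis
  qed simp
  then have "hom_sum r A F G = hom_sum r B F' G'"
    unfolding hom_sum_def sum.reindex_bij_betw[OF bij, symmetric] by simp
  moreover have "card A = card B" by (rule bij_betw_same_card[OF bij])
  ultimately show ?thesis by (simp add: A_def B_def)
qed

lemma card_vertices_iso: "(G, G') \<in> hypergraph_iso r \<Longrightarrow> card (fst G) = card (fst G')"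
  unfolding hypergraph_iso_def by (auto dest: bij_betw_same_card)

lemma lab_hom_density_iso:
  "(F, F') \<in> hypergraph_iso r \<Longrightarrow> (G, G') \<in> hypergraph_iso r \<Longrightarrow>
    lab_hom_density r F G = lab_hom_density r F' G'"
  using hom_sum_cong[of F F' r G G' "\<lambda>_ _. True"]
  by (simp add: lab_hom_density_def card_vertices_iso[of F F' r] card_vertices_iso[of G G' r])

lemma lab_inj_density_iso:
  "(F, F') \<in> hypergraph_iso r \<Longrightarrow> (G, G') \<in> hypergraph_iso r \<Longrightarrow>
    lab_inj_density r F G = lab_inj_density r F' G'"
  using hom_sum_cong[of F F' r G G' inj_on]
  by (simp add: lab_inj_density_def Let_def)

lemma rep_iso_class:
  assumes "G \<in> hypergraphs r UNIV"
  shows "(G, rep (iso_class r G)) \<in> hypergraph_iso r"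
proof -
  have "G \<in> iso_class r G"
    using equiv_class_self[OF equiv_hypergraph_iso assms] by (simp add: iso_class_def)
  then have "rep (iso_class r G) \<in> iso_class r G" unfolding rep_def by (rule someI)
  then show ?thesis by (simp add: iso_class_def)
qed

lemma hom_density_iso_class:
  "F \<in> hypergraphs r UNIV \<Longrightarrow> G \<in> hypergraphs r UNIV \<Longrightarrow>
    hom_density r (iso_class r F) (iso_class r G) = lab_hom_density r F G"
  unfolding hom_density_def by (metis lab_hom_density_iso rep_iso_class)

lemma inj_density_iso_class:
  "F \<in> hypergraphs r UNIV \<Longrightarrow> G \<in> hypergraphs r UNIV \<Longrightarrow>
    inj_density r (iso_class r F) (iso_class r G) = lab_inj_density r F G"
  unfolding inj_density_def by (metis lab_inj_density_iso rep_iso_class)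

lemma num_vertices_iso_class:
  "G \<in> hypergraphs r UNIV \<Longrightarrow> num_vertices (iso_class r G) = card (fst G)"
  unfolding num_vertices_def by (metis card_vertices_iso rep_iso_class)

end

theory Submission
  imports Defs
begin

text \<open>
  All four conditions are equivalent to convergence of the expectations \<open>E t(F, G\<^sub>n)\<close> for all arrays
  \<open>F\<close> of continuous functions.  As \<open>t(F, \<cdot>)\<close> is multilinear in the entries of \<open>F\<close>, it is enough to
  have this for entries in \<open>\<F>\<close>, whose span is dense.  Products of densities are densities of
  disjoint unions, and injective densities differ from ordinary ones by \<open>O(1 / |V|)\<close>; so all
  polynomials in the densities have convergent expectations, and by the Stone-Weierstrass theorem
  all continuous functions on the space of limits do.  In the same way products of continuous
  functions of the entries determine the law of a labelled random sub-hypergraph with \<open>k\<close> vertices,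
  and conversely \<open>t\<^sub>i\<^sub>n\<^sub>j(F, \<cdot>)\<close> is an expectation over samples with \<open>|V(F)|\<close> vertices.  The limit law
  itself comes from sequential compactness: a compact metrizable space has a Borel embedding into
  the real line whose inverse is continuous on the closure of the range, which reduces the claim to
  Helly's selection theorem.
\<close>

subsection \<open>Borel sets of an abstract topology\<close>

text \<open>The hypothesis on sizes is used in the form that the expectation of
  \<open>1 / |V|\<close> tends to 0. Every error below is bounded pointwise by
  \<open>e + C / |V|\<close>, so non-injective maps and hypergraphs too small for a sample drop out
  in expectation. Convergence in distribution of a density gives convergence of its expectation
  because densities are bounded. The converse fails for a single density; only a family closed under
  products lets expectations determine laws, so all implications pass through the whole family at
  once. Unlabelled hypergraphs have unboundedly many vertices and do not form a compact space;
  compactness is therefore used on the space of limits and on the arrays over \<open>k\<close> fixed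
  vertices. A compact metrizable space, such as a square, need not embed continuously in the line. A
  Borel code suffices, since only its inverse has to be continuous to transfer test functions. The
  inverse must be controlled on the closure of the range because a limit law may charge points that
  are not codes.\<close>

lemma space_borel_of [simp]: "space (borel_of T) = topspace T"
  unfolding borel_of_def by (rule space_measure_of) (auto dest: openin_subset)

lemma sets_borel_of: "sets (borel_of T) = sigma_sets (topspace T) {U. openin T U}"
  unfolding borel_of_def by (rule sets_measure_of) (auto dest: openin_subset)

lemma borel_of_open: "openin T U \<Longrightarrow> U \<in> sets (borel_of T)"
  by (simp add: sets_borel_of sigma_sets.Basic)

lemma sets_borel_of_euclidean: "sets (borel_of (euclidean :: 'a::topological_space topology)) = sets borel"
  by (simp add: sets_borel_of borel_def sets_measure_of)

lemma measurable_borel_ofI: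
  assumes "f \<in> space M \<rightarrow> topspace T"
    and "\<And>U. openin T U \<Longrightarrow> f -` U \<inter> space M \<in> sets M"
  shows "f \<in> measurable M (borel_of T)"
  unfolding borel_of_def
  by (rule measurable_measure_of) (use assms in \<open>auto dest: openin_subset\<close>)

lemma continuous_map_measurable:
  assumes "continuous_map S T f"
  shows "f \<in> measurable (borel_of S) (borel_of T)"
proof (rule measurable_borel_ofI)
  show "f \<in> space (borel_of S) \<rightarrow> topspace T"
    using assms by (auto simp: continuous_map_def)
  fix U assume "openin T U"
  then have "openin S {x \<in> topspace S. f x \<in> U}"
    using assms by (auto simp: continuous_map_def)
  moreover have "f -` U \<inter> space (borel_of S) = {x \<in> topspace S. f x \<in> U}" by auto
  ultimately show "f -` U \<inter> space (borel_of S) \<in> sets (borel_of S)"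
    by (simp add: borel_of_open)
qed

lemma continuous_map_borel_measurable:
  fixes f :: "'a \<Rightarrow> 'b::topological_space"
  assumes "continuous_map T euclidean f"
  shows "f \<in> borel_measurable (borel_of T)"
  using continuous_map_measurable[OF assms]
  by (simp add: measurable_cong_sets[OF refl sets_borel_of_euclidean])

subsection \<open>Sequential compactness of the laws on a compact metrizable space\<close>

text \<open>Digits 0 and 1 in base 3, as for the Cantor set: sequences that differ at a given digit
  get codes at a definite distance, which binary expansions would not give.\<close>

definition ternary_code :: "(nat \<Rightarrow> bool) \<Rightarrow> real" where
  "ternary_code b = (\<Sum>k. of_bool (b k) * (1/3) ^ k)"

lemma summable_ternary: "summable (\<lambda>k. of_bool (b k) * (1/3::real) ^ k)"
  by (rule summable_comparison_test'[where g = "\<lambda>k. (1/3) ^ k" and N = 0])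
     (auto intro: summable_geometric)

lemma ternary_code_nonneg: "0 \<le> ternary_code b"
  unfolding ternary_code_def by (rule suminf_nonneg[OF summable_ternary]) auto

lemma ternary_code_le: "ternary_code b \<le> 2"
proof -
  have "ternary_code b \<le> (\<Sum>k. (1/3::real) ^ k)"
    unfolding ternary_code_def
    by (rule suminf_le[OF _ summable_ternary]) (auto intro: summable_geometric)
  also have "\<dots> = 3/2" by (subst suminf_geometric) auto
  finally show ?thesis by simp
qed

text \<open>The digit at \<open>l\<close> contributes \<open>(1/3) ^ l\<close>, and even if every
  later digit counts the other way, they take back only the geometric tail
  \<open>(1/3) ^ l / 2\<close>.\<close>

lemma ternary_code_first_difference:
  assumes "\<And>i. i < l \<Longrightarrow> b i = b' i" "b l" "\<not> b' l"
  shows "(1/3) ^ l / 2 \<le> ternary_code b - ternary_code b'"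
proof -
  define d where "d k = (of_bool (b k) - of_bool (b' k)) * (1/3::real) ^ k" for k
  have eq: "d k = of_bool (b k) * (1/3) ^ k - of_bool (b' k) * (1/3) ^ k" for k
    by (simp add: d_def algebra_simps)
  have sd: "summable d"
    unfolding eq by (intro summable_diff summable_ternary)
  have "ternary_code b - ternary_code b' = suminf d"
    unfolding ternary_code_def eq by (intro suminf_diff summable_ternary)
  also have "\<dots> = (\<Sum>i. d (i + Suc l)) + (\<Sum>i<Suc l. d i)"
    by (rule suminf_split_initial_segment[OF sd])
  also have "(\<Sum>i<Suc l. d i) = (1/3) ^ l"
    using assms by (simp add: d_def)
  finally have 1: "ternary_code b - ternary_code b' = (\<Sum>i. d (i + Suc l)) + (1/3) ^ l" .
  have "(\<Sum>i. - ((1/3) ^ Suc l * (1/3::real) ^ i)) \<le> (\<Sum>i. d (i + Suc l))"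
  proof (rule suminf_le)
    show "- ((1/3) ^ Suc l * (1/3::real) ^ i) \<le> d (i + Suc l)" for i
      by (simp add: d_def of_bool_def power_add)
    show "summable (\<lambda>i. - ((1/3) ^ Suc l * (1/3::real) ^ i))"
      by (intro summable_minus summable_mult summable_geometric) auto
    show "summable (\<lambda>i. d (i + Suc l))" using sd by (rule summable_ignore_initial_segment)
  qed
  moreover have "(\<Sum>i. - ((1/3) ^ Suc l * (1/3::real) ^ i)) = - ((1/3) ^ l / 2)"
    by (subst suminf_minus, intro summable_mult summable_geometric, simp,
        subst suminf_mult, intro summable_geometric, simp, subst suminf_geometric) auto
  ultimately show ?thesis using 1 by simp
qed

text \<open>The first disagreement may come earlier than \<open>k\<close>, but then the gap is only
  larger.\<close>

lemma ternary_code_separation: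
  assumes "b k \<noteq> b' k"
  shows "(1/3) ^ k / 2 \<le> \<bar>ternary_code b - ternary_code b'\<bar>"
proof -
  define l where "l = (LEAST i. b i \<noteq> b' i)"
  have l: "b l \<noteq> b' l" "l \<le> k"
    unfolding l_def using assms by (rule LeastI, rule Least_le)
  have less: "b i = b' i" if "i < l" for i
    using not_less_Least[of i "\<lambda>i. b i \<noteq> b' i"] that unfolding l_def by blast
  have "(1/3) ^ k / 2 \<le> (1/3::real) ^ l / 2"
    using l(2) by (auto intro: power_decreasing)
  also have "\<dots> \<le> \<bar>ternary_code b - ternary_code b'\<bar>"
  proof (cases "b l")
    case True
    then have "\<not> b' l" using l(1) by auto
    with True less have "(1/3) ^ l / 2 \<le> ternary_code b - ternary_code b'"
      by (intro ternary_code_first_difference) auto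
    then show ?thesis by linarith
  next
    case False
    then have "b' l" using l(1) by auto
    with False less have "(1/3) ^ l / 2 \<le> ternary_code b' - ternary_code b"
      by (intro ternary_code_first_difference) auto
    then show ?thesis by linarith
  qed
  finally show ?thesis .
qed

section \<open>Coding a compact space in the real line\<close>

text \<open>A sequence of continuous functions separating points stands in for a metric. It supplies
  the bits of the code and the generators in Stone-Weierstrass, and both compact spaces of the
  proof, limits and arrays, come with such a sequence.\<close>

locale separated_compact =
  fixes T :: "'a topology" and g :: "nat \<Rightarrow> 'a \<Rightarrow> real"
  assumes compact: "compact_space T"
    and cont: "\<And>j. continuous_map T euclideanreal (g j)"
    and sep: "\<And>x y. x \<in> topspace T \<Longrightarrow> y \<in> topspace T \<Longrightarrow> x \<noteq> y \<Longrightarrow> \<exists>j. g j x \<noteq> g j y"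
begin

text \<open>The index \<open>k\<close> encodes a function and a rational threshold. Two points
  separated by some function are told apart by a threshold strictly between its two values.\<close>

definition cut :: "nat \<Rightarrow> 'a \<Rightarrow> bool" where
  "cut k x = (real_of_rat (nat_to_rat_surj (snd (prod_decode k))) < g (fst (prod_decode k)) x)"

definition code :: "'a \<Rightarrow> real" where
  "code x = ternary_code (\<lambda>k. cut k x)"

text \<open>Each bit is the indicator of an open set, so the code is Borel, although it may jump
  where a threshold is crossed.\<close>

lemma code_measurable: "code \<in> borel_measurable (borel_of T)"
proof -
  have [measurable]: "g j \<in> borel_measurable (borel_of T)" for j
    by (rule continuous_map_borel_measurable[OF cont])
  show ?thesis
    unfolding code_def ternary_code_def cut_def by measurable
qed

text \<open>
  The inverse of \<open>code\<close> extends continuously to the closure of its range: the closure of the graph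
  is still the graph of a function, as \<open>cut k\<close> is determined by an approximate value of \<open>code\<close>.
\<close>

definition graph_closure :: "(real \<times> 'a) set" where
  "graph_closure =
     prod_topology euclideanreal T closure_of {(code x, x) | x. x \<in> topspace T}"

text \<open>If two points lay over the same \<open>c\<close>, a rational threshold between their
  values under some \<open>g j\<close> would give a bit on which points near the one disagree with
  points near the other, forcing codes close to \<open>c\<close> to be far apart.\<close>

lemma graph_closure_unique:
  assumes "(c, x) \<in> graph_closure" "(c, y) \<in> graph_closure"
  shows "x = y"
proof (rule ccontr)
  assume ne: "x \<noteq> y"
  have *: False if xc: "(c, x) \<in> graph_closure" and yc: "(c, y) \<in> graph_closure"
    and less: "g j x < g j y" for j x y
  proof -
    obtain q where q: "g j x < real_of_rat q" "real_of_rat q < g j y"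
      using of_rat_dense[OF less] by auto
    obtain i where i: "nat_to_rat_surj i = q"
      using surj_nat_to_rat_surj by (metis surjD)
    define k where "k = prod_encode (j, i)"
    have cut: "cut k z \<longleftrightarrow> real_of_rat q < g j z" for z
      by (simp add: cut_def k_def i)
    \<comment> \<open>Half of the separation \<open>(1/3) ^ k / 2\<close> that a disagreement at bit
      \<open>k\<close> forces, so two codes within \<open>e\<close> of \<open>c\<close> are too
      close to each other.\<close>
    define e where "e = (1/3::real) ^ k / 4"
    have e: "e > 0" by (simp add: e_def)
    have near: "\<exists>z\<in>topspace T. \<bar>code z - c\<bar> < e \<and> g j z \<in> U"
      if "(c, z) \<in> graph_closure" "g j z \<in> U" "open U" for z U
    proof -
      have z: "z \<in> topspace T" using that(1)
        by (auto simp: graph_closure_def in_closure_of)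
      have "openin T {x \<in> topspace T. g j x \<in> U}"
        by (rule openin_continuous_map_preimage[OF cont]) (use that in simp)
      then have "openin (prod_topology euclideanreal T) ({c - e<..<c + e} \<times> {x \<in> topspace T. g j x \<in> U})"
        by (subst openin_prod_Times_iff) auto
      moreover have "(c, z) \<in> {c - e<..<c + e} \<times> {x \<in> topspace T. g j x \<in> U}"
        using e z that by auto
      ultimately have "\<exists>w\<in>{(code x, x) | x. x \<in> topspace T}.
        w \<in> {c - e<..<c + e} \<times> {x \<in> topspace T. g j x \<in> U}"
        using that(1) unfolding graph_closure_def in_closure_of by (metis (no_types, lifting))
      then obtain b where "b \<in> topspace T" "c - e < code b" "code b < c + e" "g j b \<in> U" by auto
      then show ?thesis by (intro bexI[of _ b]) auto
    qed
    obtain x' where x': "\<bar>code x' - c\<bar> < e" "g j x' < real_of_rat q"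
      using near[OF xc, of "{..<real_of_rat q}"] q by auto
    obtain y' where y': "\<bar>code y' - c\<bar> < e" "real_of_rat q < g j y'"
      using near[OF yc, of "{real_of_rat q<..}"] q by auto
    have "\<bar>code x' - code y'\<bar> \<ge> (1/3) ^ k / 2"
      unfolding code_def by (rule ternary_code_separation) (use x' y' cut in auto)
    moreover have "(1/3) ^ k / 2 = 2 * e" by (simp add: e_def)
    ultimately show False using x'(1) y'(1) by arith
  qed
  have "x \<in> topspace T" "y \<in> topspace T"
    using assms by (auto simp: graph_closure_def in_closure_of)
  from sep[OF this ne] obtain j where "g j x \<noteq> g j y" by auto
  then show False using *[of x y j] *[of y x j] assms by linarith
qed

definition code_range :: "real set" where "code_range = fst ` graph_closure"

lemma closedin_graph_closure: "closedin (prod_topology euclideanreal T) graph_closure"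
  by (simp add: graph_closure_def)

text \<open>Projection along the compact factor \<open>T\<close> is a closed map.\<close>

lemma closed_section:
  assumes "closedin T V"
  shows "closed {c. \<exists>x\<in>V. (c, x) \<in> graph_closure}"
proof -
  have "closedin (prod_topology euclideanreal T) (UNIV \<times> V)"
    using assms by (simp add: closedin_prod_Times_iff)
  then have "closedin (prod_topology euclideanreal T) (graph_closure \<inter> UNIV \<times> V)"
    by (intro closedin_Int closedin_graph_closure)
  then have "closedin euclideanreal (fst ` (graph_closure \<inter> UNIV \<times> V))"
    using closed_map_fst[OF compact, of euclideanreal] unfolding closed_map_def by blast
  moreover have "fst ` (graph_closure \<inter> UNIV \<times> V) = {c. \<exists>x\<in>V. (c, x) \<in> graph_closure}"
    by force
  ultimately show ?thesis by simp
qed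

lemma graph_closure_topspace: "(c, x) \<in> graph_closure \<Longrightarrow> x \<in> topspace T"
  by (auto simp: graph_closure_def in_closure_of)

lemma closed_code_range: "closed code_range"
proof -
  have "code_range = {c. \<exists>x\<in>topspace T. (c, x) \<in> graph_closure}"
    unfolding code_range_def using graph_closure_topspace by force
  then show ?thesis using closed_section[of "topspace T"] by simp
qed

lemma code_in_graph_closure: "x \<in> topspace T \<Longrightarrow> (code x, x) \<in> graph_closure"
  unfolding graph_closure_def by (rule subsetD[OF closure_of_subset]) auto

definition decode :: "real \<Rightarrow> 'a" where
  "decode c = (THE x. (c, x) \<in> graph_closure)"

lemma decode_eq: "(c, x) \<in> graph_closure \<Longrightarrow> decode c = x"
  unfolding decode_def using graph_closure_unique by blast

lemma decode_code: "x \<in> topspace T \<Longrightarrow> decode (code x) = x"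
  by (rule decode_eq[OF code_in_graph_closure])

lemma code_in_range: "x \<in> topspace T \<Longrightarrow> code x \<in> code_range"
  using code_in_graph_closure by (force simp: code_range_def)

lemma decode_in_graph: "c \<in> code_range \<Longrightarrow> (c, decode c) \<in> graph_closure"
  by (auto simp: code_range_def decode_eq)

text \<open>Preimages of closed sets under \<open>decode\<close> are projections of closed parts of
  its closed graph.\<close>

lemma continuous_map_decode: "continuous_map (top_of_set code_range) T decode"
proof (unfold continuous_map_closedin, intro conjI ballI allI impI)
  show "decode \<in> topspace (top_of_set code_range) \<rightarrow> topspace T"
    using graph_closure_topspace[OF decode_in_graph] by auto
  fix V assume V: "closedin T V"
  have "{c \<in> topspace (top_of_set code_range). decode c \<in> V} =
    code_range \<inter> {c. \<exists>x\<in>V. (c, x) \<in> graph_closure}"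
    using decode_in_graph by (auto simp: decode_eq)
  then show "closedin (top_of_set code_range) {c \<in> topspace (top_of_set code_range). decode c \<in> V}"
    using closed_section[OF V] by (simp add: closedin_closed_Int)
qed

text \<open>The limit law on the line may charge points that are not codes, but it never leaves the
  closed set \<open>code_range\<close>, so \<open>decode\<close> still sends it back to
  \<open>T\<close>.\<close>

theorem weak_subsequence:
  assumes prob: "\<And>n. prob_space (\<mu> n)" and sets_mu: "\<And>n. sets (\<mu> n) = sets (borel_of T)"
  shows "\<exists>\<rho> N. strict_mono (\<rho> :: nat \<Rightarrow> nat) \<and> weak_limit T (\<mu> \<circ> \<rho>) N"
proof -
  define \<nu> where "\<nu> n = distr (\<mu> n) borel code" for n
  have sp: "space (\<mu> n) = topspace T" for n
    using sets_eq_imp_space_eq[OF sets_mu] by simp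
  have cm: "code \<in> borel_measurable (\<mu> n)" for n
    using code_measurable by (simp add: measurable_cong_sets[OF sets_mu refl])
  have rd: "real_distribution (\<nu> n)" for n
    unfolding \<nu>_def real_distribution_def real_distribution_axioms_def
    using prob_space.prob_space_distr[OF prob cm] by simp
  have nu_UNIV: "measure (\<nu> n) A = 1" if "{0..2} \<subseteq> A" "A \<in> sets borel" for n A
  proof -
    have "code -` A \<inter> space (\<mu> n) = space (\<mu> n)"
      using subsetD[OF that(1)] ternary_code_nonneg ternary_code_le by (auto simp: code_def)
    then show ?thesis
      unfolding \<nu>_def using that(2)
      by (simp add: measure_distr[OF cm] prob_space.prob_space[OF prob])
  qed
  \<comment> \<open>All codes lie in \<open>{0..2}\<close>, so a single bounded interval carries
    every law.\<close>
  have "tight \<nu>"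
    unfolding tight_def
  proof (intro conjI allI impI rd)
    fix e :: real assume "e > 0"
    moreover have "measure (\<nu> n) {-1<..3} = 1" for n by (rule nu_UNIV) auto
    ultimately have "\<forall>n. 1 - e < measure (\<nu> n) {-1<..3}" by simp
    then show "\<exists>a b. a < b \<and> (\<forall>n. 1 - e < measure (\<nu> n) {a<..b})"
      by (intro exI[of _ "-1"] exI[of _ 3]) auto
  qed
  from tight_imp_convergent_subsubsequence[OF this strict_mono_id]
  obtain \<rho> L where \<rho>: "strict_mono \<rho>" and L: "real_distribution L"
    and wc: "weak_conv_m (\<nu> \<circ> \<rho>) L" by (auto simp: comp_def)
  interpret L: real_distribution L by (rule L)
  have conv: "(\<lambda>n. \<integral>y. \<phi> y \<partial>(\<nu> (\<rho> n))) \<longlonglongrightarrow> (\<integral>y. \<phi> y \<partial>L)"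
    if "continuous_on UNIV \<phi>" "\<And>y. \<bar>\<phi> y\<bar> \<le> B" for \<phi> :: "real \<Rightarrow> real" and B
    using weak_conv_imp_integral_bdd_continuous_conv[of "\<nu> \<circ> \<rho>" L \<phi> B] rd L wc that
    by (simp add: continuous_on_eq_continuous_at)
  have distr_int: "(\<integral>y. \<phi> y \<partial>(\<nu> n)) = (\<integral>x. \<phi> (code x) \<partial>(\<mu> n))"
    if "\<phi> \<in> borel_measurable borel" for \<phi> :: "real \<Rightarrow> real" and n
    unfolding \<nu>_def by (rule integral_distr[OF cm that])
  have ne: "topspace T \<noteq> {}"
    using prob_space.not_empty[OF prob] sp by auto
  then have Cne: "code_range \<noteq> {}" using code_in_range by blast
  \<comment> \<open>Truncated distance to \<open>code_range\<close>. It vanishes on all codes, so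
    weak convergence forces its integral under \<open>L\<close> to be 0 and \<open>L\<close> to live
    on \<open>code_range\<close>.\<close>
  define \<psi> where "\<psi> y = min 1 (setdist {y} code_range)" for y
  have \<psi>c: "continuous_on UNIV \<psi>"
    unfolding \<psi>_def by (intro continuous_intros continuous_on_setdist)
  have \<psi>b: "0 \<le> \<psi> y" "\<psi> y \<le> 1" for y by (auto simp: \<psi>_def setdist_pos_le)
  have \<psi>m: "\<psi> \<in> borel_measurable borel" by (rule borel_measurable_continuous_onI[OF \<psi>c])
  have "(\<integral>y. \<psi> y \<partial>(\<nu> n)) = 0" for n
  proof -
    have "(\<integral>x. \<psi> (code x) \<partial>(\<mu> n)) = (\<integral>x. 0 \<partial>(\<mu> n))"
      by (rule Bochner_Integration.integral_cong)
         (auto simp: sp \<psi>_def setdist_sing_in_set code_in_range)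
    then show ?thesis by (simp add: distr_int[OF \<psi>m])
  qed
  then have "(\<integral>y. \<psi> y \<partial>L) = 0"
    using conv[OF \<psi>c, of 1] \<psi>b by (simp add: LIMSEQ_const_iff)
  moreover have "integrable L \<psi>"
    by (rule L.integrable_const_bound[of _ 1]) (use \<psi>b \<psi>m in auto)
  ultimately have "AE y in L. \<psi> y = 0"
    using integral_nonneg_eq_0_iff_AE[of L \<psi>] \<psi>b by auto
  then have AEC: "AE y in L. y \<in> code_range"
  proof eventually_elim
    fix y assume "\<psi> y = 0"
    then have "setdist {y} code_range = 0" by (auto simp: \<psi>_def min_def split: if_splits)
    then show "y \<in> code_range"
      using setdist_eq_0_sing_1[of y code_range] Cne closed_code_range by auto
  qed
  obtain x0 where x0: "x0 \<in> topspace T" using ne by blast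
  \<comment> \<open>Off \<open>code_range\<close>, an \<open>L\<close>-null set, any value will do;
    a fixed point \<open>x0\<close> keeps the map total and Borel.\<close>
  define dec where "dec y = (if y \<in> code_range then decode y else x0)" for y
  have dec_m: "dec \<in> measurable L (borel_of T)"
  proof (rule measurable_borel_ofI)
    show "dec \<in> space L \<rightarrow> topspace T"
      using graph_closure_topspace[OF decode_in_graph] x0 by (auto simp: dec_def)
    fix U assume U: "openin T U"
    have Cb: "code_range \<in> sets borel" using closed_code_range by simp
    have "openin (top_of_set code_range) {c \<in> topspace (top_of_set code_range). decode c \<in> U}"
      by (rule openin_continuous_map_preimage[OF continuous_map_decode U])
    then obtain W where W: "open W" "{c \<in> code_range. decode c \<in> U} = code_range \<inter> W"
      by (auto simp: openin_open)
    have "dec -` U \<inter> space L = (code_range \<inter> W) \<union> (if x0 \<in> U then - code_range else {})"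
      unfolding W(2)[symmetric] by (auto simp: dec_def split: if_splits)
    then show "dec -` U \<inter> space L \<in> sets L" using Cb W(1) by auto
  qed
  define N where "N = distr L (borel_of T) dec"
  have "weak_limit T (\<mu> \<circ> \<rho>) N"
    unfolding weak_limit_def
  proof (intro conjI allI impI)
    show "prob_space N" unfolding N_def by (rule L.prob_space_distr[OF dec_m])
    show "sets N = sets (borel_of T)" by (simp add: N_def)
    fix f assume f: "continuous_map T euclideanreal f \<and> bounded (f ` topspace T)"
    then obtain B where B: "\<And>x. x \<in> topspace T \<Longrightarrow> \<bar>f x\<bar> \<le> B"
      by (auto simp: bounded_iff)
    have B0: "0 \<le> B" using B[OF x0] by linarith
    have "continuous_map (top_of_set code_range) euclideanreal (f \<circ> decode)"
      using f continuous_map_compose[OF continuous_map_decode] by blast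
    then have "continuous_on code_range (f \<circ> decode)" by simp
    moreover have "norm ((f \<circ> decode) c) \<le> B" if "c \<in> code_range" for c
      using B graph_closure_topspace[OF decode_in_graph[OF that]] by simp
    \<comment> \<open>Tietze extension: \<open>f \<circ> decode\<close> is continuous on
      \<open>code_range\<close> only, while weak convergence tests against bounded continuous
      functions on the whole line.\<close>
    ultimately obtain h where h: "continuous_on UNIV h"
      "\<And>c. c \<in> code_range \<Longrightarrow> h c = (f \<circ> decode) c" "\<And>c. norm (h c) \<le> B"
      using Tietze[of code_range "f \<circ> decode" UNIV B] closed_code_range B0 by auto
    have hm: "h \<in> borel_measurable borel" by (rule borel_measurable_continuous_onI[OF h(1)])
    have "(\<integral>x. f x \<partial>((\<mu> \<circ> \<rho>) n)) = (\<integral>y. h y \<partial>(\<nu> (\<rho> n)))" for n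
      unfolding distr_int[OF hm] comp_def
      by (rule Bochner_Integration.integral_cong) (auto simp: sp h(2) code_in_range decode_code)
    moreover have "(\<integral>x. f x \<partial>N) = (\<integral>y. h y \<partial>L)"
    proof -
      have fm: "f \<in> borel_measurable (borel_of T)"
        using f by (intro continuous_map_borel_measurable) auto
      have "(\<integral>x. f x \<partial>N) = (\<integral>y. f (dec y) \<partial>L)"
        unfolding N_def by (rule integral_distr[OF dec_m fm])
      also have "\<dots> = (\<integral>y. h y \<partial>L)"
        by (rule integral_cong_AE)
           (use AEC hm measurable_compose[OF dec_m fm] in \<open>auto simp: dec_def h(2)\<close>)
      finally show ?thesis .
    qed
    ultimately show "(\<lambda>n. \<integral>x. f x \<partial>((\<mu> \<circ> \<rho>) n)) \<longlonglongrightarrow> (\<integral>x. f x \<partial>N)"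
      using conv[OF h(1), of B] h(3) by simp
  qed
  then show ?thesis using \<rho> by blast
qed

section \<open>Stone-Weierstrass and the method of moments\<close>

text \<open>The sequence of all \<open>g j\<close> is a homeomorphism onto a compact set of real
  sequences, where the classical theorem applies; \<open>R\<close> is carried over by composing with
  the inverse.\<close>

theorem Stone_Weierstrass:
  assumes const: "\<And>c. (\<lambda>_. c) \<in> R"
    and cont_R: "\<And>p. p \<in> R \<Longrightarrow> continuous_map T euclideanreal p"
    and add: "\<And>p q. p \<in> R \<Longrightarrow> q \<in> R \<Longrightarrow> (\<lambda>x. p x + q x) \<in> R"
    and mult: "\<And>p q. p \<in> R \<Longrightarrow> q \<in> R \<Longrightarrow> (\<lambda>x. p x * q x) \<in> R"
    and gen: "\<And>j. g j \<in> R"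
    and f: "continuous_map T euclideanreal f" and e: "0 < e"
  shows "\<exists>p\<in>R. \<forall>x\<in>topspace T. \<bar>f x - p x\<bar> < e"
proof -
  define h where "h x = (\<lambda>j. g j x)" for x
  have hc: "continuous_map T euclidean h"
    using cont by (auto simp: h_def euclidean_product_topology[symmetric] continuous_map_componentwise_UNIV)
  have inj: "inj_on h (topspace T)"
    using sep by (force simp: inj_on_def h_def fun_eq_iff)
  have comp: "compact (h ` topspace T)"
    using image_compactin[OF _ hc, of "topspace T"] compact by (simp add: compact_space_def)
  define k where "k = inv_into (topspace T) h"
  have kh: "k (h x) = x" if "x \<in> topspace T" for x
    using inv_into_f_f[OF inj that] by (simp add: k_def)
  \<comment> \<open>Closed sets of \<open>T\<close> are compact, and so are their images, which are
    therefore closed: the continuous injection \<open>h\<close> has a continuous inverse on its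
    range.\<close>
  have k: "continuous_map (top_of_set (h ` topspace T)) T k"
  proof (unfold continuous_map_closedin, intro conjI ballI allI impI)
    show "k \<in> topspace (top_of_set (h ` topspace T)) \<rightarrow> topspace T" using kh by auto
    fix V assume V: "closedin T V"
    have "closed (h ` V)"
      using image_compactin[OF closedin_compact_space[OF compact V] hc] by (simp add: compact_imp_closed)
    moreover have "{x \<in> topspace (top_of_set (h ` topspace T)). k x \<in> V} = h ` topspace T \<inter> h ` V"
      using kh closedin_subset[OF V] by auto
    ultimately show "closedin (top_of_set (h ` topspace T))
        {x \<in> topspace (top_of_set (h ` topspace T)). k x \<in> V}"
      by (simp add: closedin_closed_Int)
  qed
  have via_k: "continuous_on (h ` topspace T) (p \<circ> k)" if "continuous_map T euclideanreal p" for p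
    using continuous_map_compose[OF k that] by simp
  have "\<exists>q. (\<exists>p\<in>R. q = p \<circ> k) \<and> (\<forall>y\<in>h ` topspace T. \<bar>(f \<circ> k) y - q y\<bar> < e)"
  proof (rule Stone_Weierstrass_HOL[OF comp])
    show "\<exists>p\<in>R. (\<lambda>_. c) = p \<circ> k" for c
      by (rule bexI[OF _ const[of c]]) auto
    show "continuous_on (h ` topspace T) q" if "\<exists>p\<in>R. q = p \<circ> k" for q
      using that via_k cont_R by auto
    show "\<exists>p\<in>R. (\<lambda>x. q x + q' x) = p \<circ> k"
      if "(\<exists>p\<in>R. q = p \<circ> k) \<and> (\<exists>p\<in>R. q' = p \<circ> k)" for q q'
    proof -
      from that obtain p p' where p: "p \<in> R" "p' \<in> R" "q = p \<circ> k" "q' = p' \<circ> k" by blast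
      show ?thesis by (rule bexI[OF _ add[OF p(1,2)]]) (auto simp: p)
    qed
    show "\<exists>p\<in>R. (\<lambda>x. q x * q' x) = p \<circ> k"
      if "(\<exists>p\<in>R. q = p \<circ> k) \<and> (\<exists>p\<in>R. q' = p \<circ> k)" for q q'
    proof -
      from that obtain p p' where p: "p \<in> R" "p' \<in> R" "q = p \<circ> k" "q' = p' \<circ> k" by blast
      show ?thesis by (rule bexI[OF _ mult[OF p(1,2)]]) (auto simp: p)
    qed
    show "\<exists>q. (\<exists>p\<in>R. q = p \<circ> k) \<and> q x \<noteq> q y"
      if "x \<in> h ` topspace T \<and> y \<in> h ` topspace T \<and> x \<noteq> y" for x y
    proof -
      from that obtain a b where ab: "x = h a" "y = h b" "a \<in> topspace T" "b \<in> topspace T" by auto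
      have "a \<noteq> b" using that ab by auto
      then obtain j where "g j a \<noteq> g j b" using sep[of a b] ab by auto
      then show ?thesis using gen[of j] ab kh by (intro exI[of _ "g j \<circ> k"]) auto
    qed
  qed (use via_k[OF f] e in auto)
  then obtain p where "p \<in> R" "\<forall>y\<in>h ` topspace T. \<bar>(f \<circ> k) y - (p \<circ> k) y\<bar> < e" by blast
  then show ?thesis using kh by (intro bexI[of _ p]) auto
qed

text \<open>Compactness supplies a limit law only along a subsequence. Approximation from
  \<open>R\<close> makes the integrals of every continuous function Cauchy, so the whole sequence
  follows the subsequence.\<close>

theorem method_of_moments:
  assumes const: "\<And>c. (\<lambda>_. c) \<in> R"
    and cont_R: "\<And>p. p \<in> R \<Longrightarrow> continuous_map T euclideanreal p"
    and add: "\<And>p q. p \<in> R \<Longrightarrow> q \<in> R \<Longrightarrow> (\<lambda>x. p x + q x) \<in> R"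
    and mult: "\<And>p q. p \<in> R \<Longrightarrow> q \<in> R \<Longrightarrow> (\<lambda>x. p x * q x) \<in> R"
    and gen: "\<And>j. g j \<in> R"
    and prob: "\<And>n. prob_space (\<mu> n)" and sets_mu: "\<And>n. sets (\<mu> n) = sets (borel_of T)"
    and conv: "\<And>p. p \<in> R \<Longrightarrow> convergent (\<lambda>n. \<integral>x. p x \<partial>\<mu> n)"
  shows "\<exists>N. weak_limit T \<mu> N"
proof -
  obtain \<rho> N where \<rho>: "strict_mono \<rho>" and N: "weak_limit T (\<mu> \<circ> \<rho>) N"
    using weak_subsequence[of \<mu>, OF prob sets_mu] by blast
  have sp: "space (\<mu> n) = topspace T" for n
    using sets_eq_imp_space_eq[OF sets_mu] by simp
  have bdd: "bounded (f ` topspace T)" if "continuous_map T euclideanreal f" for f :: "'a \<Rightarrow> real"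
    using image_compactin[OF _ that, of "topspace T"] compact
    by (simp add: compact_space_def compact_imp_bounded)
  have int: "integrable (\<mu> n) f" if f: "continuous_map T euclideanreal f" for f :: "'a \<Rightarrow> real" and n
  proof -
    obtain B where B: "\<And>x. x \<in> topspace T \<Longrightarrow> norm (f x) \<le> B"
      using bdd[OF f] by (auto simp: bounded_iff)
    have "f \<in> borel_measurable (\<mu> n)"
      using continuous_map_borel_measurable[OF f] by (simp add: measurable_cong_sets[OF sets_mu refl])
    moreover have "AE x in \<mu> n. norm (f x) \<le> B" using B by (auto simp: sp intro!: AE_I2)
    ultimately show ?thesis
      using finite_measure.integrable_const_bound[of "\<mu> n" f B] prob_space.finite_measure[OF prob, of n]
      by blast
  qed
  have "(\<lambda>n. \<integral>x. f x \<partial>\<mu> n) \<longlonglongrightarrow> (\<integral>x. f x \<partial>N)" if f: "continuous_map T euclideanreal f" for f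
  proof -
    have "Cauchy (\<lambda>n. \<integral>x. f x \<partial>\<mu> n)"
    proof (rule metric_CauchyI)
      fix e :: real assume "0 < e"
      then have e: "0 < e / 3" by simp
      obtain p where p: "p \<in> R" and fp: "\<And>x. x \<in> topspace T \<Longrightarrow> \<bar>f x - p x\<bar> < e / 3"
        using Stone_Weierstrass[OF const cont_R add mult gen f e] by blast
      have near: "\<bar>(\<integral>x. f x \<partial>\<mu> n) - (\<integral>x. p x \<partial>\<mu> n)\<bar> \<le> e / 3" for n
      proof -
        interpret prob_space "\<mu> n" by (rule prob)
        have i: "integrable (\<mu> n) (\<lambda>x. f x - p x)"
          using int f cont_R[OF p] by (intro Bochner_Integration.integrable_diff) auto
        have "\<bar>\<integral>x. f x - p x \<partial>\<mu> n\<bar> \<le> (\<integral>x. \<bar>f x - p x\<bar> \<partial>\<mu> n)" by (rule integral_abs_bound)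
        also have "\<dots> \<le> e / 3"
          using i fp by (intro integral_le_const integrable_abs AE_I2) (auto simp: sp intro!: less_imp_le)
        finally show ?thesis using int f cont_R[OF p] by simp
      qed
      obtain M where M: "\<And>m n. M \<le> m \<Longrightarrow> M \<le> n \<Longrightarrow> dist (\<integral>x. p x \<partial>\<mu> m) (\<integral>x. p x \<partial>\<mu> n) < e / 3"
        using metric_CauchyD[OF convergent_Cauchy[OF conv[OF p]] e] by blast
      have "dist (\<integral>x. f x \<partial>\<mu> m) (\<integral>x. f x \<partial>\<mu> n) < e" if "M \<le> m" "M \<le> n" for m n
        using near[of m] near[of n] M[OF that] unfolding dist_real_def by linarith
      then show "\<exists>M. \<forall>m\<ge>M. \<forall>n\<ge>M. dist (\<integral>x. f x \<partial>\<mu> m) (\<integral>x. f x \<partial>\<mu> n) < e" by blast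
    qed
    then obtain L where L: "(\<lambda>n. \<integral>x. f x \<partial>\<mu> n) \<longlonglongrightarrow> L"
      using convergent_eq_Cauchy by blast
    have "(\<lambda>n. \<integral>x. f x \<partial>\<mu> (\<rho> n)) \<longlonglongrightarrow> (\<integral>x. f x \<partial>N)"
      using N f bdd[OF f] by (auto simp: weak_limit_def comp_def)
    moreover have "(\<lambda>n. \<integral>x. f x \<partial>\<mu> (\<rho> n)) \<longlonglongrightarrow> L"
      using LIMSEQ_subseq_LIMSEQ[OF L \<rho>] by (simp add: comp_def)
    ultimately show ?thesis using L LIMSEQ_unique by blast
  qed
  then have "weak_limit T \<mu> N" using N by (auto simp: weak_limit_def)
  then show ?thesis by blast
qed

end

subsection \<open>Densities as continuous functions\<close>

lemma finite_tuples: "finite V \<Longrightarrow> finite (tuples r V)"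
  unfolding tuples_def by (rule finite_lists_length_eq)

lemma hypergraphsD:
  assumes "G \<in> hypergraphs r S"
  shows "finite (fst G)" "fst G \<noteq> {}" "snd G \<in> tuples r (fst G) \<rightarrow>\<^sub>E S" "card (fst G) > 0"
  using assms by (auto simp: hypergraphs_def card_gt_0_iff)

lemma hypergraphs_pair [simp]:
  "(V, a) \<in> hypergraphs r S \<longleftrightarrow> finite V \<and> V \<noteq> {} \<and> a \<in> tuples r V \<rightarrow>\<^sub>E S"
  by (auto simp: hypergraphs_def)

lemma iso_class_in: "G \<in> hypergraphs r S \<Longrightarrow> iso_class r G \<in> unlabelled r S"
  by (auto simp: unlabelled_def iso_class_def intro: quotientI)

lemma unlabelledE:
  assumes "C \<in> unlabelled r S"
  obtains G where "G \<in> hypergraphs r S" "C = iso_class r G"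
  using assms by (auto simp: unlabelled_def iso_class_def elim: quotientE)

lemma hypergraphs_mono: "S \<subseteq> S' \<Longrightarrow> hypergraphs r S \<subseteq> hypergraphs r S'"
  unfolding hypergraphs_def by (intro Sigma_mono PiE_mono) auto

lemma unlabelled_mono:
  assumes "S \<subseteq> S'" shows "unlabelled r S \<subseteq> unlabelled r S'"
proof
  fix C assume "C \<in> unlabelled r S"
  then obtain G where "G \<in> hypergraphs r S" "C = iso_class r G" by (rule unlabelledE)
  then show "C \<in> unlabelled r S'" using hypergraphs_mono[OF assms, of r] by (auto intro: iso_class_in)
qed

lemma rep_unlabelled:
  assumes "C \<in> unlabelled r UNIV"
  shows "rep C \<in> hypergraphs r UNIV" "iso_class r (rep C) = C"
proof -
  obtain G where G: "G \<in> hypergraphs r UNIV" "C = iso_class r G"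
    using assms by (rule unlabelledE)
  have i: "(G, rep C) \<in> hypergraph_iso r" using rep_iso_class[OF G(1)] G(2) by simp
  show "rep C \<in> hypergraphs r UNIV" using i by (auto simp: hypergraph_iso_def)
  show "iso_class r (rep C) = C"
    using equiv_class_eq[OF equiv_hypergraph_iso i] G(2) by (simp add: iso_class_def)
qed

lemma iso_class_eq: "(G, H) \<in> hypergraph_iso r \<Longrightarrow> iso_class r G = iso_class r H"
  using equiv_class_eq[OF equiv_hypergraph_iso] by (simp add: iso_class_def)

lemma num_vertices_pos: "C \<in> unlabelled r UNIV \<Longrightarrow> num_vertices C > 0"
  unfolding num_vertices_def by (rule hypergraphsD(4)[OF rep_unlabelled(1)])

abbreviation arrays :: "nat \<Rightarrow> nat set \<Rightarrow> (nat list \<Rightarrow> 'k::topological_space) topology" where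
  "arrays r V \<equiv> product_topology (\<lambda>_. euclidean) (tuples r V)"

text \<open>In a topological sum, continuity is tested on one vertex set at a time, where a
  hypergraph is just its array.\<close>

lemma continuous_map_labelledI:
  assumes "\<And>V. finite V \<Longrightarrow> V \<noteq> {} \<Longrightarrow>
    continuous_map (arrays r V) T (\<lambda>a. f (V, a))"
  shows "continuous_map (labelled_topology r :: 'a::topological_space hypergraph topology) T f"
  unfolding continuous_map_def
proof (intro conjI allI impI)
  show "f \<in> topspace (labelled_topology r) \<rightarrow> topspace T"
  proof
    fix G :: "'a hypergraph" assume "G \<in> topspace (labelled_topology r)"
    then have G: "G \<in> hypergraphs r UNIV" by (simp add: topspace_labelled_topology)
    have "snd G \<in> topspace (arrays r (fst G))"
      using hypergraphsD(3)[OF G] by simp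
    then have "f (fst G, snd G) \<in> topspace T"
      using assms[OF hypergraphsD(1,2)[OF G]] unfolding continuous_map_def by blast
    then show "f G \<in> topspace T" by simp
  qed
  fix U assume U: "openin T U"
  show "openin (labelled_topology r) {x \<in> topspace (labelled_topology r). f x \<in> U}"
    unfolding labelled_topology_def openin_sum_topology
  proof (intro conjI ballI)
    fix V :: "nat set" assume V: "V \<in> {V. finite V \<and> V \<noteq> {}}"
    then have "openin (arrays r V)
      {a \<in> topspace (arrays r V). f (V, a) \<in> U}"
      using assms U by (intro openin_continuous_map_preimage) auto
    moreover have "{a \<in> topspace (arrays r V). f (V, a) \<in> U} =
      {x. (V, x) \<in> {x \<in> topspace (sum_topology (\<lambda>V. arrays r V)
         {V. finite V \<and> V \<noteq> {}}). f x \<in> U}}"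
      using V by auto
    ultimately show "openin (arrays r V)
      {x. (V, x) \<in> {x \<in> topspace (sum_topology (\<lambda>V. arrays r V)
         {V. finite V \<and> V \<noteq> {}}). f x \<in> U}}" by simp
  qed auto
qed

lemma continuous_map_labelled_inject:
  assumes "finite V" "V \<noteq> {}"
  shows "continuous_map (arrays r V) (labelled_topology r) (\<lambda>a. (V, a))"
  unfolding labelled_topology_def
  using continuous_map_component_injection[of V "{V. finite V \<and> V \<noteq> {}}"
      "\<lambda>V. arrays r V"] assms by simp

lemma continuous_map_iso_class: "continuous_map (labelled_topology r) (unlabelled_topology r) (iso_class r)"
  by (rule quotient_imp_continuous_map[OF quotient_map_iso_class])

text \<open>Functions defined through \<open>rep\<close> inherit no continuity from it, as it is an
  arbitrary choice. Continuity is read off from a formula \<open>f\<close> on labelled hypergraphs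
  and descends along the quotient map.\<close>

lemma continuous_map_unlabelledI:
  assumes "continuous_map (labelled_topology r) T f"
    and "\<And>G. G \<in> hypergraphs r UNIV \<Longrightarrow> p (iso_class r G) = f G"
  shows "continuous_map (unlabelled_topology r) T p"
proof (rule continuous_compose_quotient_map[OF quotient_map_iso_class])
  show "continuous_map (labelled_topology r) T (p \<circ> iso_class r)"
    by (rule continuous_map_eq[OF assms(1)]) (simp add: assms(2) topspace_labelled_topology)
qed

lemma continuous_map_apply_bcontfun:
  assumes "continuous_map T euclidean h"
  shows "continuous_map T euclideanreal (\<lambda>x. apply_bcontfun f (h x))"
proof -
  have "continuous_map euclidean euclideanreal (apply_bcontfun f)"
    by (simp add: continuous_on_apply_bcontfun)
  from continuous_map_compose[OF assms this] show ?thesis by (simp add: comp_def)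
qed

lemma continuous_map_term:
  assumes V: "finite V" and \<phi>: "\<phi> \<in> V \<rightarrow> W"
  shows "continuous_map (arrays r W) euclideanreal
    (\<lambda>a. \<Prod>i\<in>tuples r V. apply_bcontfun (F i) (a (map \<phi> i)))"
proof (rule continuous_map_prod[OF finite_tuples[OF V]])
  fix i assume i: "i \<in> tuples r V"
  have "map \<phi> i \<in> tuples r W" by (rule map_tuples[OF _ i]) (use \<phi> in auto)
  then show "continuous_map (arrays r W) euclideanreal
    (\<lambda>a. apply_bcontfun (F i) (a (map \<phi> i)))"
    by (intro continuous_map_apply_bcontfun continuous_map_product_projection)
qed

lemma continuous_map_hom_sum:
  assumes F: "finite (fst F)" and W: "finite W" and \<Phi>: "\<Phi> \<subseteq> fst F \<rightarrow>\<^sub>E W"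
  shows "continuous_map (arrays r W) euclideanreal
    (\<lambda>a. hom_sum r \<Phi> F (W, a))"
proof -
  have "finite \<Phi>" using finite_PiE[of "fst F" "\<lambda>_. W"] F W \<Phi> finite_subset by blast
  moreover have "\<phi> \<in> fst F \<rightarrow> W" if "\<phi> \<in> \<Phi>" for \<phi> using that \<Phi> by auto
  ultimately show ?thesis
    unfolding hom_sum_def snd_conv by (intro continuous_map_sum continuous_map_term F)
qed

lemma continuous_map_real_divide_const:
  fixes f :: "'a \<Rightarrow> real"
  assumes "continuous_map T euclideanreal f"
  shows "continuous_map T euclideanreal (\<lambda>x. f x / c)"
  using continuous_map_real_mult_right[OF assms, of "inverse c"] by (simp add: divide_inverse)

lemma continuous_map_lab_hom_density:
  assumes "F \<in> hypergraphs r UNIV"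
  shows "continuous_map (labelled_topology r) euclideanreal (lab_hom_density r F)"
  unfolding lab_hom_density_def
  by (rule continuous_map_labelledI, unfold fst_conv,
      intro continuous_map_real_divide_const continuous_map_hom_sum)
     (use hypergraphsD[OF assms] in auto)

lemma continuous_map_lab_inj_density:
  assumes "F \<in> hypergraphs r UNIV"
  shows "continuous_map (labelled_topology r) euclideanreal (lab_inj_density r F)"
  unfolding lab_inj_density_def Let_def
  by (rule continuous_map_labelledI, unfold fst_conv,
      intro continuous_map_real_divide_const continuous_map_hom_sum)
     (use hypergraphsD[OF assms] in auto)

lemma continuous_map_hom_density:
  assumes "F \<in> unlabelled r UNIV"
  shows "continuous_map (unlabelled_topology r) euclideanreal (hom_density r F)"
proof -
  obtain F0 where "F0 \<in> hypergraphs r UNIV" "F = iso_class r F0" using assms by (rule unlabelledE)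
  then show ?thesis
    by (intro continuous_map_unlabelledI[OF continuous_map_lab_hom_density[of F0]])
       (auto simp: hom_density_iso_class)
qed

lemma continuous_map_inj_density:
  assumes "F \<in> unlabelled r UNIV"
  shows "continuous_map (unlabelled_topology r) euclideanreal (inj_density r F)"
proof -
  obtain F0 where "F0 \<in> hypergraphs r UNIV" "F = iso_class r F0" using assms by (rule unlabelledE)
  then show ?thesis
    by (intro continuous_map_unlabelledI[OF continuous_map_lab_inj_density[of F0]])
       (auto simp: inj_density_iso_class)
qed

lemma continuous_map_inverse_num_vertices:
  "continuous_map (unlabelled_topology r) euclideanreal (\<lambda>G. 1 / real (num_vertices G))"
proof (rule continuous_map_unlabelledI)
  show "continuous_map (labelled_topology r) euclideanreal (\<lambda>G. 1 / real (card (fst G)))"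
    by (rule continuous_map_labelledI) simp
qed (simp add: num_vertices_iso_class)

section \<open>Uniform bounds for the densities\<close>

text \<open>Bounds every summand of \<open>hom_sum\<close>, hence any average of summands,
  independently of the hypergraph in which the density is taken.\<close>

definition weight_bound :: "nat \<Rightarrow> ('k::topological_space \<Rightarrow>\<^sub>C real) hypergraph \<Rightarrow> real" where
  "weight_bound r F = (\<Prod>i\<in>tuples r (fst F). norm (snd F i))"

lemma weight_bound_nonneg: "0 \<le> weight_bound r F"
  by (simp add: weight_bound_def prod_nonneg)

lemma abs_term_le:
  "\<bar>\<Prod>i\<in>tuples r (fst F). apply_bcontfun (snd F i) (h i)\<bar> \<le> weight_bound r F"
  unfolding weight_bound_def abs_prod
proof (rule prod_mono)
  show "0 \<le> \<bar>apply_bcontfun (snd F i) (h i)\<bar> \<and> \<bar>apply_bcontfun (snd F i) (h i)\<bar> \<le> norm (snd F i)" for i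
    using norm_bounded[of "snd F i" "h i"] by simp
qed

lemma abs_average_le:
  fixes f :: "'a \<Rightarrow> real"
  assumes "\<And>x. x \<in> A \<Longrightarrow> \<bar>f x\<bar> \<le> B" "0 \<le> B"
  shows "\<bar>sum f A / real (card A)\<bar> \<le> B"
proof (cases "finite A \<and> A \<noteq> {}")
  case True
  have "\<bar>sum f A\<bar> \<le> (\<Sum>x\<in>A. B)"
    by (rule order_trans[OF sum_abs sum_mono]) (use assms in auto)
  then show ?thesis using True by (simp add: divide_le_eq card_gt_0_iff mult.commute)
qed (use assms in auto)

lemma lab_hom_density_average:
  assumes "finite (fst F)"
  shows "lab_hom_density r F G = hom_sum r (fst F \<rightarrow>\<^sub>E fst G) F G / real (card (fst F \<rightarrow>\<^sub>E fst G))"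
  unfolding lab_hom_density_def card_funcsetE[OF assms] by simp

lemma abs_lab_hom_density_le:
  assumes "finite (fst F)" shows "\<bar>lab_hom_density r F G\<bar> \<le> weight_bound r F"
  unfolding lab_hom_density_average[OF assms] hom_sum_def
  by (rule abs_average_le[OF abs_term_le weight_bound_nonneg])

lemma abs_lab_inj_density_le: "\<bar>lab_inj_density r F G\<bar> \<le> weight_bound r F"
  unfolding lab_inj_density_def Let_def hom_sum_def
  by (rule abs_average_le[OF abs_term_le weight_bound_nonneg])

lemma bij_betw_tuples:
  assumes b: "bij_betw \<sigma> V W"
  shows "bij_betw (map \<sigma>) (tuples r V) (tuples r W)"
proof (rule bij_betw_byWitness[where f' = "map (inv_into V \<sigma>)"])
  show "\<forall>i\<in>tuples r V. map (inv_into V \<sigma>) (map \<sigma> i) = i"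
    using bij_betw_inv_into_left[OF b] by (auto simp: tuples_def subset_iff intro!: map_idI)
  show "\<forall>i\<in>tuples r W. map \<sigma> (map (inv_into V \<sigma>) i) = i"
    using bij_betw_inv_into_right[OF b] by (auto simp: tuples_def subset_iff intro!: map_idI)
  show "map \<sigma> ` tuples r V \<subseteq> tuples r W"
    using map_tuples[of \<sigma> V W] bij_betw_imp_surj_on[OF b] by blast
  show "map (inv_into V \<sigma>) ` tuples r W \<subseteq> tuples r V"
    using map_tuples[of "inv_into V \<sigma>" W V] bij_betw_imp_surj_on[OF bij_betw_inv_into[OF b]] by blast
qed

lemma weight_bound_iso:
  assumes "(F, F') \<in> hypergraph_iso r"
  shows "weight_bound r F = weight_bound r F'"
proof -
  obtain \<sigma> where b: "bij_betw \<sigma> (fst F) (fst F')"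
    and e: "\<And>i. i \<in> tuples r (fst F) \<Longrightarrow> snd F' (map \<sigma> i) = snd F i"
    using assms unfolding hypergraph_iso_def by auto
  have bb: "bij_betw (map \<sigma>) (tuples r (fst F)) (tuples r (fst F'))" by (rule bij_betw_tuples[OF b])
  show ?thesis
    unfolding weight_bound_def prod.reindex_bij_betw[OF bb, symmetric] by (simp add: e)
qed

lemma abs_hom_density_le:
  assumes "F \<in> unlabelled r UNIV"
  shows "\<bar>hom_density r F G\<bar> \<le> weight_bound r (rep F)"
  unfolding hom_density_def
  by (rule abs_lab_hom_density_le[OF hypergraphsD(1)[OF rep_unlabelled(1)[OF assms]]])

lemma abs_inj_density_le: "\<bar>inj_density r F G\<bar> \<le> weight_bound r (rep F)"
  unfolding inj_density_def by (rule abs_lab_inj_density_le)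

text \<open>Places \<open>tau_plus\<close> in the cube. Membership of \<open>F\<close> gives some
  representative decorated by \<open>\<F>\<close>, not necessarily \<open>rep F\<close>, so the
  bound is moved along an isomorphism.\<close>

lemma abs_hom_density_le_1:
  assumes F: "F \<in> unlabelled r \<F>" and norm: "\<And>f. f \<in> \<F> \<Longrightarrow> norm f \<le> 1"
  shows "\<bar>hom_density r F G\<bar> \<le> 1"
proof -
  obtain F0 where F0: "F0 \<in> hypergraphs r \<F>" "F = iso_class r F0" using F by (rule unlabelledE)
  have F0': "F0 \<in> hypergraphs r UNIV" using F0(1) hypergraphs_mono[of \<F> UNIV r] by auto
  have Fu: "F \<in> unlabelled r UNIV" using iso_class_in[OF F0'] F0(2) by simp
  have "\<bar>hom_density r F G\<bar> \<le> weight_bound r (rep F)" by (rule abs_hom_density_le[OF Fu])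
  also have "\<dots> = weight_bound r F0"
    using weight_bound_iso[OF rep_iso_class[OF F0']] F0(2) by simp
  also have "\<dots> \<le> 1"
    unfolding weight_bound_def
  proof (rule prod_le_1)
    show "0 \<le> norm (snd F0 i) \<and> norm (snd F0 i) \<le> 1" if "i \<in> tuples r (fst F0)" for i
      using norm[OF PiE_mem[OF hypergraphsD(3)[OF F0(1)] that]] by simp
  qed
  finally show ?thesis .
qed

subsection \<open>Injective and ordinary densities\<close>

text \<open>A non-injective map identifies one of at most \<open>card V ^ 2\<close> pairs of
  vertices, and is then determined by its values away from one vertex of the pair. The factor
  \<open>card W\<close> on the left avoids division.\<close>

lemma card_not_inj_le:
  assumes V: "finite V" "V \<noteq> {}" and W: "finite (W :: 'b set)"
  shows "card W * card {\<phi> \<in> V \<rightarrow>\<^sub>E W. \<not> inj_on \<phi> V} \<le> card V ^ 2 * card W ^ card V"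
proof -
  let ?P = "{p \<in> V \<times> V. fst p \<noteq> snd p}"
  let ?A = "\<lambda>p. {\<phi> \<in> V \<rightarrow>\<^sub>E W. \<phi> (fst p) = \<phi> (snd p)}"
  have fin: "finite (V \<rightarrow>\<^sub>E W)" using V W by (simp add: finite_PiE)
  have A: "card (?A p) \<le> card W ^ (card V - 1)" if p: "p \<in> ?P" for p
  proof -
    obtain a b where ab: "p = (a, b)" "a \<in> V" "b \<in> V" "a \<noteq> b" using p by auto
    have "card (?A p) \<le> card ((V - {b}) \<rightarrow>\<^sub>E W)"
    proof (rule card_inj_on_le)
      show "inj_on (\<lambda>\<phi>. restrict \<phi> (V - {b})) (?A p)"
      proof (rule inj_onI)
        fix \<phi> \<psi> assume h: "\<phi> \<in> ?A p" "\<psi> \<in> ?A p" "restrict \<phi> (V - {b}) = restrict \<psi> (V - {b})"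
        have e: "\<phi> x = \<psi> x" if "x \<in> V - {b}" for x
          using fun_cong[OF h(3), of x] that by (simp split: if_splits)
        have "\<phi> b = \<psi> b" using e[of a] h(1,2) ab by auto
        then have "\<phi> x = \<psi> x" if "x \<in> V" for x using e that by (cases "x = b") auto
        then show "\<phi> = \<psi>" using h(1,2) by (auto intro: PiE_ext)
      qed
      show "(\<lambda>\<phi>. restrict \<phi> (V - {b})) ` ?A p \<subseteq> (V - {b}) \<rightarrow>\<^sub>E W"
        by (auto simp: PiE_iff split: if_splits)
      show "finite ((V - {b}) \<rightarrow>\<^sub>E W)" using V W by (simp add: finite_PiE)
    qed
    also have "\<dots> = card W ^ (card V - 1)" using V ab by (simp add: card_funcsetE)
    finally show ?thesis .
  qed
  have "{\<phi> \<in> V \<rightarrow>\<^sub>E W. \<not> inj_on \<phi> V} \<subseteq> (\<Union>p\<in>?P. ?A p)"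
    by (fastforce simp: inj_on_def)
  then have "card {\<phi> \<in> V \<rightarrow>\<^sub>E W. \<not> inj_on \<phi> V} \<le> card (\<Union>p\<in>?P. ?A p)"
    using fin V by (intro card_mono) (auto intro: finite_subset[OF _ fin])
  also have "\<dots> \<le> (\<Sum>p\<in>?P. card (?A p))"
    using V by (intro card_UN_le) (auto intro: finite_subset[of _ "V \<times> V"])
  also have "\<dots> \<le> (\<Sum>p\<in>?P. card W ^ (card V - 1))" by (rule sum_mono[OF A])
  also have "\<dots> \<le> card V ^ 2 * card W ^ (card V - 1)"
    using card_mono[of "V \<times> V" ?P] V by (simp add: card_cartesian_product power2_eq_square)
  finally have "card W * card {\<phi> \<in> V \<rightarrow>\<^sub>E W. \<not> inj_on \<phi> V} \<le>
      card W * (card V ^ 2 * card W ^ (card V - 1))" by simp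
  also have "\<dots> = card V ^ 2 * card W ^ card V"
  proof -
    have "card V = Suc (card V - 1)" using V by (simp add: card_gt_0_iff)
    then show ?thesis by (metis (no_types) mult.left_commute power_Suc)
  qed
  finally show ?thesis .
qed

text \<open>Dropping the terms outside \<open>I\<close> and renormalising each cost at most
  \<open>B * card (A - I) / card A\<close>, whence the factor 2.\<close>

lemma average_subset_diff:
  fixes h :: "'a \<Rightarrow> real"
  assumes A: "finite A" "A \<noteq> {}" and I: "I \<subseteq> A" and h: "\<And>x. x \<in> A \<Longrightarrow> \<bar>h x\<bar> \<le> B"
  shows "\<bar>sum h I / real (card I) - sum h A / real (card A)\<bar> \<le> 2 * B * real (card (A - I)) / real (card A)"
proof -
  obtain x where "x \<in> A" using A(2) by blast
  then have B: "0 \<le> B" using h[of x] abs_ge_zero[of "h x"] by linarith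
  have fI: "finite I" using A I finite_subset by blast
  have N: "real (card A) > 0" using A by (simp add: card_gt_0_iff)
  have S: "sum h A = sum h I + sum h (A - I)" using sum.subset_diff[OF I A(1), of h] by simp
  have C: "real (card A) = real (card I) + real (card (A - I))"
    using card_Diff_subset[OF fI I] card_mono[OF A(1) I] by simp
  have bnd: "\<bar>sum h J\<bar> \<le> B * real (card J)" if "J \<subseteq> A" for J
  proof -
    have "\<bar>sum h J\<bar> \<le> (\<Sum>x\<in>J. \<bar>h x\<bar>)" by (rule sum_abs)
    also have "\<dots> \<le> (\<Sum>x\<in>J. B)" by (rule sum_mono) (use h that in auto)
    finally show ?thesis by (simp add: mult.commute)
  qed
  have b1: "\<bar>sum h (A - I)\<bar> \<le> B * real (card (A - I))" by (rule bnd) auto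
  show ?thesis
  proof (cases "card I = 0")
    \<comment> \<open>The average over the empty set is \<open>0 / 0 = 0\<close>, and the bound
      becomes \<open>2 * B\<close>.\<close>
    case True
    then have "I = {}" using fI by simp
    then have "\<bar>sum h A\<bar> \<le> 2 * (B * real (card A))" using b1 B by simp
    then have "\<bar>sum h A\<bar> / real (card A) \<le> 2 * B"
      by (subst pos_divide_le_eq[OF N]) (simp add: mult.assoc)
    then show ?thesis using N \<open>I = {}\<close> by simp
  next
    case False
    then have i: "real (card I) > 0" by simp
    have b2: "\<bar>sum h I\<bar> \<le> B * real (card I)" by (rule bnd[OF I])
    \<comment> \<open>The first term is the change of normalisation from \<open>card I\<close> to
      \<open>card A\<close>; the second is the discarded part.\<close>
    have "sum h I / card I - sum h A / card A =
        (sum h I / card I) * (real (card (A - I)) / card A) - sum h (A - I) / card A"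
    proof -
      have "real (card (A - I)) / card A = 1 - real (card I) / card A"
        using C N by (simp add: field_simps)
      then show ?thesis using i by (simp add: S right_diff_distrib add_divide_distrib)
    qed
    also have "\<bar>\<dots>\<bar> \<le> \<bar>sum h I / card I\<bar> * (real (card (A - I)) / card A) + \<bar>sum h (A - I)\<bar> / card A"
      using abs_triangle_ineq4[of "(sum h I / card I) * (real (card (A - I)) / card A)" "sum h (A - I) / card A"]
      by (simp add: abs_mult)
    also have "\<dots> \<le> B * (real (card (A - I)) / card A) + B * real (card (A - I)) / card A"
    proof (intro add_mono mult_right_mono divide_right_mono b1)
      show "\<bar>sum h I / card I\<bar> \<le> B" using b2 i by (simp add: divide_le_eq)
    qed (use N in auto)
    finally show ?thesis by simp
  qed
qed

text \<open>Hypergraphs too small to admit an injection are included: their injective density is 0,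
  and the right-hand side is then large enough to bound the ordinary density alone.\<close>

lemma lab_inj_hom_density_diff:
  assumes F: "F \<in> hypergraphs r UNIV" and G: "G \<in> hypergraphs r UNIV"
  shows "\<bar>lab_inj_density r F G - lab_hom_density r F G\<bar>
    \<le> 2 * weight_bound r F * real (card (fst F)) ^ 2 / real (card (fst G))"
proof -
  note f = hypergraphsD[OF F] and g = hypergraphsD[OF G]
  let ?A = "fst F \<rightarrow>\<^sub>E fst G"
  let ?I = "{\<phi> \<in> ?A. inj_on \<phi> (fst F)}"
  have A: "finite ?A" "?A \<noteq> {}" using f g by (auto simp: finite_PiE PiE_eq_empty_iff)
  have N: "real (card ?A) > 0" using A by (simp add: card_gt_0_iff)
  have n: "real (card (fst G)) > 0" using g by simp
  have "?A - ?I = {\<phi> \<in> ?A. \<not> inj_on \<phi> (fst F)}" by auto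
  then have "card (fst G) * card (?A - ?I) \<le> card (fst F) ^ 2 * card ?A"
    using card_not_inj_le[OF f(1,2) g(1)] by (simp add: card_funcsetE f)
  then have "real (card (fst G)) * real (card (?A - ?I)) \<le> real (card (fst F)) ^ 2 * real (card ?A)"
    unfolding of_nat_mult[symmetric] of_nat_power[symmetric] of_nat_le_iff .
  then have "real (card (?A - ?I)) \<le> real (card (fst F)) ^ 2 / card (fst G) * real (card ?A)"
    using n by (simp add: pos_le_divide_eq mult.commute)
  then have m: "real (card (?A - ?I)) / card ?A \<le> real (card (fst F)) ^ 2 / card (fst G)"
    by (subst pos_divide_le_eq[OF N])
  have "\<bar>lab_inj_density r F G - lab_hom_density r F G\<bar> \<le>
      2 * weight_bound r F * real (card (?A - ?I)) / real (card ?A)"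
    unfolding lab_inj_density_def lab_hom_density_average[OF f(1)] Let_def hom_sum_def
    by (rule average_subset_diff[OF A]) (auto intro: abs_term_le)
  also have "\<dots> = 2 * weight_bound r F * (real (card (?A - ?I)) / real (card ?A))" by simp
  also have "\<dots> \<le> 2 * weight_bound r F * (real (card (fst F)) ^ 2 / card (fst G))"
    using m weight_bound_nonneg[of r F] by (intro mult_left_mono) auto
  finally show ?thesis by simp
qed

lemma inj_hom_density_diff:
  assumes F: "F \<in> unlabelled r UNIV"
  obtains C where "0 \<le> C"
    "\<And>G. G \<in> unlabelled r UNIV \<Longrightarrow> \<bar>inj_density r F G - hom_density r F G\<bar> \<le> C / real (num_vertices G)"
proof
  show "0 \<le> 2 * weight_bound r (rep F) * real (card (fst (rep F))) ^ 2"
    using weight_bound_nonneg[of r "rep F"] by simp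
  show "\<bar>inj_density r F G - hom_density r F G\<bar> \<le>
      2 * weight_bound r (rep F) * real (card (fst (rep F))) ^ 2 / real (num_vertices G)"
    if "G \<in> unlabelled r UNIV" for G
    unfolding inj_density_def hom_density_def num_vertices_def
    using lab_inj_hom_density_diff[OF rep_unlabelled(1)[OF F] rep_unlabelled(1)[OF that]] .
qed

subsection \<open>Products of densities\<close>

text \<open>
  The product is the density of the disjoint union, where the tuples that meet both parts carry the
  constant function 1; for \<open>r = 0\<close> the two parts would share the empty tuple.
\<close>

lemma lab_hom_density_mult:
  fixes F1 F2 :: "('k::topological_space \<Rightarrow>\<^sub>C real) hypergraph"
  assumes r: "1 \<le> r" and F1: "F1 \<in> hypergraphs r UNIV" and F2: "F2 \<in> hypergraphs r UNIV"
  shows "\<exists>F\<in>hypergraphs r UNIV.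
    \<forall>G. lab_hom_density r F G = lab_hom_density r F1 G * lab_hom_density r F2 G"
proof -
  note f1 = hypergraphsD[OF F1] and f2 = hypergraphsD[OF F2]
  define V1 V2 where "V1 = fst F1" and "V2 = fst F2"
  \<comment> \<open>Even and odd numbers make the two vertex sets disjoint, and \<open>div 2\<close>
    undoes both embeddings.\<close>
  define e0 e1 where "e0 = (\<lambda>v::nat. 2 * v)" and "e1 = (\<lambda>v::nat. 2 * v + 1)"
  define V where "V = e0 ` V1 \<union> e1 ` V2"
  define T1 T2 where "T1 = map e0 ` tuples r V1" and "T2 = map e1 ` tuples r V2"
  define d where "d = (\<lambda>i\<in>tuples r V.
    if i \<in> T1 then snd F1 (map (\<lambda>v. v div 2) i)
    else if i \<in> T2 then snd F2 (map (\<lambda>v. v div 2) i) else const_bcontfun 1)"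
  let ?F = "(V, d)"
  have fin: "finite V1" "finite V2" using f1 f2 by (auto simp: V1_def V2_def)
  have FH: "?F \<in> hypergraphs r UNIV"
    using f1 f2 by (auto simp: V_def V1_def V2_def d_def)
  have inj: "inj e0" "inj e1" by (auto simp: inj_def e0_def e1_def)
  have parity: "e0 u \<noteq> e1 w" for u w unfolding e0_def e1_def by presburger
  have T12: "T1 \<inter> T2 = {}"
  proof -
    have False if "i \<in> T1" "i \<in> T2" for i
    proof -
      from that have l: "length i = r" by (auto simp: T1_def tuples_def)
      \<comment> \<open>A tuple of length at least 1 has a first vertex, whose parity tells the part
        it comes from.\<close>
      then have h: "i ! 0 \<in> set i" using r by auto
      have "even (i ! 0)" using h that(1) by (auto simp: T1_def e0_def)
      moreover have "odd (i ! 0)" using h that(2) by (auto simp: T2_def e1_def)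
      ultimately show False by simp
    qed
    then show ?thesis by blast
  qed
  have T: "T1 \<subseteq> tuples r V" "T2 \<subseteq> tuples r V"
    using map_tuples[of e0 V1 V] map_tuples[of e1 V2 V] by (auto simp: T1_def T2_def V_def)
  have finT: "finite (tuples r V)" using fin by (intro finite_tuples) (simp add: V_def)
  have div0: "map (\<lambda>v. v div 2) (map e0 i) = i" and div1: "map (\<lambda>v. v div 2) (map e1 i) = i" for i
    by (auto simp: e0_def e1_def comp_def intro!: map_idI)
  have split: "(\<Prod>i\<in>tuples r V. apply_bcontfun (d i) (a (map \<phi> i))) =
      (\<Prod>i\<in>tuples r V1. apply_bcontfun (snd F1 i) (a (map (\<lambda>v. \<phi> (e0 v)) i))) *
      (\<Prod>i\<in>tuples r V2. apply_bcontfun (snd F2 i) (a (map (\<lambda>v. \<phi> (e1 v)) i)))"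
    for a :: "nat list \<Rightarrow> 'k" and \<phi> :: "nat \<Rightarrow> nat"
  proof -
    let ?t = "\<lambda>i. apply_bcontfun (d i) (a (map \<phi> i))"
    have "prod ?t (tuples r V) = prod ?t (T1 \<union> T2)"
      using T finT by (intro prod.mono_neutral_right) (auto simp: d_def)
    also have "\<dots> = prod ?t T1 * prod ?t T2"
      using T finT T12 by (intro prod.union_disjoint) (auto intro: finite_subset)
    also have "prod ?t T1 = (\<Prod>i\<in>tuples r V1. ?t (map e0 i))"
      unfolding T1_def using inj by (subst prod.reindex) (auto intro: inj_on_subset simp: comp_def)
    also have "\<dots> = (\<Prod>i\<in>tuples r V1. apply_bcontfun (snd F1 i) (a (map (\<lambda>v. \<phi> (e0 v)) i)))"
    proof (rule prod.cong[OF refl])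
      fix i assume i: "i \<in> tuples r V1"
      then have "map e0 i \<in> T1" by (simp add: T1_def)
      then have "d (map e0 i) = snd F1 i" using T div0 by (auto simp: d_def simp del: map_map)
      then show "?t (map e0 i) = apply_bcontfun (snd F1 i) (a (map (\<lambda>v. \<phi> (e0 v)) i))"
        by (simp add: comp_def)
    qed
    also have "prod ?t T2 = (\<Prod>i\<in>tuples r V2. ?t (map e1 i))"
      unfolding T2_def using inj by (subst prod.reindex) (auto intro: inj_on_subset simp: comp_def)
    also have "\<dots> = (\<Prod>i\<in>tuples r V2. apply_bcontfun (snd F2 i) (a (map (\<lambda>v. \<phi> (e1 v)) i)))"
    proof (rule prod.cong[OF refl])
      fix i assume i: "i \<in> tuples r V2"
      then have i2: "map e1 i \<in> T2" by (simp add: T2_def)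
      then have "map e1 i \<notin> T1" using T12 by blast
      with i2 have "d (map e1 i) = snd F2 i" using T div1 by (auto simp: d_def simp del: map_map)
      then show "?t (map e1 i) = apply_bcontfun (snd F2 i) (a (map (\<lambda>v. \<phi> (e1 v)) i))"
        by (simp add: comp_def)
    qed
    finally show ?thesis .
  qed
  have "lab_hom_density r ?F G = lab_hom_density r F1 G * lab_hom_density r F2 G" for G :: "'k hypergraph"
  proof -
    define W where "W = fst G"
    \<comment> \<open>Maps on the disjoint union are pairs of maps on the parts; this turns the sum
      over maps into a product of two sums.\<close>
    define join where "join p = (\<lambda>v\<in>V. if even v then fst p (v div 2) else snd p (v div 2))"
      for p :: "(nat \<Rightarrow> nat) \<times> (nat \<Rightarrow> nat)"
    define cut where "cut \<phi> = ((\<lambda>v\<in>V1. \<phi> (e0 v)), (\<lambda>v\<in>V2. \<phi> (e1 v)))" for \<phi> :: "nat \<Rightarrow> nat"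
    have V_iff: "e0 v \<in> V \<longleftrightarrow> v \<in> V1" "e1 v \<in> V \<longleftrightarrow> v \<in> V2" for v
      unfolding V_def Un_iff inj_image_mem_iff[OF inj(1)] inj_image_mem_iff[OF inj(2)]
      using parity[symmetric] parity by (auto simp: image_iff)
    have V_cases: "(\<exists>u\<in>V1. v = e0 u) \<or> (\<exists>u\<in>V2. v = e1 u)" if "v \<in> V" for v
      using that by (auto simp: V_def)
    have join_e0: "join p (e0 v) = fst p v" if "v \<in> V1" for p v
      using that V_iff(1) by (simp add: join_def) (simp add: e0_def)
    have join_e1: "join p (e1 v) = snd p v" if "v \<in> V2" for p v
      using that V_iff(2) by (simp add: join_def) (simp add: e1_def)
    have cut_join: "cut (join p) = p" if "p \<in> (V1 \<rightarrow>\<^sub>E W) \<times> (V2 \<rightarrow>\<^sub>E W)" for p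
    proof (rule prod_eqI; rule ext)
      have p: "fst p \<in> V1 \<rightarrow>\<^sub>E W" "snd p \<in> V2 \<rightarrow>\<^sub>E W" using that by auto
      show "fst (cut (join p)) v = fst p v" for v
        using PiE_arb[OF p(1), of v] by (simp add: cut_def join_e0)
      show "snd (cut (join p)) v = snd p v" for v
        using PiE_arb[OF p(2), of v] by (simp add: cut_def join_e1)
    qed
    have join_cut: "join (cut \<phi>) = \<phi>" if "\<phi> \<in> V \<rightarrow>\<^sub>E W" for \<phi>
    proof
      fix v show "join (cut \<phi>) v = \<phi> v"
      proof (cases "v \<in> V")
        case True
        then show ?thesis using V_cases[OF True] by (auto simp: join_e0 join_e1) (auto simp: cut_def)
      next
        case False
        then show ?thesis using that by (simp add: join_def PiE_iff extensional_def)
      qed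
    qed
    have join_in: "join p \<in> V \<rightarrow>\<^sub>E W" if "p \<in> (V1 \<rightarrow>\<^sub>E W) \<times> (V2 \<rightarrow>\<^sub>E W)" for p
    proof (rule PiE_I)
      show "join p v \<in> W" if "v \<in> V" for v
        using V_cases[OF that] \<open>p \<in> _\<close> by (auto simp: join_e0 join_e1)
      show "join p v = undefined" if "v \<notin> V" for v using that by (simp add: join_def)
    qed
    have cut_in: "cut \<phi> \<in> (V1 \<rightarrow>\<^sub>E W) \<times> (V2 \<rightarrow>\<^sub>E W)" if "\<phi> \<in> V \<rightarrow>\<^sub>E W" for \<phi>
      using that V_iff by (auto simp: cut_def)
    have bij: "bij_betw join ((V1 \<rightarrow>\<^sub>E W) \<times> (V2 \<rightarrow>\<^sub>E W)) (V \<rightarrow>\<^sub>E W)"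
      by (rule bij_betw_byWitness[where f' = cut]) (blast intro: cut_join join_cut | rule image_subsetI, erule join_in cut_in)+
    let ?s1 = "\<lambda>\<phi>. \<Prod>i\<in>tuples r V1. apply_bcontfun (snd F1 i) (snd G (map \<phi> i))"
    let ?s2 = "\<lambda>\<phi>. \<Prod>i\<in>tuples r V2. apply_bcontfun (snd F2 i) (snd G (map \<phi> i))"
    have "hom_sum r (V \<rightarrow>\<^sub>E W) ?F G = (\<Sum>p\<in>(V1 \<rightarrow>\<^sub>E W) \<times> (V2 \<rightarrow>\<^sub>E W). ?s1 (fst p) * ?s2 (snd p))"
      unfolding hom_sum_def fst_conv snd_conv split sum.reindex_bij_betw[OF bij, symmetric]
    proof (intro sum.cong refl arg_cong2[of _ _ _ _ "(*)"] prod.cong)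
      fix p i assume "i \<in> tuples r V1"
      then have "map (\<lambda>v. join p (e0 v)) i = map (fst p) i" by (auto simp: tuples_def join_e0)
      then show "apply_bcontfun (snd F1 i) (snd G (map (\<lambda>v. join p (e0 v)) i)) =
        apply_bcontfun (snd F1 i) (snd G (map (fst p) i))" by (simp only:)
    next
      fix p i assume "i \<in> tuples r V2"
      then have "map (\<lambda>v. join p (e1 v)) i = map (snd p) i" by (auto simp: tuples_def join_e1)
      then show "apply_bcontfun (snd F2 i) (snd G (map (\<lambda>v. join p (e1 v)) i)) =
        apply_bcontfun (snd F2 i) (snd G (map (snd p) i))" by (simp only:)
    qed
    also have "\<dots> = (\<Sum>\<phi>\<in>V1 \<rightarrow>\<^sub>E W. ?s1 \<phi>) * (\<Sum>\<phi>\<in>V2 \<rightarrow>\<^sub>E W. ?s2 \<phi>)"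
      by (simp add: sum_product sum.cartesian_product case_prod_beta)
    finally have "hom_sum r (V \<rightarrow>\<^sub>E W) ?F G = hom_sum r (V1 \<rightarrow>\<^sub>E W) F1 G * hom_sum r (V2 \<rightarrow>\<^sub>E W) F2 G"
      by (simp add: hom_sum_def V1_def V2_def)
    moreover have "card V = card V1 + card V2"
    proof -
      have "e0 ` V1 \<inter> e1 ` V2 = {}" using parity by blast
      then show ?thesis
        unfolding V_def using fin inj by (simp add: card_Un_disjoint card_image inj_on_subset)
    qed
    ultimately show ?thesis
      by (simp add: lab_hom_density_def V1_def[symmetric] V2_def[symmetric] W_def[symmetric] power_add)
  qed
  with FH show ?thesis by blast
qed

lemma hom_density_mult:
  fixes F1 F2 :: "('k::topological_space \<Rightarrow>\<^sub>C real) hypergraph set"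
  assumes r: "1 \<le> r" and F1: "F1 \<in> unlabelled r UNIV" and F2: "F2 \<in> unlabelled r UNIV"
  obtains F where "F \<in> unlabelled r UNIV"
    "\<And>G. G \<in> unlabelled r UNIV \<Longrightarrow> hom_density r F G = hom_density r F1 G * hom_density r F2 G"
proof -
  obtain F where F: "F \<in> hypergraphs r UNIV"
    "\<And>G. lab_hom_density r F G = lab_hom_density r (rep F1) G * lab_hom_density r (rep F2) G"
    using lab_hom_density_mult[OF r rep_unlabelled(1)[OF F1] rep_unlabelled(1)[OF F2]] by auto
  have "hom_density r (iso_class r F) G = hom_density r F1 G * hom_density r F2 G"
    if "G \<in> unlabelled r UNIV" for G
    using hom_density_iso_class[OF F(1) rep_unlabelled(1)[OF that]] rep_unlabelled(2)[OF that]
    by (simp add: F(2) hom_density_def)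
  with iso_class_in[OF F(1)] show thesis by (rule that)
qed

subsection \<open>Multilinearity in the decorations\<close>

text \<open>The positions are freed one at a time. With the other entries fixed, the entries for
  which \<open>Q\<close> holds form a subspace containing \<open>\<F>\<close>, hence its span, and
  the bound \<open>norm f * B\<close> extends this to the closure. \<open>Q\<close> is abstract as
  the rule serves both convergence of expectations and existence of continuous extensions.\<close>

lemma hom_density_multilinear_induct:
  fixes \<F> :: "('k::topological_space \<Rightarrow>\<^sub>C real) set" and Q :: "('k hypergraph set \<Rightarrow> real) \<Rightarrow> bool"
  assumes dense: "closure (span \<F>) = UNIV"
    and zero: "Q (\<lambda>_. 0)"
    and add: "\<And>p q. Q p \<Longrightarrow> Q q \<Longrightarrow> Q (\<lambda>G. p G + q G)"
    and scale: "\<And>c p. Q p \<Longrightarrow> Q (\<lambda>G. c * p G)"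
    and lim: "\<And>p. (\<And>e. 0 < e \<Longrightarrow> \<exists>q. Q q \<and> (\<forall>G\<in>unlabelled r UNIV. \<bar>p G - q G\<bar> \<le> e)) \<Longrightarrow> Q p"
    and base: "\<And>F. F \<in> unlabelled r \<F> \<Longrightarrow> Q (hom_density r F)"
    and F: "F \<in> unlabelled r UNIV"
  shows "Q (hom_density r F)"
proof -
  \<comment> \<open>Error 0 is a special case of approximation, so \<open>Q\<close> sees only the
    values on unlabelled hypergraphs.\<close>
  have cong: "Q p" if "Q q" "\<And>G. G \<in> unlabelled r UNIV \<Longrightarrow> p G = q G" for p q
    by (rule lim) (use that in \<open>auto intro!: exI[of _ q]\<close>)
  obtain F0 where F0: "F0 \<in> hypergraphs r UNIV" "F = iso_class r F0" using F by (rule unlabelledE)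
  obtain V a where Va: "F0 = (V, a)" by (cases F0)
  note V = hypergraphsD(1,2)[OF F0(1), unfolded Va fst_conv]
  define L where "L a G = lab_hom_density r (V, a) (rep G)"
    for a :: "nat list \<Rightarrow> ('k \<Rightarrow>\<^sub>C real)" and G :: "'k hypergraph set"
  have QL: "Q (hom_density r (iso_class r (V, a))) \<longleftrightarrow> Q (L a)" if "a \<in> tuples r V \<rightarrow>\<^sub>E UNIV" for a
  proof -
    have "hom_density r (iso_class r (V, a)) G = L a G" if G: "G \<in> unlabelled r UNIV" for G
      using hom_density_iso_class[of "(V, a)" r "rep G"] rep_unlabelled[OF G] that V
        \<open>a \<in> _\<close> by (simp add: L_def)
    then show ?thesis using cong by metis
  qed
  \<comment> \<open>\<open>S\<close> collects the positions whose entries may be arbitrary; it grows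
    from the empty set, where \<open>base\<close> applies, to all tuples.\<close>
  have "\<forall>a\<in>tuples r V \<rightarrow>\<^sub>E UNIV. (\<forall>i\<in>tuples r V - S. a i \<in> \<F>) \<longrightarrow> Q (L a)"
    if "finite S" "S \<subseteq> tuples r V" for S
    using that
  proof (induction S rule: finite_induct)
    case empty
    show ?case
    proof (intro ballI impI)
      fix a assume a: "a \<in> tuples r V \<rightarrow>\<^sub>E UNIV" "\<forall>i\<in>tuples r V - {}. a i \<in> \<F>"
      then have "(V, a) \<in> hypergraphs r \<F>" using V by (auto simp: PiE_iff)
      then show "Q (L a)" using base[OF iso_class_in] QL[OF a(1)] by blast
    qed
  next
    case (insert s S)
    then have s: "s \<in> tuples r V" by simp
    note IH = insert.IH
    show ?case
    proof (intro ballI impI)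
      fix a :: "nat list \<Rightarrow> ('k \<Rightarrow>\<^sub>C real)"
      assume a: "a \<in> tuples r V \<rightarrow>\<^sub>E UNIV" "\<forall>i\<in>tuples r V - insert s S. a i \<in> \<F>"
      let ?rest = "\<lambda>\<phi> G. \<Prod>i\<in>tuples r V - {s}. apply_bcontfun (a i) (snd (rep G) (map \<phi> i))"
      let ?D = "\<lambda>G. real (card (fst (rep G))) ^ card V"
      have L_upd: "L (a(s := f)) G =
        (\<Sum>\<phi>\<in>V \<rightarrow>\<^sub>E fst (rep G). apply_bcontfun f (snd (rep G) (map \<phi> s)) * ?rest \<phi> G) / ?D G" for f G
        unfolding L_def lab_hom_density_def hom_sum_def fst_conv snd_conv
        by (simp add: prod.remove[OF finite_tuples[OF V(1)] s])
      have L_add: "L (a(s := f + f')) G = L (a(s := f)) G + L (a(s := f')) G" for f f' G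
        unfolding L_upd by (simp add: plus_bcontfun.rep_eq sum.distrib distrib_right add_divide_distrib)
      have L_scale: "L (a(s := c *\<^sub>R f)) G = c * L (a(s := f)) G" for c f G
        unfolding L_upd by (simp add: scaleR_bcontfun.rep_eq sum_distrib_left mult.assoc)
      define B where "B = (\<Prod>i\<in>tuples r V - {s}. norm (a i))"
      have B: "0 \<le> B" by (simp add: B_def prod_nonneg)
      have L_bound: "\<bar>L (a(s := f)) G\<bar> \<le> norm f * B" for f G
      proof -
        have "weight_bound r (V, a(s := f)) = norm f * B"
          by (simp add: weight_bound_def B_def prod.remove[OF finite_tuples[OF V(1)] s])
        then show ?thesis
          using abs_lab_hom_density_le[of "(V, a(s := f))" r "rep G"] V by (simp add: L_def)
      qed
      define X where "X = {f. Q (L (a(s := f)))}"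
      have "subspace X"
      proof (rule subspaceI)
        have "L (a(s := 0)) = (\<lambda>_. 0)" using L_scale[of 0 0] by auto
        then show "0 \<in> X" using zero by (simp add: X_def)
        show "f + f' \<in> X" if "f \<in> X" "f' \<in> X" for f f'
          using add[of "L (a(s := f))" "L (a(s := f'))"] that
          by (simp add: X_def L_add[symmetric])
        show "c *\<^sub>R f \<in> X" if "f \<in> X" for c f
          using scale[of "L (a(s := f))" c] that by (simp add: X_def L_scale[symmetric])
      qed
      moreover have "\<F> \<subseteq> X"
      proof
        fix f assume f: "f \<in> \<F>"
        have "Q (L (a(s := f)))"
        proof (rule IH[rule_format])
          show "S \<subseteq> tuples r V" using insert.prems by simp
          show "a(s := f) \<in> tuples r V \<rightarrow>\<^sub>E UNIV" using a(1) s by (auto simp: PiE_iff extensional_def)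
          show "(a(s := f)) i \<in> \<F>" if "i \<in> tuples r V - S" for i using that a(2) f by auto
        qed
        then show "f \<in> X" by (simp add: X_def)
      qed
      ultimately have spanX: "span \<F> \<subseteq> X" by (intro span_minimal)
      have "a s \<in> X"
      proof -
        have "Q (L (a(s := a s)))"
        proof (rule lim)
          fix e :: real assume e: "0 < e"
          \<comment> \<open>Adding 1 keeps the quotient meaningful when another entry is 0 and
            \<open>B\<close> vanishes.\<close>
          have "0 < e / (B + 1)" using e B by simp
          then obtain f where f: "f \<in> span \<F>" "dist f (a s) < e / (B + 1)"
            using dense closure_approachable[of "a s" "span \<F>"] by auto
          have "\<bar>L (a(s := a s)) G - L (a(s := f)) G\<bar> \<le> e" for G
          proof -
            have "L (a(s := a s)) G - L (a(s := f)) G = L (a(s := a s - f)) G"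
              using L_add[of "a s - f" f G] by simp
            then have "\<bar>L (a(s := a s)) G - L (a(s := f)) G\<bar> \<le> norm (a s - f) * B"
              using L_bound by simp
            also have "\<dots> \<le> e / (B + 1) * B"
              using f(2) B by (intro mult_right_mono) (auto simp: dist_norm norm_minus_commute)
            also have "\<dots> \<le> e" using B e by (simp add: field_simps)
            finally show ?thesis .
          qed
          moreover have "Q (L (a(s := f)))" using f(1) spanX by (auto simp: X_def)
          ultimately show "\<exists>q. Q q \<and> (\<forall>G\<in>unlabelled r UNIV. \<bar>L (a(s := a s)) G - q G\<bar> \<le> e)"
            by blast
        qed
        then show ?thesis by (simp add: X_def)
      qed
      then show "Q (L a)" by (simp add: X_def)
    qed
  qed
  from this[OF finite_tuples[OF V(1)] subset_refl] have "Q (L a)"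
    using hypergraphsD(3)[OF F0(1)] Va by auto
  then show ?thesis using QL[of a] hypergraphsD(3)[OF F0(1)] Va F0(2) by simp
qed

subsection \<open>Uniform limits of continuous functions\<close>

lemma continuous_map_real_uniform_limit:
  fixes p :: "'a \<Rightarrow> real"
  assumes "\<And>e. 0 < e \<Longrightarrow> \<exists>q. continuous_map T euclideanreal q \<and> (\<forall>x\<in>topspace T. \<bar>p x - q x\<bar> \<le> e)"
  shows "continuous_map T euclideanreal p"
proof -
  have "\<exists>q. continuous_map T euclideanreal q \<and> (\<forall>x\<in>topspace T. \<bar>p x - q x\<bar> \<le> inverse (real (Suc n)))" for n
    by (rule assms) simp
  then obtain q where q: "\<And>n. continuous_map T euclideanreal (q n)"
    "\<And>n x. x \<in> topspace T \<Longrightarrow> \<bar>p x - q n x\<bar> \<le> inverse (real (Suc n))" by metis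
  have "continuous_map T Met_TC.mtopology p"
  proof (rule Met_TC.continuous_map_uniform_limit_alt[of _ _ sequentially])
    show "\<forall>\<^sub>F n in sequentially. continuous_map T Met_TC.mtopology (q n)"
      using q(1) by (simp add: mtopology_is_euclidean)
    fix e :: real assume "0 < e"
    then obtain N where N: "inverse (real (Suc N)) < e" using reals_Archimedean by blast
    show "\<forall>\<^sub>F n in sequentially. \<forall>x\<in>topspace T. dist (q n x) (p x) < e"
    proof (rule eventually_sequentiallyI[of N], rule ballI)
      fix n x assume "N \<le> n" "x \<in> topspace T"
      then have "\<bar>p x - q n x\<bar> \<le> inverse (real (Suc n))" "inverse (real (Suc n)) \<le> inverse (real (Suc N))"
        using q(2) by (auto intro!: le_imp_inverse_le)
      then show "dist (q n x) (p x) < e" using N unfolding dist_real_def by linarith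
    qed
  qed auto
  then show ?thesis by (simp add: mtopology_is_euclidean)
qed

subsection \<open>Random hypergraphs\<close>

locale random_hypergraphs =
  fixes r :: nat
    and \<F> :: "('k::polish_space \<Rightarrow>\<^sub>C real) set"
    and M :: "nat \<Rightarrow> 'w measure"
    and X :: "nat \<Rightarrow> 'w \<Rightarrow> 'k hypergraph set"
  assumes r: "1 \<le> r"
    and compact_K: "compact (UNIV :: 'k set)"
    and countable_F: "countable \<F>"
    and norm_F: "\<And>f. f \<in> \<F> \<Longrightarrow> norm f \<le> 1"
    and dense_F: "closure (span \<F>) = UNIV"
    and prob_M: "\<And>n. prob_space (M n)"
    and X_measurable: "\<And>n. X n \<in> measurable (M n) (borel_of (unlabelled_topology r))"
    and large: "\<And>m::nat. (\<lambda>n. measure (M n) {\<omega> \<in> space (M n). m \<le> num_vertices (X n \<omega>)}) \<longlonglongrightarrow> 1"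
begin

abbreviation hyps :: "'k hypergraph set set" where
  "hyps \<equiv> unlabelled r UNIV"

definition expect :: "nat \<Rightarrow> ('k hypergraph set \<Rightarrow> real) \<Rightarrow> real" where
  "expect n p = (\<integral>\<omega>. p (X n \<omega>) \<partial>M n)"

text \<open>Boundedness has to be demanded: unlabelled hypergraphs with all numbers of vertices form
  a non-compact space.\<close>

definition test_fun :: "('k hypergraph set \<Rightarrow> real) \<Rightarrow> bool" where
  "test_fun p \<longleftrightarrow> continuous_map (unlabelled_topology r) euclideanreal p \<and>
     (\<exists>B. \<forall>G\<in>hyps. \<bar>p G\<bar> \<le> B)"

text \<open>Asks for convergence of expectations, not of laws: this property is stable under linear
  combinations and uniform limits.\<close>

definition conv :: "('k hypergraph set \<Rightarrow> real) \<Rightarrow> bool" where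
  "conv p \<longleftrightarrow> test_fun p \<and> convergent (\<lambda>n. expect n p)"

lemma X_in: "\<omega> \<in> space (M n) \<Longrightarrow> X n \<omega> \<in> hyps"
  using measurable_space[OF X_measurable] by (simp add: topspace_unlabelled_topology)

lemma test_funD: "test_fun p \<Longrightarrow> continuous_map (unlabelled_topology r) euclideanreal p"
  by (simp add: test_fun_def)

lemma test_fun_bound:
  assumes "test_fun p" shows "\<exists>B. 0 \<le> B \<and> (\<forall>G\<in>hyps. \<bar>p G\<bar> \<le> B)"
proof -
  obtain B where "\<forall>G\<in>hyps. \<bar>p G\<bar> \<le> B" using assms unfolding test_fun_def by blast
  then have "\<bar>p G\<bar> \<le> max 0 B" if "G \<in> hyps" for G using that by (simp add: max.coboundedI2)
  then show ?thesis by (intro exI[of _ "max 0 B"]) auto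
qed

lemma test_funI:
  "continuous_map (unlabelled_topology r) euclideanreal p \<Longrightarrow> (\<And>G. G \<in> hyps \<Longrightarrow> \<bar>p G\<bar> \<le> B) \<Longrightarrow> test_fun p"
  unfolding test_fun_def by blast

lemma test_fun_add: assumes "test_fun p" "test_fun q" shows "test_fun (\<lambda>G. p G + q G)"
proof -
  obtain B where B: "\<forall>G\<in>hyps. \<bar>p G\<bar> \<le> B" using test_fun_bound[OF assms(1)] by blast
  obtain C where C: "\<forall>G\<in>hyps. \<bar>q G\<bar> \<le> C" using test_fun_bound[OF assms(2)] by blast
  show ?thesis
  proof (rule test_funI[OF continuous_map_add[OF assms[THEN test_funD]]])
    show "\<bar>p G + q G\<bar> \<le> B + C" if "G \<in> hyps" for G
      using abs_triangle_ineq[of "p G" "q G"] bspec[OF B that] bspec[OF C that] by linarith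
  qed
qed

lemma test_fun_mult: assumes "test_fun p" "test_fun q" shows "test_fun (\<lambda>G. p G * q G)"
proof -
  obtain B where B: "0 \<le> B" "\<forall>G\<in>hyps. \<bar>p G\<bar> \<le> B" using test_fun_bound[OF assms(1)] by blast
  obtain C where C: "\<forall>G\<in>hyps. \<bar>q G\<bar> \<le> C" using test_fun_bound[OF assms(2)] by blast
  show ?thesis
  proof (rule test_funI[OF continuous_map_real_mult[OF assms[THEN test_funD]]])
    show "\<bar>p G * q G\<bar> \<le> B * C" if "G \<in> hyps" for G
      unfolding abs_mult using bspec[OF B(2) that] bspec[OF C that] B(1) by (intro mult_mono) auto
  qed
qed

lemma test_fun_const: "test_fun (\<lambda>_. c)"
  by (rule test_funI[of _ "\<bar>c\<bar>"]) simp_all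

lemma test_fun_diff: "test_fun p \<Longrightarrow> test_fun q \<Longrightarrow> test_fun (\<lambda>G. p G - q G)"
  using test_fun_add[of p "\<lambda>G. -1 * q G"] test_fun_mult[OF test_fun_const[of "-1"], of q] by simp

lemma test_fun_lim:
  assumes "\<And>e. 0 < e \<Longrightarrow> \<exists>q. test_fun q \<and> (\<forall>G\<in>hyps. \<bar>p G - q G\<bar> \<le> e)"
  shows "test_fun p"
proof -
  have "continuous_map (unlabelled_topology r) euclideanreal p"
  proof (rule continuous_map_real_uniform_limit)
    fix e :: real assume "0 < e"
    from assms[OF this] obtain q where "test_fun q" "\<forall>G\<in>hyps. \<bar>p G - q G\<bar> \<le> e" by blast
    then show "\<exists>q. continuous_map (unlabelled_topology r) euclideanreal q \<and>
        (\<forall>G\<in>topspace (unlabelled_topology r). \<bar>p G - q G\<bar> \<le> e)"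
      unfolding topspace_unlabelled_topology by (intro exI[of _ q]) (simp add: test_funD)
  qed
  moreover obtain q where q: "test_fun q" "\<forall>G\<in>hyps. \<bar>p G - q G\<bar> \<le> 1"
    using assms[of 1] by auto
  obtain B where B: "\<forall>G\<in>hyps. \<bar>q G\<bar> \<le> B" using test_fun_bound[OF q(1)] by blast
  have "\<bar>p G\<bar> \<le> B + 1" if "G \<in> hyps" for G
    using bspec[OF q(2) that] bspec[OF B that] by linarith
  ultimately show ?thesis by (rule test_funI)
qed

lemma test_fun_hom: "F \<in> unlabelled r UNIV \<Longrightarrow> test_fun (hom_density r F)"
  by (rule test_funI[OF continuous_map_hom_density abs_hom_density_le])

lemma test_fun_inj: "F \<in> unlabelled r UNIV \<Longrightarrow> test_fun (inj_density r F)"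
  by (rule test_funI[OF continuous_map_inj_density abs_inj_density_le])

definition inv_size :: "'k hypergraph set \<Rightarrow> real" where
  "inv_size G = 1 / real (num_vertices G)"

lemma inv_size_bounds: "0 \<le> inv_size G" "inv_size G \<le> 1"
  by (auto simp: inv_size_def divide_simps)

lemma test_fun_inv_size: "test_fun inv_size"
  unfolding inv_size_def[abs_def]
  by (rule test_funI[OF continuous_map_inverse_num_vertices, of 1]) (auto simp: divide_simps)

section \<open>Expectations and the effect of growing size\<close>

lemma test_measurable: "test_fun p \<Longrightarrow> (\<lambda>\<omega>. p (X n \<omega>)) \<in> borel_measurable (M n)"
  using measurable_compose[OF X_measurable continuous_map_borel_measurable[OF test_funD]] .

lemma test_integrable:
  assumes "test_fun p" shows "integrable (M n) (\<lambda>\<omega>. p (X n \<omega>))"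
proof -
  interpret prob_space "M n" by (rule prob_M)
  obtain B where "\<forall>G\<in>hyps. \<bar>p G\<bar> \<le> B" using test_fun_bound[OF assms] by blast
  then show ?thesis
    using test_measurable[OF assms] X_in
    by (intro integrable_const_bound[of _ B]) (auto intro!: AE_I2)
qed

lemma expect_add: "test_fun p \<Longrightarrow> test_fun q \<Longrightarrow> expect n (\<lambda>G. p G + q G) = expect n p + expect n q"
  unfolding expect_def by (intro Bochner_Integration.integral_add test_integrable)

lemma expect_diff: "test_fun p \<Longrightarrow> test_fun q \<Longrightarrow> expect n (\<lambda>G. p G - q G) = expect n p - expect n q"
  unfolding expect_def by (intro Bochner_Integration.integral_diff test_integrable)

lemma expect_mult: "expect n (\<lambda>G. c * p G) = c * expect n p"
  unfolding expect_def by simp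

lemma expect_const: "expect n (\<lambda>_. c) = c"
  unfolding expect_def using prob_space.prob_space[OF prob_M] by simp

lemma expect_cong: "(\<And>G. G \<in> hyps \<Longrightarrow> p G = q G) \<Longrightarrow> expect n p = expect n q"
  unfolding expect_def using X_in by (intro Bochner_Integration.integral_cong) auto

lemma expect_mono:
  "test_fun p \<Longrightarrow> test_fun q \<Longrightarrow> (\<And>G. G \<in> hyps \<Longrightarrow> p G \<le> q G) \<Longrightarrow> expect n p \<le> expect n q"
  unfolding expect_def using X_in by (intro integral_mono test_integrable) auto

lemma expect_abs_le:
  assumes "test_fun p" "test_fun q" "\<And>G. G \<in> hyps \<Longrightarrow> \<bar>p G\<bar> \<le> q G"
  shows "\<bar>expect n p\<bar> \<le> expect n q"
proof -
  have "expect n p \<le> expect n q"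
    by (rule expect_mono[OF assms(1,2)]) (use assms(3) abs_le_D1 in blast)
  moreover have "expect n (\<lambda>G. -1 * p G) \<le> expect n q"
    by (rule expect_mono[OF test_fun_mult[OF test_fun_const assms(1)] assms(2)])
       (use assms(3) abs_le_D2 in auto)
  ultimately show ?thesis unfolding expect_mult by simp
qed

text \<open>Truncation at \<open>Suc m\<close> vertices: \<open>inv_size\<close> is at most
  \<open>1 / Suc m\<close> on the large hypergraphs and at most 1 on the rest, whose probability
  tends to 0.\<close>

lemma expect_inv_size: "(\<lambda>n. expect n inv_size) \<longlonglongrightarrow> 0"
proof (rule LIMSEQ_I)
  fix e :: real assume e: "0 < e"
  obtain m where m: "inverse (real (Suc m)) < e / 2" using reals_Archimedean[of "e / 2"] e by auto
  let ?A = "\<lambda>n. {\<omega> \<in> space (M n). Suc m \<le> num_vertices (X n \<omega>)}"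
  obtain N where N: "\<And>n. N \<le> n \<Longrightarrow> \<bar>measure (M n) (?A n) - 1\<bar> < e / 2"
    using LIMSEQ_D[OF large[of "Suc m"], of "e / 2"] e by auto
  have "norm (expect n inv_size - 0) < e" if n: "N \<le> n" for n
  proof -
    interpret prob_space "M n" by (rule prob_M)
    have A: "?A n \<in> sets (M n)"
    proof -
      \<comment> \<open>Rewritten through the continuous function \<open>inv_size\<close>, the event
        is visibly measurable.\<close>
      have "?A n = {\<omega> \<in> space (M n). inv_size (X n \<omega>) \<le> inverse (real (Suc m))}"
      proof (rule Collect_cong, rule conj_cong[OF refl])
        fix \<omega> assume "\<omega> \<in> space (M n)"
        then have "num_vertices (X n \<omega>) > 0" by (rule num_vertices_pos[OF X_in])
        then show "Suc m \<le> num_vertices (X n \<omega>) \<longleftrightarrow> inv_size (X n \<omega>) \<le> inverse (real (Suc m))"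
          by (simp add: inv_size_def inverse_eq_divide divide_simps flip: of_nat_Suc)
      qed
      also have "\<dots> \<in> sets (M n)" using test_measurable[OF test_fun_inv_size] by measurable
      finally show ?thesis .
    qed
    have "expect n inv_size \<le> (\<integral>\<omega>. inverse (real (Suc m)) + (1 - indicator (?A n) \<omega>) \<partial>M n)"
      unfolding expect_def
    proof (rule integral_mono[OF test_integrable[OF test_fun_inv_size]])
      show "integrable (M n) (\<lambda>\<omega>. inverse (real (Suc m)) + (1 - indicator (?A n) \<omega>))"
        using A by (intro Bochner_Integration.integrable_add Bochner_Integration.integrable_diff
          integrable_real_indicator) (auto simp: emeasure_eq_measure)
      fix \<omega> assume \<omega>: "\<omega> \<in> space (M n)"
      show "inv_size (X n \<omega>) \<le> inverse (real (Suc m)) + (1 - indicator (?A n) \<omega>)"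
      proof (cases "\<omega> \<in> ?A n")
        case True
        then have "inv_size (X n \<omega>) \<le> inverse (real (Suc m))"
          by (simp add: inv_size_def inverse_eq_divide divide_simps)
        then show ?thesis using True by simp
      next
        case False
        then show ?thesis using inv_size_bounds(2)[of "X n \<omega>"]
          by (simp add: indicator_def) (smt (verit) inverse_nonnegative_iff_nonnegative of_nat_0_le_iff)
      qed
    qed
    also have "\<dots> = inverse (real (Suc m)) + (1 - measure (M n) (?A n))"
      using A by (simp add: prob_space emeasure_eq_measure)
    also have "\<dots> < e" using m N[OF n] by linarith
    finally have "expect n inv_size < e" .
    moreover have "0 \<le> expect n inv_size"
      unfolding expect_def using inv_size_bounds(1) by (intro integral_nonneg_AE) auto
    ultimately show ?thesis by simp
  qed
  then show "\<exists>no. \<forall>n\<ge>no. norm (expect n inv_size - 0) < e" by blast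
qed

text \<open>One \<open>e\<close> is the pointwise slack; the second absorbs \<open>C\<close> times
  the expectation of \<open>inv_size\<close>, which is eventually below \<open>e\<close>.\<close>

lemma expect_close:
  assumes p: "test_fun p" and q: "test_fun q" and e: "0 < e"
    and le: "\<And>G. G \<in> hyps \<Longrightarrow> \<bar>p G - q G\<bar> \<le> e + C * inv_size G"
  shows "\<exists>N. \<forall>n\<ge>N. \<bar>expect n p - expect n q\<bar> < 2 * e"
proof -
  have t: "test_fun (\<lambda>G. e + C * inv_size G)"
    by (intro test_fun_add test_fun_mult test_fun_const test_fun_inv_size)
  have "(\<lambda>n. C * expect n inv_size) \<longlonglongrightarrow> 0"
    using tendsto_mult_right_zero[OF expect_inv_size] .
  then obtain N where N: "\<And>n. N \<le> n \<Longrightarrow> \<bar>C * expect n inv_size\<bar> < e"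
    using LIMSEQ_D[of "\<lambda>n. C * expect n inv_size" 0 e] e by auto
  have "\<bar>expect n p - expect n q\<bar> < 2 * e" if "N \<le> n" for n
  proof -
    have "\<bar>expect n (\<lambda>G. p G - q G)\<bar> \<le> expect n (\<lambda>G. e + C * inv_size G)"
      by (rule expect_abs_le[OF test_fun_diff[OF p q] t le])
    also have "\<dots> = e + C * expect n inv_size"
      using expect_add[OF test_fun_const test_fun_mult[OF test_fun_const test_fun_inv_size]]
      by (simp add: expect_const expect_mult)
    finally have "\<bar>expect n p - expect n q\<bar> \<le> e + C * expect n inv_size" by (simp add: expect_diff[OF p q])
    then show ?thesis using N[OF that] abs_ge_self[of "C * expect n inv_size"] by linarith
  qed
  then show ?thesis by blast
qed

lemma expect_negligible:
  assumes p: "test_fun p"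
    and small: "\<And>e. 0 < e \<Longrightarrow> \<exists>C. \<forall>G\<in>hyps. \<bar>p G\<bar> \<le> e + C * inv_size G"
  shows "(\<lambda>n. expect n p) \<longlonglongrightarrow> 0"
proof (rule LIMSEQ_I)
  fix e :: real assume e: "0 < e"
  obtain C where C: "\<And>G. G \<in> hyps \<Longrightarrow> \<bar>p G\<bar> \<le> e / 2 + C * inv_size G" using small[of "e / 2"] e by auto
  show "\<exists>no. \<forall>n\<ge>no. norm (expect n p - 0) < e"
    using expect_close[OF p test_fun_const[of 0], of "e / 2" C] C e by (simp add: expect_const)
qed

text \<open>The constant \<open>C\<close> may depend on \<open>e\<close>, since for fixed
  \<open>e\<close> its term vanishes in expectation as \<open>n\<close> grows.\<close>

lemma conv_approx:
  assumes p: "test_fun p"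
    and approx: "\<And>e. 0 < e \<Longrightarrow> \<exists>q C. conv q \<and> (\<forall>G\<in>hyps. \<bar>p G - q G\<bar> \<le> e + C * inv_size G)"
  shows "conv p"
proof -
  have "Cauchy (\<lambda>n. expect n p)"
  proof (rule metric_CauchyI)
    fix e :: real assume e: "0 < e"
    \<comment> \<open>\<open>expect_close\<close> doubles \<open>e / 8\<close> to
      \<open>e / 4\<close>; with one more \<open>e / 4\<close> for the Cauchy tail the three terms
      stay below \<open>e\<close>.\<close>
    obtain q C where q: "conv q" "\<And>G. G \<in> hyps \<Longrightarrow> \<bar>p G - q G\<bar> \<le> e / 8 + C * inv_size G"
      using approx[of "e / 8"] e by auto
    have tq: "test_fun q" and e8: "0 < e / 8" using q(1) e by (simp_all add: conv_def)
    obtain N where near: "\<And>n. N \<le> n \<Longrightarrow> \<bar>expect n p - expect n q\<bar> < e / 4"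
      using expect_close[OF p tq e8 q(2)] by auto
    obtain N' where N': "\<And>m n. N' \<le> m \<Longrightarrow> N' \<le> n \<Longrightarrow> dist (expect m q) (expect n q) < e / 4"
      using metric_CauchyD[of "\<lambda>n. expect n q" "e / 4"] q(1) e by (auto simp: conv_def convergent_Cauchy)
    have "dist (expect m p) (expect n p) < e" if "max N N' \<le> m" "max N N' \<le> n" for m n
    proof -
      have "\<bar>expect m p - expect n p\<bar> \<le>
          \<bar>expect m p - expect m q\<bar> + \<bar>expect m q - expect n q\<bar> + \<bar>expect n p - expect n q\<bar>"
        by arith
      then show ?thesis using near[of m] near[of n] N'[of m n] that e unfolding dist_real_def by simp
    qed
    then show "\<exists>M. \<forall>m\<ge>M. \<forall>n\<ge>M. dist (expect m p) (expect n p) < e" by blast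
  qed
  then show ?thesis using p by (simp add: conv_def convergent_eq_Cauchy Cauchy_convergent)
qed

lemma conv_add: "conv p \<Longrightarrow> conv q \<Longrightarrow> conv (\<lambda>G. p G + q G)"
  unfolding conv_def by (simp add: test_fun_add expect_add convergent_add)

lemma conv_mult: "conv p \<Longrightarrow> conv (\<lambda>G. c * p G)"
  unfolding conv_def by (auto simp: expect_mult intro: test_fun_mult test_fun_const convergent_mult convergent_const)

lemma conv_const: "conv (\<lambda>_. c)"
  unfolding conv_def by (simp add: test_fun_const expect_const convergent_const)

lemma conv_lim:
  assumes "\<And>e. 0 < e \<Longrightarrow> \<exists>q. conv q \<and> (\<forall>G\<in>hyps. \<bar>p G - q G\<bar> \<le> e)"
  shows "conv p"
proof (rule conv_approx)
  show "test_fun p" by (rule test_fun_lim) (use assms in \<open>auto simp: conv_def\<close>)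
  show "\<exists>q C. conv q \<and> (\<forall>G\<in>hyps. \<bar>p G - q G\<bar> \<le> e + C * inv_size G)" if "0 < e" for e
  proof -
    from assms[OF that] obtain q where "conv q" "\<forall>G\<in>hyps. \<bar>p G - q G\<bar> \<le> e" by blast
    then show ?thesis by (intro exI[of _ q] exI[of _ 0]) simp
  qed
qed

section \<open>Convergence of all moments\<close>

definition moments_converge :: bool where
  "moments_converge \<longleftrightarrow> (\<forall>F\<in>unlabelled r UNIV. conv (hom_density r F))"

lemma moments_convergeI:
  assumes "\<And>F. F \<in> unlabelled r \<F> \<Longrightarrow> conv (hom_density r F)"
  shows moments_converge
  unfolding moments_converge_def
proof
  fix F :: "('k \<Rightarrow>\<^sub>C real) hypergraph set" assume F: "F \<in> unlabelled r UNIV"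
  show "conv (hom_density r F)"
    by (rule hom_density_multilinear_induct[OF dense_F conv_const conv_add conv_mult conv_lim assms F])
qed

lemma conv_inj_iff_hom:
  assumes F: "F \<in> unlabelled r UNIV"
  shows "conv (inj_density r F) \<longleftrightarrow> conv (hom_density r F)"
proof -
  obtain C where C: "\<And>G. G \<in> hyps \<Longrightarrow> \<bar>inj_density r F G - hom_density r F G\<bar> \<le> C / real (num_vertices G)"
    using inj_hom_density_diff[OF F] by metis
  have d: "\<bar>inj_density r F G - hom_density r F G\<bar> \<le> e + C * inv_size G" if "G \<in> hyps" "0 < e" for G e
    using C[OF that(1)] that(2) by (simp add: inv_size_def)
  show ?thesis
  proof
    assume c: "conv (inj_density r F)"
    show "conv (hom_density r F)"
      by (rule conv_approx[OF test_fun_hom[OF F]])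
         (use c d in \<open>auto simp: abs_minus_commute intro!: exI[of _ "inj_density r F"] exI[of _ C]\<close>)
  next
    assume c: "conv (hom_density r F)"
    show "conv (inj_density r F)"
      by (rule conv_approx[OF test_fun_inj[OF F]])
         (use c d in \<open>auto intro!: exI[of _ "hom_density r F"] exI[of _ C]\<close>)
  qed
qed

section \<open>The algebra of the densities\<close>

text \<open>Finite linear combinations, generated term by term so that products are handled by
  inductions on both factors.\<close>

inductive_set hom_span :: "('k hypergraph set \<Rightarrow> real) set" where
  zero: "(\<lambda>_. 0) \<in> hom_span"
| step: "p \<in> hom_span \<Longrightarrow> F \<in> unlabelled r UNIV \<Longrightarrow> (\<lambda>G. p G + c * hom_density r F G) \<in> hom_span"

lemma hom_span_test: "p \<in> hom_span \<Longrightarrow> test_fun p"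
  by (induction rule: hom_span.induct)
     (auto intro!: test_fun_add test_fun_mult test_fun_const test_fun_hom)

lemma hom_span_conv:
  assumes "p \<in> hom_span" moments_converge shows "conv p"
  using assms
  by (induction rule: hom_span.induct) (auto intro!: conv_add conv_mult conv_const simp: moments_converge_def)

lemma hom_span_add: "q \<in> hom_span \<Longrightarrow> p \<in> hom_span \<Longrightarrow> (\<lambda>G. p G + q G) \<in> hom_span"
proof (induction rule: hom_span.induct)
  case (step q F c)
  then show ?case using hom_span.step[of "\<lambda>G. p G + q G" F c] by (simp add: add.assoc)
qed simp

text \<open>Equality is claimed on \<open>hyps\<close> only, as \<open>hom_density_mult\<close>
  passes through representatives; this is enough for expectations.\<close>

lemma hom_span_mult_hom:
  assumes "p \<in> hom_span" and F: "F \<in> unlabelled r UNIV"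
  shows "\<exists>q\<in>hom_span. \<forall>G\<in>hyps. q G = p G * (c * hom_density r F G)"
  using assms(1)
proof (induction rule: hom_span.induct)
  case zero
  show ?case using hom_span.zero by auto
next
  case (step p F' c')
  then obtain q where q: "q \<in> hom_span" "\<And>G. G \<in> hyps \<Longrightarrow> q G = p G * (c * hom_density r F G)" by auto
  obtain F'' where F'': "F'' \<in> unlabelled r UNIV"
    "\<And>G. G \<in> hyps \<Longrightarrow> hom_density r F'' G = hom_density r F' G * hom_density r F G"
    using hom_density_mult[OF r step.hyps(2) F] by metis
  show ?case
    by (rule bexI[OF _ hom_span.step[OF q(1) F''(1), of "c' * c"]])
       (simp add: q(2) F''(2) algebra_simps)
qed

lemma hom_span_mult:
  assumes "q \<in> hom_span" "p \<in> hom_span"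
  shows "\<exists>s\<in>hom_span. \<forall>G\<in>hyps. s G = p G * q G"
  using assms(1)
proof (induction rule: hom_span.induct)
  case zero
  show ?case using hom_span.zero by auto
next
  case (step q F c)
  then obtain s where s: "s \<in> hom_span" "\<And>G. G \<in> hyps \<Longrightarrow> s G = p G * q G" by auto
  obtain s' where s': "s' \<in> hom_span" "\<And>G. G \<in> hyps \<Longrightarrow> s' G = p G * (c * hom_density r F G)"
    using hom_span_mult_hom[OF assms(2) step.hyps(2), of c] by auto
  show ?case
    by (rule bexI[OF _ hom_span_add[OF s'(1) s(1)]]) (simp add: s(2) s'(2) distrib_left)
qed

text \<open>The slack admits \<open>inv_size\<close>, the last coordinate of
  \<open>tau_plus\<close>, with 0 as its approximation. Thus all coordinates of the space of limits
  become members after composition with \<open>tau_plus\<close>.\<close>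

definition near_span :: "('k hypergraph set \<Rightarrow> real) \<Rightarrow> bool" where
  "near_span p \<longleftrightarrow> test_fun p \<and> (\<exists>q\<in>hom_span. \<exists>C. \<forall>G\<in>hyps. \<bar>p G - q G\<bar> \<le> C * inv_size G)"

lemma near_span_conv:
  assumes "near_span p" moments_converge shows "conv p"
proof -
  obtain q C where q: "test_fun p" "q \<in> hom_span" "\<And>G. G \<in> hyps \<Longrightarrow> \<bar>p G - q G\<bar> \<le> C * inv_size G"
    using assms(1) by (auto simp: near_span_def)
  show ?thesis
    by (rule conv_approx[OF q(1)], rule exI[of _ q], rule exI[of _ C])
       (use q(3) hom_span_conv[OF q(2) assms(2)] in \<open>auto intro!: add_increasing\<close>)
qed

lemma near_span_add:
  assumes "near_span p" "near_span p'" shows "near_span (\<lambda>G. p G + p' G)"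
proof -
  obtain q C where q: "test_fun p" "q \<in> hom_span" "\<And>G. G \<in> hyps \<Longrightarrow> \<bar>p G - q G\<bar> \<le> C * inv_size G"
    using assms(1) by (auto simp: near_span_def)
  obtain q' C' where q': "test_fun p'" "q' \<in> hom_span" "\<And>G. G \<in> hyps \<Longrightarrow> \<bar>p' G - q' G\<bar> \<le> C' * inv_size G"
    using assms(2) by (auto simp: near_span_def)
  have "\<bar>(p G + p' G) - (q G + q' G)\<bar> \<le> (C + C') * inv_size G" if "G \<in> hyps" for G
    using q(3)[OF that] q'(3)[OF that] unfolding distrib_right by linarith
  then show ?thesis
    unfolding near_span_def
    using test_fun_add[OF q(1) q'(1)] by (intro conjI bexI[OF _ hom_span_add[OF q'(2) q(2)]]) auto
qed

text \<open>Test functions are bounded, so the error of a product is again a constant times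
  \<open>inv_size\<close>.\<close>

lemma near_span_mult:
  assumes "near_span p" "near_span p'" shows "near_span (\<lambda>G. p G * p' G)"
proof -
  obtain q C where q: "test_fun p" "q \<in> hom_span" "\<And>G. G \<in> hyps \<Longrightarrow> \<bar>p G - q G\<bar> \<le> C * inv_size G"
    using assms(1) by (auto simp: near_span_def)
  obtain q' C' where q': "test_fun p'" "q' \<in> hom_span" "\<And>G. G \<in> hyps \<Longrightarrow> \<bar>p' G - q' G\<bar> \<le> C' * inv_size G"
    using assms(2) by (auto simp: near_span_def)
  obtain s where s: "s \<in> hom_span" "\<And>G. G \<in> hyps \<Longrightarrow> s G = q G * q' G"
    using hom_span_mult[OF q'(2) q(2)] by blast
  obtain B where B: "0 \<le> B" "\<And>G. G \<in> hyps \<Longrightarrow> \<bar>p' G\<bar> \<le> B" using test_fun_bound[OF q'(1)] by blast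
  obtain B' where B': "0 \<le> B'" "\<And>G. G \<in> hyps \<Longrightarrow> \<bar>q G\<bar> \<le> B'" using test_fun_bound[OF hom_span_test[OF q(2)]] by blast
  have "\<bar>p G * p' G - s G\<bar> \<le> (C * B + B' * C') * inv_size G" if G: "G \<in> hyps" for G
  proof -
    have "p G * p' G - s G = (p G - q G) * p' G + q G * (p' G - q' G)"
      by (simp add: s(2)[OF G] algebra_simps)
    also have "\<bar>\<dots>\<bar> \<le> \<bar>p G - q G\<bar> * \<bar>p' G\<bar> + \<bar>q G\<bar> * \<bar>p' G - q' G\<bar>"
      by (rule order_trans[OF abs_triangle_ineq]) (simp add: abs_mult)
    also have "\<dots> \<le> (C * inv_size G) * B + B' * (C' * inv_size G)"
      using q(3)[OF G] q'(3)[OF G] B(1) B(2)[OF G] B'(1) B'(2)[OF G]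
      by (intro add_mono mult_mono) (auto intro: order_trans[OF abs_ge_zero])
    finally show ?thesis by (simp add: algebra_simps)
  qed
  then show ?thesis
    unfolding near_span_def using test_fun_mult[OF q(1) q'(1)] by (intro conjI bexI[OF _ s(1)]) auto
qed

lemma near_span_hom:
  assumes F: "F \<in> unlabelled r UNIV" shows "near_span (hom_density r F)"
  unfolding near_span_def
  using test_fun_hom[OF F] hom_span.step[OF hom_span.zero F, of 1]
  by (intro conjI bexI[of _ "\<lambda>G. 0 + 1 * hom_density r F G"] exI[of _ 0]) auto

lemma near_span_inv_size: "near_span inv_size"
  unfolding near_span_def
  using test_fun_inv_size hom_span.zero inv_size_bounds(1)
  by (intro conjI bexI[of _ "\<lambda>_. 0"] exI[of _ 1]) auto

lemma near_span_const: "near_span (\<lambda>_. c)"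
proof -
  \<comment> \<open>One vertex carrying the constant 1 has density 1 in every hypergraph.\<close>
  define F :: "('k \<Rightarrow>\<^sub>C real) hypergraph" where "F = ({0}, \<lambda>i\<in>tuples r {0}. const_bcontfun 1)"
  have F: "F \<in> hypergraphs r UNIV" by (simp add: F_def)
  have "lab_hom_density r F G = 1" if "G \<in> hypergraphs r UNIV" for G
    using hypergraphsD(4)[OF that]
    by (simp add: lab_hom_density_def hom_sum_def F_def card_funcsetE)
  then have one: "hom_density r (iso_class r F) G = 1" if "G \<in> hyps" for G
    using hom_density_iso_class[OF F rep_unlabelled(1)[OF that]] rep_unlabelled[OF that] by simp
  show ?thesis
    unfolding near_span_def
    using test_fun_const hom_span.step[OF hom_span.zero iso_class_in[OF F], of c] one
    by (intro conjI bexI[of _ "\<lambda>G. 0 + c * hom_density r (iso_class r F) G"] exI[of _ 0]) auto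
qed

end

subsection \<open>The space of limits\<close>

lemma countable_tuples_funs:
  assumes "countable S" "finite V"
  shows "countable (tuples r V \<rightarrow>\<^sub>E S)"
  using assms by (intro countable_PiE finite_tuples) auto

text \<open>Countably many coordinates are what lets a sequence of functions separate the points of
  the space of limits.\<close>

lemma countable_unlabelled:
  assumes "countable S" shows "countable (unlabelled r S)"
proof -
  have "countable {V :: nat set. finite V \<and> V \<noteq> {}}"
    by (rule countable_subset[OF _ countable_Collect_finite]) auto
  then have "countable (hypergraphs r S)"
    unfolding hypergraphs_def by (rule countable_SIGMA) (simp add: countable_tuples_funs[OF assms])
  then have "countable (iso_class r ` hypergraphs r S)" by (rule countable_image)
  moreover have "unlabelled r S \<subseteq> iso_class r ` hypergraphs r S" by (auto elim: unlabelledE)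
  ultimately show ?thesis using countable_subset by blast
qed

context random_hypergraphs
begin

abbreviation "T \<equiv> limit_topology r \<F>"
abbreviation "tau \<equiv> tau_plus r \<F>"

definition law :: "nat \<Rightarrow> ((('k \<Rightarrow>\<^sub>C real) hypergraph set \<Rightarrow> real) \<times> real) measure" where
  "law n = distr (M n) (borel_of T) (\<lambda>\<omega>. tau (X n \<omega>))"

lemma F_sub: "unlabelled r \<F> \<subseteq> unlabelled r UNIV"
  by (rule unlabelled_mono) simp

lemma topspace_cube: "topspace (cube_topology r \<F>) = (unlabelled r \<F> \<rightarrow>\<^sub>E {-1..1}) \<times> {0..1}"
  by (simp add: cube_topology_def)

lemma continuous_map_tau_cube: "continuous_map (unlabelled_topology r) (cube_topology r \<F>) tau"
  unfolding cube_topology_def tau_plus_def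
proof (rule continuous_map_pairedI)
  show "continuous_map (unlabelled_topology r) (product_topology (\<lambda>_. top_of_set {- 1..1}) (unlabelled r \<F>))
     (\<lambda>G. \<lambda>F\<in>unlabelled r \<F>. hom_density r F G)"
    unfolding continuous_map_componentwise
  proof (intro conjI ballI)
    fix F assume F: "F \<in> unlabelled r \<F>"
    have "continuous_map (unlabelled_topology r) (top_of_set {-1..1}) (hom_density r F)"
      unfolding continuous_map_in_subtopology
      using continuous_map_hom_density[of F r] F F_sub abs_hom_density_le_1[OF F norm_F]
      by (auto simp: abs_le_iff minus_le_iff)
    then show "continuous_map (unlabelled_topology r) (top_of_set {- 1..1})
        (\<lambda>G. (\<lambda>F\<in>unlabelled r \<F>. hom_density r F G) F)"
      using F by simp
  qed auto
  show "continuous_map (unlabelled_topology r) (top_of_set {0..1}) (\<lambda>G. 1 / real (num_vertices G))"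
    unfolding continuous_map_in_subtopology
    using continuous_map_inverse_num_vertices by (auto simp: divide_simps)
qed

lemma tau_in_cube: "G \<in> hyps \<Longrightarrow> tau G \<in> topspace (cube_topology r \<F>)"
  using continuous_map_tau_cube unfolding continuous_map_def topspace_unlabelled_topology by blast

lemma topspace_T: "topspace T = cube_topology r \<F> closure_of tau_image r \<F>"
  unfolding limit_topology_def topspace_subtopology
  by (rule inf_absorb2) (rule closure_of_subset_topspace)

lemma tau_in_T: "G \<in> hyps \<Longrightarrow> tau G \<in> topspace T"
  unfolding topspace_T
  by (rule subsetD[OF closure_of_subset]) (use tau_in_cube in \<open>auto simp: tau_image_def\<close>)

lemma continuous_map_tau: "continuous_map (unlabelled_topology r) T tau"
  unfolding limit_topology_def continuous_map_in_subtopology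
  using continuous_map_tau_cube tau_in_T by (auto simp: topspace_T topspace_unlabelled_topology)

lemma compact_T: "compact_space T"
proof -
  have "compact_space (cube_topology r \<F>)"
    unfolding cube_topology_def compact_space_prod_topology compact_space_product_topology
    by (auto simp: compact_space_subtopology compactin_euclidean_iff)
  then show ?thesis
    unfolding limit_topology_def by (intro compact_space_subtopology closedin_compact_space) auto
qed

lemma continuous_map_coordinate:
  assumes "F \<in> unlabelled r \<F>"
  shows "continuous_map T euclideanreal (\<lambda>\<Gamma>. fst \<Gamma> F)"
proof -
  have "continuous_map (cube_topology r \<F>) (top_of_set {-1..1}) (\<lambda>\<Gamma>. fst \<Gamma> F)"
    using continuous_map_compose[OF continuous_map_fst continuous_map_product_projection[OF assms]]
    unfolding cube_topology_def comp_def .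
  then show ?thesis
    unfolding limit_topology_def
    by (intro continuous_map_from_subtopology) (auto simp: continuous_map_in_subtopology)
qed

lemma continuous_map_size_coordinate: "continuous_map T euclideanreal snd"
proof -
  have "continuous_map (cube_topology r \<F>) (top_of_set {0..1}) snd"
    unfolding cube_topology_def by (rule continuous_map_snd)
  then show ?thesis
    unfolding limit_topology_def
    by (intro continuous_map_from_subtopology) (auto simp: continuous_map_in_subtopology)
qed

lemma tau_coordinate: "F \<in> unlabelled r \<F> \<Longrightarrow> fst (tau G) F = hom_density r F G"
  by (simp add: tau_plus_def)

lemma snd_tau: "snd (tau G) = inv_size G"
  by (simp add: tau_plus_def inv_size_def)

definition coordinates :: "((('k \<Rightarrow>\<^sub>C real) hypergraph set \<Rightarrow> real) \<times> real \<Rightarrow> real) set" where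
  "coordinates = insert snd ((\<lambda>F \<Gamma>. fst \<Gamma> F) ` unlabelled r \<F>)"

lemma range_coordinates: "range (from_nat_into coordinates) = coordinates"
  using countable_unlabelled[OF countable_F] by (intro range_from_nat_into) (auto simp: coordinates_def)

lemma continuous_map_coordinates:
  assumes "c \<in> coordinates" shows "continuous_map T euclideanreal c"
  using assms unfolding coordinates_def
proof (elim insertE imageE)
  show "continuous_map T euclideanreal c" if "c = snd"
    unfolding that by (rule continuous_map_size_coordinate)
  show "continuous_map T euclideanreal c" if "c = (\<lambda>\<Gamma>. fst \<Gamma> F)" "F \<in> unlabelled r \<F>" for F
    unfolding that(1) by (rule continuous_map_coordinate[OF that(2)])
qed

lemma T_subset: "topspace T \<subseteq> (unlabelled r \<F> \<rightarrow>\<^sub>E {-1..1}) \<times> {0..1}"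
  unfolding topspace_T topspace_cube[symmetric] by (rule closure_of_subset_topspace)

text \<open>Points of the cube are extensional in their first component, so agreement on all
  coordinates makes them equal.\<close>

lemma separated_T: "separated_compact T (from_nat_into coordinates)"
proof (rule separated_compact.intro)
  show "compact_space T" by (rule compact_T)
  show "continuous_map T euclideanreal (from_nat_into coordinates j)" for j
    by (rule continuous_map_coordinates[OF subsetD[OF equalityD1[OF range_coordinates] rangeI]])
  fix x y assume x: "x \<in> topspace T" and y: "y \<in> topspace T" and ne: "x \<noteq> y"
  have ext: "fst z \<in> extensional (unlabelled r \<F>)" if "z \<in> topspace T" for z
    using subsetD[OF T_subset that] by (simp add: PiE_iff mem_Times_iff)
  have ex: "\<exists>c\<in>coordinates. c x \<noteq> c y"
  proof (rule ccontr)
    assume "\<not> (\<exists>c\<in>coordinates. c x \<noteq> c y)"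
    then have eq: "\<forall>c\<in>coordinates. c x = c y" by blast
    then have "fst x F = fst y F" if "F \<in> unlabelled r \<F>" for F
      using that by (simp add: coordinates_def)
    then have "fst x = fst y" by (rule extensionalityI[OF ext[OF x] ext[OF y]])
    moreover have "snd x = snd y" using eq by (simp add: coordinates_def)
    ultimately show False using ne by (simp add: prod_eq_iff)
  qed
  from ex obtain c where c: "c \<in> coordinates" "c x \<noteq> c y" by blast
  from c(1) have "c \<in> range (from_nat_into coordinates)" by (simp only: range_coordinates)
  then obtain j where "c = from_nat_into coordinates j" by (rule rangeE)
  then show "\<exists>j. from_nat_into coordinates j x \<noteq> from_nat_into coordinates j y"
    using c(2) by auto
qed

lemma continuous_T_bounded:
  assumes "continuous_map T euclideanreal f" shows "bounded (f ` topspace T)"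
  using image_compactin[OF _ assms, of "topspace T"] compact_T
  by (simp add: compact_space_def compact_imp_bounded)

section \<open>Continuous extension of the densities to the closure\<close>

text \<open>The points satisfying the bound form a closed set containing the dense image of
  \<open>tau_plus\<close>.\<close>

lemma dense_bound:
  assumes f: "continuous_map T euclideanreal f" and le: "\<And>G. G \<in> hyps \<Longrightarrow> \<bar>f (tau G)\<bar> \<le> c"
    and x: "x \<in> topspace T"
  shows "\<bar>f x\<bar> \<le> c"
proof -
  let ?C = "{y \<in> topspace T. f y \<in> {-c..c}}"
  have "closedin T ?C" by (rule closedin_continuous_map_preimage[OF f]) simp
  then have "closedin (cube_topology r \<F>) ?C"
    unfolding limit_topology_def by (rule closedin_trans_full) (rule closedin_closure_of)
  moreover have "tau_image r \<F> \<subseteq> ?C"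
    unfolding tau_image_def
  proof (rule image_subsetI)
    fix G :: "'k hypergraph set" assume G: "G \<in> hyps"
    show "tau G \<in> ?C" using tau_in_T[OF G] le[OF G] by (simp add: abs_le_iff minus_le_iff)
  qed
  ultimately have "topspace T \<subseteq> ?C" unfolding topspace_T by (intro closure_of_minimal)
  then have "x \<in> ?C" using x by (rule subsetD)
  then show ?thesis by (simp add: abs_le_iff minus_le_iff)
qed

text \<open>Having a continuous extension is a property closed under linear combinations and uniform
  limits, so multilinearity reduces it to entries in \<open>\<F>\<close>, where the extension is a
  coordinate.\<close>

lemma extension_exists:
  assumes F: "F \<in> unlabelled r UNIV"
  shows "\<exists>g. continuous_map T euclideanreal g \<and> (\<forall>G\<in>hyps. g (tau G) = hom_density r F G)"
proof -
  define Q where "Q p \<longleftrightarrow> (\<exists>g. continuous_map T euclideanreal g \<and> (\<forall>G\<in>hyps. g (tau G) = p G))"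
    for p :: "'k hypergraph set \<Rightarrow> real"
  have "Q (hom_density r F)"
  proof (rule hom_density_multilinear_induct[OF dense_F _ _ _ _ _ F])
    show "Q (\<lambda>_. 0)" unfolding Q_def by (intro exI[of _ "\<lambda>_. 0"]) simp
    show "Q (\<lambda>G. p G + q G)" if "Q p" "Q q" for p q
    proof -
      from that obtain g h where
        "continuous_map T euclideanreal g" "\<forall>G\<in>hyps. g (tau G) = p G"
        "continuous_map T euclideanreal h" "\<forall>G\<in>hyps. h (tau G) = q G" unfolding Q_def by blast
      then show ?thesis unfolding Q_def by (intro exI[of _ "\<lambda>x. g x + h x"]) (simp add: continuous_map_add)
    qed
    show "Q (\<lambda>G. c * p G)" if "Q p" for c p
    proof -
      from that obtain g where
        "continuous_map T euclideanreal g" "\<forall>G\<in>hyps. g (tau G) = p G" unfolding Q_def by blast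
      then show ?thesis unfolding Q_def by (intro exI[of _ "\<lambda>x. c * g x"]) (simp add: continuous_map_real_mult_left)
    qed
    show "Q (hom_density r F)" if "F \<in> unlabelled r \<F>" for F
      unfolding Q_def using continuous_map_coordinate[OF that] tau_coordinate[OF that]
      by (intro exI[of _ "\<lambda>\<Gamma>. fst \<Gamma> F"]) simp
    show "Q p" if lim: "\<And>e. 0 < e \<Longrightarrow> \<exists>q. Q q \<and> (\<forall>G\<in>hyps. \<bar>p G - q G\<bar> \<le> e)" for p
    proof -
      define \<delta> where "\<delta> n = inverse (real (Suc n))" for n
      have "\<exists>g. continuous_map T euclideanreal g \<and> (\<forall>G\<in>hyps. \<bar>p G - g (tau G)\<bar> \<le> \<delta> n)" for n
      proof -
        have "0 < \<delta> n" by (simp add: \<delta>_def)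
        from lim[OF this] obtain q where q: "Q q" "\<forall>G\<in>hyps. \<bar>p G - q G\<bar> \<le> \<delta> n" by blast
        from q(1) obtain g where "continuous_map T euclideanreal g" "\<forall>G\<in>hyps. g (tau G) = q G"
          unfolding Q_def by blast
        then show ?thesis using q(2) by (intro exI[of _ g]) simp
      qed
      then obtain g where g: "\<And>n. continuous_map T euclideanreal (g n)"
        "\<And>n. \<forall>G\<in>hyps. \<bar>p G - g n (tau G)\<bar> \<le> \<delta> n" by metis
      \<comment> \<open>Both functions are near \<open>p\<close> only on the image of
        \<open>tau_plus\<close>; density carries the estimate to all of \<open>T\<close>, so the
        extensions are uniformly Cauchy.\<close>
      have diff: "\<bar>g m x - g n x\<bar> \<le> \<delta> m + \<delta> n" if "x \<in> topspace T" for m n x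
      proof (rule dense_bound[OF _ _ that])
        show "continuous_map T euclideanreal (\<lambda>x. g m x - g n x)" by (intro continuous_map_diff g)
        show "\<bar>g m (tau G) - g n (tau G)\<bar> \<le> \<delta> m + \<delta> n" if "G \<in> hyps" for G
          using bspec[OF g(2) that, of m] bspec[OF g(2) that, of n] by linarith
      qed
      have \<delta>0: "\<delta> \<longlonglongrightarrow> 0" unfolding \<delta>_def by (rule LIMSEQ_inverse_real_of_nat)
      have cauchy: "Cauchy (\<lambda>n. g n x)" if x: "x \<in> topspace T" for x
      proof (rule metric_CauchyI)
        fix e :: real assume "0 < e"
        then obtain N where N: "\<And>n. N \<le> n \<Longrightarrow> norm (\<delta> n - 0) < e / 2"
          using LIMSEQ_D[OF \<delta>0, of "e / 2"] by auto
        have "dist (g m x) (g n x) < e" if "N \<le> m" "N \<le> n" for m n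
          using diff[OF x, of m n] N[OF that(1)] N[OF that(2)] by (simp add: dist_real_def)
        then show "\<exists>M. \<forall>m\<ge>M. \<forall>n\<ge>M. dist (g m x) (g n x) < e" by blast
      qed
      define h where "h x = lim (\<lambda>n. g n x)" for x
      have h: "(\<lambda>n. g n x) \<longlonglongrightarrow> h x" if "x \<in> topspace T" for x
        using cauchy[OF that] by (simp add: h_def Cauchy_convergent_iff convergent_LIMSEQ_iff)
      have close: "\<bar>h x - g m x\<bar> \<le> \<delta> m" if x: "x \<in> topspace T" for m x
      proof -
        have "(\<lambda>n. \<bar>g n x - g m x\<bar>) \<longlonglongrightarrow> \<bar>h x - g m x\<bar>" by (intro tendsto_intros h x)
        moreover have "(\<lambda>n. \<delta> n + \<delta> m) \<longlonglongrightarrow> 0 + \<delta> m" by (intro tendsto_intros \<delta>0)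
        ultimately have "\<bar>h x - g m x\<bar> \<le> 0 + \<delta> m"
          by (rule LIMSEQ_le) (use diff[OF x] in blast)
        then show ?thesis by simp
      qed
      have "continuous_map T euclideanreal h"
      proof (rule continuous_map_real_uniform_limit)
        fix e :: real assume "0 < e"
        then obtain n where "\<delta> n < e" unfolding \<delta>_def using reals_Archimedean by blast
        then have "\<forall>x\<in>topspace T. \<bar>h x - g n x\<bar> \<le> e" using close[of _ n] by fastforce
        with g(1) show "\<exists>q. continuous_map T euclideanreal q \<and> (\<forall>x\<in>topspace T. \<bar>h x - q x\<bar> \<le> e)" by blast
      qed
      moreover have "h (tau G) = p G" if G: "G \<in> hyps" for G
      proof (rule LIMSEQ_unique[OF h[OF tau_in_T[OF G]]])
        show "(\<lambda>n. g n (tau G)) \<longlonglongrightarrow> p G"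
        proof (rule LIM_zero_cancel, rule Lim_null_comparison[OF _ \<delta>0])
          show "\<forall>\<^sub>F n in sequentially. norm (g n (tau G) - p G) \<le> \<delta> n"
            using bspec[OF g(2) G] by (auto simp: abs_minus_commute)
        qed
      qed
      ultimately show ?thesis unfolding Q_def by blast
    qed
  qed
  then show ?thesis by (simp add: Q_def)
qed

lemma density_ext:
  assumes F: "F \<in> unlabelled r UNIV"
  shows "continuous_map T euclideanreal (density_ext r \<F> F)"
    and "\<And>G. G \<in> hyps \<Longrightarrow> density_ext r \<F> F (tau G) = hom_density r F G"
  using someI_ex[OF extension_exists[OF F]] unfolding density_ext_def[symmetric] by blast+

section \<open>Laws on the space of limits\<close>

lemma tau_measurable: "(\<lambda>\<omega>. tau (X n \<omega>)) \<in> measurable (M n) (borel_of T)"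
  by (rule measurable_compose[OF X_measurable continuous_map_measurable[OF continuous_map_tau]])

lemma prob_law: "prob_space (law n)"
  unfolding law_def by (rule prob_space.prob_space_distr[OF prob_M tau_measurable])

lemma test_fun_tau:
  assumes f: "continuous_map T euclideanreal f" shows "test_fun (\<lambda>G. f (tau G))"
proof -
  from continuous_T_bounded[OF f] obtain B where B: "\<forall>x\<in>topspace T. \<bar>f x\<bar> \<le> B"
    unfolding bounded_iff by auto
  show ?thesis
  proof (rule test_funI)
    show "continuous_map (unlabelled_topology r) euclideanreal (\<lambda>G. f (tau G))"
      using continuous_map_compose[OF continuous_map_tau f] by (simp add: comp_def)
    show "\<bar>f (tau G)\<bar> \<le> B" if "G \<in> hyps" for G using B tau_in_T[OF that] by blast
  qed
qed

lemma integral_law: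
  assumes f: "continuous_map T euclideanreal f"
  shows "(\<integral>x. f x \<partial>law n) = expect n (\<lambda>G. f (tau G))"
  unfolding law_def expect_def
  by (rule integral_distr[OF tau_measurable continuous_map_borel_measurable[OF f]])

lemma weak_limit_law_iff:
  "weak_limit T law N \<longleftrightarrow> prob_space N \<and> sets N = sets (borel_of T) \<and>
    (\<forall>f. continuous_map T euclideanreal f \<longrightarrow> (\<lambda>n. expect n (\<lambda>G. f (tau G))) \<longlonglongrightarrow> (\<integral>x. f x \<partial>N))"
proof -
  have eq: "(continuous_map T euclideanreal f \<and> bounded (f ` topspace T) \<longrightarrow>
        (\<lambda>n. \<integral>x. f x \<partial>law n) \<longlonglongrightarrow> (\<integral>x. f x \<partial>N)) \<longleftrightarrow>
      (continuous_map T euclideanreal f \<longrightarrow> (\<lambda>n. expect n (\<lambda>G. f (tau G))) \<longlonglongrightarrow> (\<integral>x. f x \<partial>N))" for f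
    by (cases "continuous_map T euclideanreal f") (simp_all add: continuous_T_bounded integral_law)
  show ?thesis unfolding weak_limit_def eq ..
qed

text \<open>The continuous functions on the space of limits whose composition with
  \<open>tau_plus\<close> is in the near span form an algebra containing every coordinate, and their
  expectations converge.\<close>

theorem limit_exists:
  assumes moments_converge shows "\<exists>N. weak_limit T law N"
proof (rule separated_compact.method_of_moments[OF separated_T])
  let ?R = "{p. continuous_map T euclideanreal p \<and> near_span (\<lambda>G. p (tau G))}"
  show "(\<lambda>_. c) \<in> ?R" for c using near_span_const by simp
  show "continuous_map T euclideanreal p" if "p \<in> ?R" for p using that by simp
  show "(\<lambda>x. p x + q x) \<in> ?R" if "p \<in> ?R" "q \<in> ?R" for p q
    using that by (simp add: continuous_map_add near_span_add)
  show "(\<lambda>x. p x * q x) \<in> ?R" if "p \<in> ?R" "q \<in> ?R" for p q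
    using that by (simp add: continuous_map_real_mult near_span_mult)
  show "from_nat_into coordinates j \<in> ?R" for j
  proof -
    have "c \<in> ?R" if "c \<in> coordinates" for c
    proof (cases "c = snd")
      case True
      then show ?thesis using continuous_map_size_coordinate near_span_inv_size by (simp add: snd_tau)
    next
      case False
      with that obtain F where F: "F \<in> unlabelled r \<F>" and c: "c = (\<lambda>\<Gamma>. fst \<Gamma> F)"
        by (auto simp: coordinates_def)
      have "near_span (\<lambda>G. fst (tau G) F)"
        unfolding tau_coordinate[OF F] using F F_sub by (intro near_span_hom) auto
      then show ?thesis using continuous_map_coordinate[OF F] by (simp add: c)
    qed
    moreover have "from_nat_into coordinates j \<in> coordinates" using range_coordinates by blast
    ultimately show ?thesis by blast
  qed
  show "prob_space (law n)" for n by (rule prob_law)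
  show "sets (law n) = sets (borel_of T)" for n by (simp add: law_def)
  show "convergent (\<lambda>n. \<integral>x. p x \<partial>law n)" if "p \<in> ?R" for p
    using that near_span_conv[OF _ assms, of "\<lambda>G. p (tau G)"] by (simp add: integral_law conv_def)
qed

lemma expect_via:
  assumes h: "test_fun h" and \<phi>: "\<phi> \<in> borel_measurable borel"
  shows "(\<integral>y. \<phi> y \<partial>distr (M n) borel (\<lambda>\<omega>. h (X n \<omega>))) = expect n (\<lambda>G. \<phi> (h G))"
  unfolding expect_def by (rule integral_distr[OF test_measurable[OF h] \<phi>])

lemma real_distribution_test:
  assumes h: "test_fun h"
  shows "real_distribution (distr (M n) borel (\<lambda>\<omega>. h (X n \<omega>)))"
  unfolding real_distribution_def real_distribution_axioms_def
  using prob_space.prob_space_distr[OF prob_M test_measurable[OF h]] by simp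

lemma limit_measurable:
  assumes "weak_limit T law N" and D: "continuous_map T euclideanreal D"
  shows "D \<in> borel_measurable N"
proof -
  have "sets N = sets (borel_of T)" using assms(1) by (simp add: weak_limit_def)
  from measurable_cong_sets[OF this refl, of "borel :: real measure"] show ?thesis
    using continuous_map_borel_measurable[OF D] by simp
qed

lemma real_distribution_limit:
  assumes N: "weak_limit T law N" and D: "continuous_map T euclideanreal D"
  shows "real_distribution (distr N borel D)"
proof -
  have "prob_space N" using N by (simp add: weak_limit_def)
  from prob_space.prob_space_distr[OF this limit_measurable[OF N D]] show ?thesis
    unfolding real_distribution_def real_distribution_axioms_def by simp
qed

text \<open>The slack \<open>O(1 / |V|)\<close> makes room for the injective densities.\<close>

lemma weak_conv_density:
  assumes N: "weak_limit T law N" and D: "continuous_map T euclideanreal D" and h: "test_fun h"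
    and close: "\<And>G. G \<in> hyps \<Longrightarrow> \<bar>h G - D (tau G)\<bar> \<le> C * inv_size G"
  shows "weak_conv_m (\<lambda>n. distr (M n) borel (\<lambda>\<omega>. h (X n \<omega>))) (distr N borel D)"
proof (rule integral_bdd_continuous_conv_imp_weak_conv)
  show "real_distribution (distr (M n) borel (\<lambda>\<omega>. h (X n \<omega>)))" for n
    by (rule real_distribution_test[OF h])
  show "real_distribution (distr N borel D)" by (rule real_distribution_limit[OF N D])
  fix \<phi> :: "real \<Rightarrow> real"
  assume cont: "\<And>x. isCont \<phi> x" and le1: "\<And>x. \<bar>\<phi> x\<bar> \<le> 1"
  have \<phi>c: "continuous_on UNIV \<phi>" using cont by (simp add: continuous_on_eq_continuous_at)
  then have \<phi>m: "\<phi> \<in> borel_measurable borel" by (rule borel_measurable_continuous_onI)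
  have \<phi>mapT: "continuous_map T euclideanreal (\<lambda>x. \<phi> (D x))"
    using continuous_map_compose[OF D, of euclideanreal \<phi>] \<phi>c by (simp add: comp_def)
  have t1: "test_fun (\<lambda>G. \<phi> (h G))"
    using continuous_map_compose[OF test_funD[OF h], of euclideanreal \<phi>] \<phi>c le1
    by (intro test_funI[of _ 1]) (simp_all add: comp_def)
  have t2: "test_fun (\<lambda>G. \<phi> (D (tau G)))" by (rule test_fun_tau[OF \<phi>mapT])
  obtain B1 where B1: "\<forall>G\<in>hyps. \<bar>h G\<bar> \<le> B1" using test_fun_bound[OF h] by blast
  obtain B2 where B2: "\<forall>G\<in>hyps. \<bar>D (tau G)\<bar> \<le> B2" using test_fun_bound[OF test_fun_tau[OF D]] by blast
  \<comment> \<open>Both \<open>h\<close> and \<open>D\<close> along \<open>tau\<close> stay in the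
    compact interval \<open>{-B..B}\<close>, on which \<open>\<phi>\<close> is uniformly
    continuous.\<close>
  define B where "B = max B1 B2"
  have uc: "uniformly_continuous_on {-B..B} \<phi>"
    by (rule compact_uniformly_continuous) (auto intro: continuous_on_subset[OF \<phi>c])
  have "(\<lambda>n. expect n (\<lambda>G. \<phi> (h G) - \<phi> (D (tau G)))) \<longlonglongrightarrow> 0"
  proof (rule expect_negligible[OF test_fun_diff[OF t1 t2]])
    fix e :: real assume e: "0 < e"
    obtain d where d: "0 < d" "\<And>x y. x \<in> {-B..B} \<Longrightarrow> y \<in> {-B..B} \<Longrightarrow> dist x y < d \<Longrightarrow> dist (\<phi> x) (\<phi> y) < e"
      using uc e unfolding uniformly_continuous_on_def by metis
    \<comment> \<open>Arguments closer than \<open>d\<close> change \<open>\<phi>\<close> by less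
      than \<open>e\<close>. Otherwise \<open>d \<le> C * inv_size G\<close>, and the largest
      possible change 2 is at most \<open>2 / d * C * inv_size G\<close>.\<close>
    have "\<bar>\<phi> (h G) - \<phi> (D (tau G))\<bar> \<le> e + (2 / d * C) * inv_size G" if G: "G \<in> hyps" for G
    proof (cases "\<bar>h G - D (tau G)\<bar> < d")
      case True
      have "h G \<in> {-B..B}" "D (tau G) \<in> {-B..B}"
        using bspec[OF B1 G] bspec[OF B2 G] by (auto simp: B_def abs_le_iff minus_le_iff)
      then have "\<bar>\<phi> (h G) - \<phi> (D (tau G))\<bar> < e" using d(2) True by (simp add: dist_real_def)
      moreover have "0 \<le> (2 / d * C) * inv_size G"
      proof -
        have "0 \<le> C * inv_size G" using close[OF G] by (rule order_trans[OF abs_ge_zero])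
        moreover have "0 \<le> 2 / d" using d(1) by simp
        ultimately have "0 \<le> 2 / d * (C * inv_size G)" by (rule mult_nonneg_nonneg[rotated])
        then show ?thesis by (simp add: mult.assoc)
      qed
      ultimately show ?thesis by linarith
    next
      case False
      then have "d \<le> C * inv_size G" using close[OF G] by linarith
      then have "2 \<le> 2 / d * (C * inv_size G)" using d(1) by (simp add: field_simps)
      then have "2 \<le> (2 / d * C) * inv_size G" by (simp add: mult.assoc)
      moreover have "\<bar>\<phi> (h G) - \<phi> (D (tau G))\<bar> \<le> 2" using le1[of "h G"] le1[of "D (tau G)"] by linarith
      ultimately show ?thesis using e by linarith
    qed
    then show "\<exists>C. \<forall>G\<in>hyps. \<bar>\<phi> (h G) - \<phi> (D (tau G))\<bar> \<le> e + C * inv_size G" by blast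
  qed
  then have "(\<lambda>n. expect n (\<lambda>G. \<phi> (h G)) - expect n (\<lambda>G. \<phi> (D (tau G)))) \<longlonglongrightarrow> 0"
    by (simp add: expect_diff[OF t1 t2])
  moreover have "(\<lambda>n. expect n (\<lambda>G. \<phi> (D (tau G)))) \<longlonglongrightarrow> (\<integral>x. \<phi> (D x) \<partial>N)"
    using N \<phi>mapT unfolding weak_limit_law_iff by blast
  ultimately have "(\<lambda>n. expect n (\<lambda>G. \<phi> (h G))) \<longlonglongrightarrow> (\<integral>x. \<phi> (D x) \<partial>N)"
    using tendsto_add by force
  moreover have "(\<integral>x. \<phi> (D x) \<partial>N) = (\<integral>y. \<phi> y \<partial>distr N borel D)"
  by (rule integral_distr[symmetric, OF limit_measurable[OF N D] \<phi>m])
  ultimately show "(\<lambda>n. \<integral>y. \<phi> y \<partial>distr (M n) borel (\<lambda>\<omega>. h (X n \<omega>))) \<longlonglongrightarrow> (\<integral>y. \<phi> y \<partial>distr N borel D)"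
    by (simp add: expect_via[OF h \<phi>m])
qed

text \<open>The last coordinate is nonnegative with expectation 0 in the limit, so it vanishes
  almost surely, while on the image it is \<open>1 / |V|\<close> and hence positive.\<close>

lemma limit_not_in_image:
  assumes N: "weak_limit T law N"
  shows "AE \<Gamma> in N. \<Gamma> \<notin> tau_image r \<F>"
proof -
  interpret N: prob_space N using N by (simp add: weak_limit_def)
  have sN: "sets N = sets (borel_of T)" using N by (simp add: weak_limit_def)
  have sp: "space N = topspace T" using sets_eq_imp_space_eq[OF sN] by simp
  have m: "snd \<in> borel_measurable N"
    using continuous_map_borel_measurable[OF continuous_map_size_coordinate]
    by (simp add: measurable_cong_sets[OF sN refl])
  have "(\<lambda>n. expect n (\<lambda>G. snd (tau G))) \<longlonglongrightarrow> (\<integral>x. snd x \<partial>N)"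
    using N continuous_map_size_coordinate unfolding weak_limit_law_iff by blast
  then have "(\<integral>x. snd x \<partial>N) = 0"
    using LIMSEQ_unique[OF expect_inv_size] by (simp add: snd_tau)
  moreover have bound: "0 \<le> snd x \<and> snd x \<le> 1" if "x \<in> space N" for x
    using subsetD[OF T_subset, of x] that by (simp add: sp mem_Times_iff)
  moreover have "integrable N snd"
    by (rule N.integrable_const_bound[of _ 1]) (use bound m in \<open>auto intro!: AE_I2\<close>)
  ultimately have "AE x in N. snd x = 0"
    using integral_nonneg_eq_0_iff_AE[of N snd] by (auto intro!: AE_I2)
  then show ?thesis
  proof eventually_elim
    fix x :: "(('k \<Rightarrow>\<^sub>C real) hypergraph set \<Rightarrow> real) \<times> real" assume x: "snd x = 0"
    show "x \<notin> tau_image r \<F>"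
    proof
      assume "x \<in> tau_image r \<F>"
      then obtain G where "G \<in> hyps" "x = tau G" by (auto simp: tau_image_def)
      then show False using x num_vertices_pos[of G r] by (simp add: snd_tau inv_size_def)
    qed
  qed
qed

section \<open>Both kinds of density in the limit\<close>

definition density_like :: "(('k \<Rightarrow>\<^sub>C real) hypergraph set \<Rightarrow> 'k hypergraph set \<Rightarrow> real) \<Rightarrow> bool" where
  "density_like t \<longleftrightarrow> t \<in> {hom_density r, inj_density r}"

lemma density_like_test: "density_like t \<Longrightarrow> F \<in> unlabelled r UNIV \<Longrightarrow> test_fun (t F)"
  unfolding density_like_def using test_fun_hom test_fun_inj by auto

lemma density_like_conv:
  "density_like t \<Longrightarrow> F \<in> unlabelled r UNIV \<Longrightarrow> conv (t F) \<longleftrightarrow> conv (hom_density r F)"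
  unfolding density_like_def using conv_inj_iff_hom by auto

lemma density_like_close:
  assumes "density_like t" "F \<in> unlabelled r UNIV"
  shows "\<exists>C. \<forall>G\<in>hyps. \<bar>t F G - hom_density r F G\<bar> \<le> C * inv_size G"
proof (cases "t = hom_density r")
  case True
  then show ?thesis by (intro exI[of _ 0]) simp
next
  case False
  then have t: "t = inj_density r" using assms(1) by (simp add: density_like_def)
  obtain C where "\<And>G. G \<in> hyps \<Longrightarrow> \<bar>inj_density r F G - hom_density r F G\<bar> \<le> C / real (num_vertices G)"
    using inj_hom_density_diff[OF assms(2)] by metis
  then show ?thesis by (intro exI[of _ C]) (simp add: t inv_size_def)
qed

lemma weak_conv_coordinate:
  assumes N: "weak_limit T law N" and t: "density_like t" and F: "F \<in> unlabelled r \<F>"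
  shows "weak_conv_m (\<lambda>n. distr (M n) borel (\<lambda>\<omega>. t F (X n \<omega>))) (distr N borel (\<lambda>\<Gamma>. fst \<Gamma> F))"
proof -
  have F': "F \<in> unlabelled r UNIV" using F F_sub by auto
  obtain C where "\<forall>G\<in>hyps. \<bar>t F G - hom_density r F G\<bar> \<le> C * inv_size G"
    using density_like_close[OF t F'] by blast
  then show ?thesis
    by (intro weak_conv_density[where C = C, OF N continuous_map_coordinate[OF F] density_like_test[OF t F']])
       (simp add: tau_coordinate[OF F])
qed

lemma weak_conv_extension:
  assumes N: "weak_limit T law N" and t: "density_like t" and F: "F \<in> unlabelled r UNIV"
  shows "weak_conv_m (\<lambda>n. distr (M n) borel (\<lambda>\<omega>. t F (X n \<omega>))) (distr N borel (density_ext r \<F> F))"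
proof -
  obtain C where "\<forall>G\<in>hyps. \<bar>t F G - hom_density r F G\<bar> \<le> C * inv_size G"
    using density_like_close[OF t F] by blast
  then show ?thesis
    by (intro weak_conv_density[where C = C, OF N density_ext(1)[OF F] density_like_test[OF t F]])
       (simp add: density_ext(2)[OF F])
qed

text \<open>Weak convergence tests bounded functions only; as \<open>h\<close> takes values in
  \<open>{-B..B}\<close>, the identity may be replaced by its truncation to this interval.\<close>

lemma converges_in_distribution_conv:
  assumes h: "test_fun h" and c: "real_converges_in_distribution M (\<lambda>n \<omega>. h (X n \<omega>))"
  shows "conv h"
proof -
  obtain B where B: "0 \<le> B" "\<forall>G\<in>hyps. \<bar>h G\<bar> \<le> B" using test_fun_bound[OF h] by blast
  obtain \<mu> where \<mu>: "real_distribution \<mu>"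
    "weak_conv_m (\<lambda>n. distr (M n) borel (\<lambda>\<omega>. h (X n \<omega>))) \<mu>"
    using c unfolding real_converges_in_distribution_def by blast
  define \<phi> where "\<phi> y = max (-B) (min B y)" for y :: real
  have \<phi>c: "continuous_on UNIV \<phi>" unfolding \<phi>_def by (intro continuous_intros)
  have "(\<lambda>n. \<integral>y. \<phi> y \<partial>distr (M n) borel (\<lambda>\<omega>. h (X n \<omega>))) \<longlonglongrightarrow> (\<integral>y. \<phi> y \<partial>\<mu>)"
  proof (rule weak_conv_imp_integral_bdd_continuous_conv[OF real_distribution_test[OF h] \<mu>])
    show "isCont \<phi> x" for x using \<phi>c by (simp add: continuous_on_eq_continuous_at)
    show "norm (\<phi> x) \<le> B" for x using B(1) by (simp add: \<phi>_def abs_le_iff)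
  qed
  moreover have "(\<integral>y. \<phi> y \<partial>distr (M n) borel (\<lambda>\<omega>. h (X n \<omega>))) = expect n h" for n
    unfolding expect_via[OF h borel_measurable_continuous_onI[OF \<phi>c]]
    by (rule expect_cong) (use B(2) in \<open>auto simp: \<phi>_def abs_le_iff minus_le_iff\<close>)
  ultimately have "(\<lambda>n. expect n h) \<longlonglongrightarrow> (\<integral>y. \<phi> y \<partial>\<mu>)" by simp
  then show ?thesis using h unfolding conv_def convergent_def by blast
qed

lemma densities_imp_moments:
  assumes t: "density_like t"
    and "\<And>F. F \<in> unlabelled r \<F> \<Longrightarrow> real_converges_in_distribution M (\<lambda>n \<omega>. t F (X n \<omega>))"
  shows moments_converge
proof (rule moments_convergeI)
  fix F assume F: "F \<in> unlabelled r \<F>"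
  then have F': "F \<in> unlabelled r UNIV" using F_sub by auto
  show "conv (hom_density r F)"
    using converges_in_distribution_conv[OF density_like_test[OF t F'] assms(2)[OF F]]
      density_like_conv[OF t F'] by simp
qed

lemma limit_imp_densities:
  assumes N: "weak_limit T law N" and t: "density_like t" and F: "F \<in> unlabelled r UNIV"
  shows "real_converges_in_distribution M (\<lambda>n \<omega>. t F (X n \<omega>))"
  unfolding real_converges_in_distribution_def
  using weak_conv_extension[OF N t F] real_distribution_limit[OF N density_ext(1)[OF F]] by blast

end

subsection \<open>Uniform sampling from a hypergraph\<close>

text \<open>
  Since \<open>rep\<close> is an arbitrary choice, measurability of \<open>kernel\<close> below rests on lower semicontinuity
  of the probabilities of open sets, which can be checked on labelled hypergraphs.
\<close>

locale sampling_scheme =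
  fixes r :: nat and S :: "nat set \<Rightarrow> 's set"
    and h :: "'k::topological_space hypergraph \<Rightarrow> 's \<Rightarrow> 'b" and T2 :: "'b topology"
  assumes S: "\<And>V. finite V \<Longrightarrow> V \<noteq> {} \<Longrightarrow> finite (S V) \<and> S V \<noteq> {}"
    and h: "\<And>V s. finite V \<Longrightarrow> V \<noteq> {} \<Longrightarrow> s \<in> S V \<Longrightarrow> continuous_map (arrays r V) T2 (\<lambda>a. h (V, a) s)"
    and invariant: "\<And>G H. (G, H) \<in> hypergraph_iso r \<Longrightarrow>
      \<exists>\<beta>. bij_betw \<beta> (S (fst G)) (S (fst H)) \<and> (\<forall>s\<in>S (fst G). h H (\<beta> s) = h G s)"
begin

definition average :: "('b \<Rightarrow> real) \<Rightarrow> 'k hypergraph set \<Rightarrow> real" where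
  "average f C = (\<Sum>s\<in>S (fst (rep C)). f (h (rep C) s)) / real (card (S (fst (rep C))))"

definition kernel :: "'k hypergraph set \<Rightarrow> 'b measure" where
  "kernel C = distr (uniform_count_measure (S (fst (rep C)))) (borel_of T2) (h (rep C))"

lemma h_in:
  assumes "G \<in> hypergraphs r UNIV" "s \<in> S (fst G)" shows "h G s \<in> topspace T2"
proof -
  have "snd G \<in> topspace (arrays r (fst G))" using hypergraphsD(3)[OF assms(1)] by simp
  moreover have "(\<lambda>a. h (fst G, a) s) \<in> topspace (arrays r (fst G)) \<rightarrow> topspace T2"
    using h[OF hypergraphsD(1,2)[OF assms(1)] assms(2)] unfolding continuous_map_def by (rule conjunct1)
  ultimately have "h (fst G, snd G) s \<in> topspace T2" by (rule Pi_mem[rotated])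
  then show ?thesis by simp
qed

lemma S_rep: "C \<in> unlabelled r UNIV \<Longrightarrow> finite (S (fst (rep C))) \<and> S (fst (rep C)) \<noteq> {}"
  using hypergraphsD[OF rep_unlabelled(1)] by (intro S) auto

lemma sum_iso:
  fixes f :: "'b \<Rightarrow> real"
  assumes "(G, H) \<in> hypergraph_iso r"
  shows "(\<Sum>s\<in>S (fst G). f (h G s)) / real (card (S (fst G))) =
    (\<Sum>s\<in>S (fst H). f (h H s)) / real (card (S (fst H)))"
proof -
  obtain \<beta> where \<beta>: "bij_betw \<beta> (S (fst G)) (S (fst H))" "\<forall>s\<in>S (fst G). h H (\<beta> s) = h G s"
    using invariant[OF assms] by blast
  show ?thesis
    unfolding sum.reindex_bij_betw[OF \<beta>(1), symmetric] bij_betw_same_card[OF \<beta>(1)] using \<beta>(2) by simp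
qed

lemma average_iso_class:
  assumes "G \<in> hypergraphs r UNIV"
  shows "average f (iso_class r G) = (\<Sum>s\<in>S (fst G). f (h G s)) / real (card (S (fst G)))"
  unfolding average_def by (rule sum_iso[OF rep_iso_class[OF assms], symmetric])

lemma continuous_map_average:
  assumes f: "continuous_map T2 euclideanreal f"
  shows "continuous_map (unlabelled_topology r) euclideanreal (average f)"
proof (rule continuous_map_unlabelledI)
  show "continuous_map (labelled_topology r) euclideanreal
     (\<lambda>G. (\<Sum>s\<in>S (fst G). f (h G s)) / real (card (S (fst G))))"
  proof (rule continuous_map_labelledI, unfold fst_conv, rule continuous_map_real_divide_const,
      rule continuous_map_sum)
    fix V s assume V: "finite (V :: nat set)" "V \<noteq> {}"
    then show "finite (S V)" using S by blast
    assume s: "s \<in> S V"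
    show "continuous_map (arrays r V) euclideanreal (\<lambda>a. f (h (V, a) s))"
      using continuous_map_compose[OF h[OF V s] f] by (simp add: comp_def)
  qed
qed (rule average_iso_class)

lemma abs_average_bound:
  assumes "C \<in> unlabelled r UNIV" "\<And>x. x \<in> topspace T2 \<Longrightarrow> \<bar>f x\<bar> \<le> B" "0 \<le> B"
  shows "\<bar>average f C\<bar> \<le> B"
  unfolding average_def
  by (rule abs_average_le) (use assms(2)[OF h_in[OF rep_unlabelled(1)[OF assms(1)]]] assms(3) in auto)

lemma sample_point_measurable:
  assumes "C \<in> unlabelled r UNIV"
  shows "h (rep C) \<in> measurable (uniform_count_measure (S (fst (rep C)))) (borel_of T2)"
  unfolding measurable_cong_sets[OF sets_uniform_count_measure_count_space refl] measurable_count_space_eq1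
  using h_in[OF rep_unlabelled(1)[OF assms]] by simp

lemma prob_kernel: "C \<in> unlabelled r UNIV \<Longrightarrow> prob_space (kernel C)"
  unfolding kernel_def using S_rep[of C]
  by (intro prob_space.prob_space_distr prob_space_uniform_count_measure sample_point_measurable) auto

lemma integral_kernel:
  assumes C: "C \<in> unlabelled r UNIV" and f: "f \<in> borel_measurable (borel_of T2)"
  shows "(\<integral>x. f x \<partial>kernel C) = average f C"
  unfolding kernel_def integral_distr[OF sample_point_measurable[OF C] f] average_def
  by (rule integral_uniform_count_measure) (use S_rep[OF C] in simp)

lemma openin_average_indicator:
  assumes U: "openin T2 U"
  shows "openin (unlabelled_topology r) {C \<in> unlabelled r UNIV. a < average (indicator U) C}"
  unfolding openin_unlabelled_topology
proof (intro conjI)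
  let ?N = "\<lambda>G. (\<Sum>s\<in>S (fst G). indicator U (h G s)) / real (card (S (fst G)))"
  have eq: "{G \<in> hypergraphs r UNIV. iso_class r G \<in> {C \<in> unlabelled r UNIV. a < average (indicator U) C}} =
    {G \<in> hypergraphs r UNIV. a < ?N G}"
  proof (rule Collect_cong, rule conj_cong[OF refl])
    fix G :: "'k hypergraph" assume G: "G \<in> hypergraphs r UNIV"
    show "iso_class r G \<in> {C \<in> unlabelled r UNIV. a < average (indicator U) C} \<longleftrightarrow> a < ?N G"
      using iso_class_in[OF G] by (simp add: average_iso_class[OF G])
  qed
  show "openin (labelled_topology r)
    {G \<in> hypergraphs r UNIV. iso_class r G \<in> {C \<in> unlabelled r UNIV. a < average (indicator U) C}}"
    unfolding eq labelled_topology_def openin_sum_topology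
  proof (intro conjI ballI)
    show "{G \<in> hypergraphs r UNIV. a < ?N G} \<subseteq>
        Sigma {V. finite V \<and> V \<noteq> {}} (topspace \<circ> (\<lambda>V. arrays r V))"
      by (auto simp: hypergraphs_def)
    fix V :: "nat set" assume "V \<in> {V. finite V \<and> V \<noteq> {}}"
    then have V: "finite V" "V \<noteq> {}" by auto
    have fin: "finite (S V)" using S[OF V] by blast
    let ?O = "\<lambda>s. {x \<in> topspace (arrays r V). h (V, x) s \<in> U}"
    let ?J = "{J. J \<subseteq> S V \<and> a < real (card J) / real (card (S V))}"
    have count: "?N (V, x) = real (card {s \<in> S V. h (V, x) s \<in> U}) / real (card (S V))" for x
    proof -
      have "(\<Sum>s\<in>S V. indicator U (h (V, x) s)) = (\<Sum>s\<in>S V. if h (V, x) s \<in> U then 1 else 0 :: real)"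
        by (rule sum.cong) (auto simp: indicator_def)
      then show ?thesis using fin by (simp add: sum.If_cases Int_def)
    qed
    \<comment> \<open>The count exceeds the threshold iff some large enough set \<open>J\<close> of
      samples lands in \<open>U\<close>. This is a union over \<open>J\<close> of finite
      intersections of open conditions.\<close>
    have "{x. (V, x) \<in> {G \<in> hypergraphs r UNIV. a < ?N G}} =
        (\<Union>J\<in>?J. topspace (arrays r V) \<inter> (\<Inter>s\<in>J. ?O s))" (is "?L = ?R")
    proof (intro equalityI subsetI)
      fix x assume x: "x \<in> ?L"
      then have xt: "x \<in> topspace (arrays r V)" by simp
      have "a < ?N (V, x)" using x by blast
      then have "a < real (card {s \<in> S V. h (V, x) s \<in> U}) / real (card (S V))"
        unfolding count .
      then have J: "{s \<in> S V. h (V, x) s \<in> U} \<in> ?J" by simp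
      show "x \<in> ?R" by (rule UN_I[OF J]) (use xt in simp)
    next
      fix x assume "x \<in> ?R"
      then obtain J where J: "J \<subseteq> S V" "a < real (card J) / real (card (S V))"
        "x \<in> topspace (arrays r V)" "\<forall>s\<in>J. x \<in> ?O s" by blast
      have "J \<subseteq> {s \<in> S V. h (V, x) s \<in> U}" using J(1,4) by auto
      then have "card J \<le> card {s \<in> S V. h (V, x) s \<in> U}" using fin by (intro card_mono) auto
      then have "real (card J) / real (card (S V)) \<le> ?N (V, x)"
        unfolding count by (intro divide_right_mono) auto
      then have "a < ?N (V, x)" using J(2) by linarith
      then show "x \<in> ?L" using J(3) V by simp
    qed
    moreover have "openin (arrays r V) (topspace (arrays r V) \<inter> (\<Inter>s\<in>J. ?O s))" if "J \<in> ?J" for J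
    proof (cases "J = {}")
      case False
      have "finite J" using that fin finite_subset by blast
      moreover have "openin (arrays r V) (?O s)" if "s \<in> J" for s
        using \<open>J \<in> ?J\<close> that by (intro openin_continuous_map_preimage[OF h[OF V] U]) auto
      ultimately show ?thesis using False by (intro openin_Int openin_topspace openin_INT2) auto
    next
      case True
      then show ?thesis using openin_topspace[of "arrays r V"] by simp
    qed
    ultimately show "openin (arrays r V) {x. (V, x) \<in> {G \<in> hypergraphs r UNIV. a < ?N G}}"
      by (simp only:) (intro openin_Union; blast)
  qed
qed auto

lemma emeasure_kernel:
  assumes C: "C \<in> unlabelled r UNIV" and A: "A \<in> sets (borel_of T2)"
  shows "emeasure (kernel C) A = ennreal (average (indicator A) C)"
proof -
  interpret prob_space "kernel C" by (rule prob_kernel[OF C])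
  have "A \<in> sets (kernel C)" using A by (simp add: kernel_def)
  then have "emeasure (kernel C) A = ennreal (\<integral>x. indicator A x \<partial>kernel C)"
    by (simp add: emeasure_eq_measure)
  also have "(\<integral>x. indicator A x \<partial>kernel C) = average (indicator A) C"
    by (rule integral_kernel[OF C]) (use A in simp)
  finally show ?thesis .
qed

text \<open>Open sets are stable under intersection and generate the Borel sets, so measurability is
  checked on their probabilities alone.\<close>

lemma kernel_measurable: "kernel \<in> measurable (borel_of (unlabelled_topology r)) (subprob_algebra (borel_of T2))"
proof (rule measurable_subprob_algebra_generated[OF sets_borel_of])
  have sp: "C \<in> unlabelled r UNIV" if "C \<in> space (borel_of (unlabelled_topology r))"
    for C :: "'k hypergraph set"
    using that by (simp add: topspace_unlabelled_topology)
  show "Int_stable {U. openin T2 U}" by (auto intro!: Int_stableI)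
  show "{U. openin T2 U} \<subseteq> Pow (topspace T2)" by (auto dest: openin_subset)
  show "subprob_space (kernel C)" if "C \<in> space (borel_of (unlabelled_topology r))" for C
    using prob_kernel[OF sp[OF that]] by (rule prob_space_imp_subprob_space)
  show "sets (kernel C) = sets (borel_of T2)" for C by (simp add: kernel_def)
  have *: "(\<lambda>C. emeasure (kernel C) U) \<in> borel_measurable (borel_of (unlabelled_topology r))"
    if U: "openin T2 U" for U
  proof -
    have "average (indicator U) \<in> borel_measurable (borel_of (unlabelled_topology r))"
      unfolding borel_measurable_iff_greater
      using borel_of_open[OF openin_average_indicator[OF U]] by (simp add: topspace_unlabelled_topology)
    then have "(\<lambda>C. ennreal (average (indicator U) C)) \<in> borel_measurable (borel_of (unlabelled_topology r))"
      by measurable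
    then show ?thesis
      by (subst measurable_cong[OF emeasure_kernel[OF sp borel_of_open[OF U]]])
  qed
  show "(\<lambda>C. emeasure (kernel C) U) \<in> borel_measurable (borel_of (unlabelled_topology r))"
    if "U \<in> {U. openin T2 U}" for U using * that by simp
  show "(\<lambda>C. emeasure (kernel C) (topspace T2)) \<in> borel_measurable (borel_of (unlabelled_topology r))"
    by (rule *) simp
qed

end

section \<open>Samples as vertex subsets and as labellings\<close>

lemma continuous_map_restrict_arrays:
  assumes "W \<subseteq> V"
  shows "continuous_map (arrays r V) (arrays r W) (\<lambda>a. restrict a (tuples r W))"
  unfolding continuous_map_componentwise
proof (intro conjI ballI)
  fix i assume i: "i \<in> tuples r W"
  then have "i \<in> tuples r V" using assms by (auto simp: tuples_def)
  from continuous_map_product_projection[OF this, of "\<lambda>_. euclidean"] i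
  show "continuous_map (arrays r V) euclidean (\<lambda>a. restrict a (tuples r W) i)" by simp
qed auto

definition subsets_of_size :: "nat \<Rightarrow> nat set \<Rightarrow> nat set set" where
  "subsets_of_size k V = {W. W \<subseteq> V \<and> card W = min k (card V)}"

lemma subsets_of_sizeD:
  assumes "1 \<le> k" "finite V" "V \<noteq> {}" "W \<in> subsets_of_size k V"
  shows "W \<subseteq> V" "finite W" "W \<noteq> {}"
proof -
  show "W \<subseteq> V" using assms(4) by (simp add: subsets_of_size_def)
  then show "finite W" using assms(2) finite_subset by blast
  have "card W > 0" using assms by (simp add: subsets_of_size_def card_gt_0_iff)
  then show "W \<noteq> {}" by auto
qed

lemma induced_in: "G \<in> hypergraphs r UNIV \<Longrightarrow> W \<subseteq> fst G \<Longrightarrow> W \<noteq> {} \<Longrightarrow> induced r G W \<in> hypergraphs r UNIV"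
  unfolding induced_def hypergraphs_pair using finite_subset[OF _ hypergraphsD(1)] by simp

text \<open>Injectivity on \<open>W\<close> is enough, so this covers isomorphisms restricted to a
  subset as well as labellings of a sample.\<close>

lemma iso_class_induced:
  assumes GH: "G \<in> hypergraphs r UNIV" "H \<in> hypergraphs r UNIV" and \<sigma>: "inj_on \<sigma> W"
    and e: "\<And>i. i \<in> tuples r W \<Longrightarrow> snd H (map \<sigma> i) = snd G i"
    and W: "W \<subseteq> fst G" "W \<noteq> {}" "\<sigma> ` W \<subseteq> fst H"
  shows "iso_class r (induced r H (\<sigma> ` W)) = iso_class r (induced r G W)"
proof (rule iso_class_eq[symmetric])
  have 1: "induced r G W \<in> hypergraphs r UNIV" by (rule induced_in[OF GH(1) W(1,2)])
  have 2: "induced r H (\<sigma> ` W) \<in> hypergraphs r UNIV" by (rule induced_in[OF GH(2) W(3)]) (use W(2) in simp)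
  have "snd (induced r H (\<sigma> ` W)) (map \<sigma> i) = snd (induced r G W) i" if i: "i \<in> tuples r W" for i
    using map_tuples[OF subset_refl i, of \<sigma>] i e[OF i] by (simp add: induced_def)
  moreover have "bij_betw \<sigma> (fst (induced r G W)) (fst (induced r H (\<sigma> ` W)))"
    using \<sigma> by (simp add: induced_def bij_betw_def)
  ultimately show "(induced r G W, induced r H (\<sigma> ` W)) \<in> hypergraph_iso r"
    unfolding hypergraph_iso_def using 1 2
    by (simp add: induced_def[of r G W]) (rule exI[of _ \<sigma>], simp add: induced_def)
qed

text \<open>An isomorphism acts on vertex subsets by images and carries induced sub-hypergraphs to
  isomorphic ones, so the choice made by \<open>rep\<close> is invisible.\<close>

lemma sampling_subsets:
  assumes k: "1 \<le> k"
  shows "sampling_scheme r (subsets_of_size k) (\<lambda>G W. iso_class r (induced r G W))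
    (unlabelled_topology r :: 'k::topological_space hypergraph set topology)"
proof (rule sampling_scheme.intro)
  fix V :: "nat set" assume V: "finite V" "V \<noteq> {}"
  obtain W where "W \<subseteq> V" "card W = min k (card V)"
    using obtain_subset_with_card_n[of "min k (card V)" V] by auto
  then show "finite (subsets_of_size k V) \<and> subsets_of_size k V \<noteq> {}"
    using V by (auto simp: subsets_of_size_def)
  fix W assume W: "W \<in> subsets_of_size k V"
  note w = subsets_of_sizeD[OF k V W]
  from continuous_map_compose[OF continuous_map_compose[OF continuous_map_restrict_arrays[OF w(1)]
        continuous_map_labelled_inject[OF w(2,3)]] continuous_map_iso_class]
  show "continuous_map (arrays r V) (unlabelled_topology r :: 'k hypergraph set topology)
      (\<lambda>a. iso_class r (induced r (V, a) W))"
    by (simp add: comp_def induced_def)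
next
  fix G H :: "'k hypergraph" assume iso: "(G, H) \<in> hypergraph_iso r"
  then obtain \<sigma> where GH: "G \<in> hypergraphs r UNIV" "H \<in> hypergraphs r UNIV"
    and b: "bij_betw \<sigma> (fst G) (fst H)"
    and e: "\<And>i. i \<in> tuples r (fst G) \<Longrightarrow> snd H (map \<sigma> i) = snd G i"
    unfolding hypergraph_iso_def by auto
  have inj: "inj_on \<sigma> (fst G)" and surj: "\<sigma> ` fst G = fst H" using b by (auto simp: bij_betw_def)
  have c: "card (fst G) = card (fst H)" by (rule bij_betw_same_card[OF b])
  have cW: "card (\<sigma> ` W) = card W" if "W \<subseteq> fst G" for W
    using inj_on_subset[OF inj that] by (rule card_image)
  have bij: "bij_betw ((`) \<sigma>) (subsets_of_size k (fst G)) (subsets_of_size k (fst H))"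
  proof (rule bij_betw_imageI[OF inj_onI equalityI[OF subsetI subsetI]])
    fix W W' assume "W \<in> subsets_of_size k (fst G)" "W' \<in> subsets_of_size k (fst G)" "\<sigma> ` W = \<sigma> ` W'"
    then show "W = W'" using inj by (simp add: subsets_of_size_def inj_on_image_eq_iff)
  next
    fix Y assume "Y \<in> (`) \<sigma> ` subsets_of_size k (fst G)"
    then obtain W where W: "W \<subseteq> fst G" "card W = min k (card (fst G))" "Y = \<sigma> ` W"
      by (auto simp: subsets_of_size_def)
    then show "Y \<in> subsets_of_size k (fst H)"
      using cW[OF W(1)] c surj by (auto simp: subsets_of_size_def)
  next
    fix Y assume Y: "Y \<in> subsets_of_size k (fst H)"
    then have "Y \<subseteq> \<sigma> ` fst G" by (simp add: subsets_of_size_def surj)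
    then obtain W where W: "W \<subseteq> fst G" "Y = \<sigma> ` W" unfolding subset_image_iff by blast
    then have "W \<in> subsets_of_size k (fst G)"
      using Y cW[OF W(1)] c by (simp add: subsets_of_size_def)
    then show "Y \<in> (`) \<sigma> ` subsets_of_size k (fst G)" using W(2) by blast
  qed
  have eq: "iso_class r (induced r H (\<sigma> ` W)) = iso_class r (induced r G W)"
    if W: "W \<in> subsets_of_size k (fst G)" for W
  proof -
    note w = subsets_of_sizeD[OF k hypergraphsD(1,2)[OF GH(1)] W]
    show ?thesis
    proof (rule iso_class_induced[OF GH inj_on_subset[OF inj w(1)] _ w(1,3)])
      show "snd H (map \<sigma> i) = snd G i" if "i \<in> tuples r W" for i
        using that w(1) by (intro e) (auto simp: tuples_def)
      show "\<sigma> ` W \<subseteq> fst H" using w(1) surj by blast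
    qed
  qed
  show "\<exists>\<beta>. bij_betw \<beta> (subsets_of_size k (fst G)) (subsets_of_size k (fst H)) \<and>
      (\<forall>s\<in>subsets_of_size k (fst G). iso_class r (induced r H (\<beta> s)) = iso_class r (induced r G s))"
    by (rule exI[of _ "(`) \<sigma>"]) (use bij eq in simp)
qed

lemma sample_eq_kernel:
  "1 \<le> k \<Longrightarrow> sample r k = sampling_scheme.kernel (subsets_of_size k) (\<lambda>G W. iso_class r (induced r G W))
    (unlabelled_topology r)"
  by (rule ext) (simp add: sample_def sampling_scheme.kernel_def[OF sampling_subsets] subsets_of_size_def)

text \<open>If there is no injection, then all maps are allowed, so that the set is never empty.\<close>

definition labellings :: "nat \<Rightarrow> nat set \<Rightarrow> (nat \<Rightarrow> nat) set" where
  "labellings k V = {\<phi> \<in> {..<k} \<rightarrow>\<^sub>E V. inj_on \<phi> {..<k} \<or> card V < k}"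

text \<open>A sample read as an array on the fixed vertices \<open>{..<k}\<close>. All samples then
  lie in a single space of arrays, compact when the space of decorations is.\<close>

definition pullback :: "nat \<Rightarrow> nat \<Rightarrow> 'k hypergraph \<Rightarrow> (nat \<Rightarrow> nat) \<Rightarrow> nat list \<Rightarrow> 'k" where
  "pullback r k G \<phi> = (\<lambda>i\<in>tuples r {..<k}. snd G (map \<phi> i))"

lemma labellings_large: "k \<le> card V \<Longrightarrow> labellings k V = {\<phi> \<in> {..<k} \<rightarrow>\<^sub>E V. inj_on \<phi> {..<k}}"
  by (auto simp: labellings_def)

lemma finite_labellings: "finite V \<Longrightarrow> finite (labellings k V)"
  unfolding labellings_def by (rule finite_subset[OF _ finite_PiE[of "{..<k}" "\<lambda>_. V"]]) auto

lemma labellings_nonempty: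
  assumes "finite V" "V \<noteq> {}" shows "labellings k V \<noteq> {}"
proof (cases "card V < k")
  case True
  obtain v where "v \<in> V" using assms by blast
  then have "(\<lambda>i\<in>{..<k}. v) \<in> labellings k V" using True by (simp add: labellings_def)
  then show ?thesis by blast
next
  case False
  then obtain f where f: "inj_on f {..<k}" "f ` {..<k} \<subseteq> V"
    using card_le_inj[of "{..<k}" V] assms(1) by auto
  have "inj_on (restrict f {..<k}) {..<k}" using f(1) by (simp add: inj_on_def)
  then have "restrict f {..<k} \<in> labellings k V" using f(2) by (auto simp: labellings_def)
  then show ?thesis by blast
qed

lemma sampling_labellings:
  "sampling_scheme r (labellings k) (pullback r k) (arrays r {..<k} :: (nat list \<Rightarrow> 'k::topological_space) topology)"
proof (rule sampling_scheme.intro)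
  fix V :: "nat set" assume V: "finite V" "V \<noteq> {}"
  show "finite (labellings k V) \<and> labellings k V \<noteq> {}"
    using finite_labellings[OF V(1)] labellings_nonempty[OF V] by blast
  fix \<phi> assume \<phi>: "\<phi> \<in> labellings k V"
  show "continuous_map (arrays r V) (arrays r {..<k} :: (nat list \<Rightarrow> 'k) topology) (\<lambda>a. pullback r k (V, a) \<phi>)"
    unfolding continuous_map_componentwise pullback_def
  proof (intro conjI ballI)
    fix i assume i: "i \<in> tuples r {..<k}"
    have "map \<phi> i \<in> tuples r V" by (rule map_tuples[OF _ i]) (use \<phi> in \<open>auto simp: labellings_def\<close>)
    from continuous_map_product_projection[OF this, of "\<lambda>_. euclidean"] i
    show "continuous_map (arrays r V) euclidean (\<lambda>a. (\<lambda>i\<in>tuples r {..<k}. snd (V, a) (map \<phi> i)) i)" by simp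
  qed auto
next
  fix G H :: "'k hypergraph" assume iso: "(G, H) \<in> hypergraph_iso r"
  then obtain \<sigma> where b: "bij_betw \<sigma> (fst G) (fst H)"
    and e: "\<And>i. i \<in> tuples r (fst G) \<Longrightarrow> snd H (map \<sigma> i) = snd G i"
    unfolding hypergraph_iso_def by auto
  let ?\<tau> = "inv_into (fst G) \<sigma>"
  have c: "card (fst G) = card (fst H)" by (rule bij_betw_same_card[OF b])
  have b': "bij_betw ?\<tau> (fst H) (fst G)" by (rule bij_betw_inv_into[OF b])
  \<comment> \<open>Stated for a general bijection, to serve both \<open>\<sigma>\<close> and its
    inverse.\<close>
  have step: "(\<lambda>i\<in>{..<k}. \<rho> (\<phi> i)) \<in> labellings k W"
    if \<rho>: "bij_betw \<rho> V W" and cc: "card V = card W" and \<phi>: "\<phi> \<in> labellings k V" for \<rho> \<phi> V W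
  proof -
    have p: "\<phi> i \<in> V" if "i < k" for i using \<phi> that by (auto simp: labellings_def)
    have "inj_on (\<lambda>i\<in>{..<k}. \<rho> (\<phi> i)) {..<k}" if "inj_on \<phi> {..<k}"
      using that bij_betw_imp_inj_on[OF \<rho>] p by (simp add: inj_on_def)
    then show ?thesis
      using \<phi> bij_betwE[OF \<rho>] p cc by (auto simp: labellings_def)
  qed
  have bij: "bij_betw (\<lambda>\<phi>. \<lambda>i\<in>{..<k}. \<sigma> (\<phi> i)) (labellings k (fst G)) (labellings k (fst H))"
  proof (rule bij_betw_byWitness[where f' = "\<lambda>\<phi>. \<lambda>i\<in>{..<k}. ?\<tau> (\<phi> i)"])
    show "\<forall>\<phi>\<in>labellings k (fst G). (\<lambda>i\<in>{..<k}. ?\<tau> ((\<lambda>i\<in>{..<k}. \<sigma> (\<phi> i)) i)) = \<phi>"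
    proof
      fix \<phi> assume "\<phi> \<in> labellings k (fst G)"
      then have \<phi>: "\<phi> \<in> {..<k} \<rightarrow>\<^sub>E fst G" by (simp add: labellings_def)
      show "(\<lambda>i\<in>{..<k}. ?\<tau> ((\<lambda>i\<in>{..<k}. \<sigma> (\<phi> i)) i)) = \<phi>"
        by (rule extensionalityI[of _ "{..<k}"])
           (use \<phi> bij_betw_inv_into_left[OF b] in \<open>auto simp: PiE_iff\<close>)
    qed
    show "\<forall>\<phi>\<in>labellings k (fst H). (\<lambda>i\<in>{..<k}. \<sigma> ((\<lambda>i\<in>{..<k}. ?\<tau> (\<phi> i)) i)) = \<phi>"
    proof
      fix \<phi> assume "\<phi> \<in> labellings k (fst H)"
      then have \<phi>: "\<phi> \<in> {..<k} \<rightarrow>\<^sub>E fst H" by (simp add: labellings_def)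
      show "(\<lambda>i\<in>{..<k}. \<sigma> ((\<lambda>i\<in>{..<k}. ?\<tau> (\<phi> i)) i)) = \<phi>"
        by (rule extensionalityI[of _ "{..<k}"])
           (use \<phi> bij_betw_inv_into_right[OF b] in \<open>auto simp: PiE_iff\<close>)
    qed
    show "(\<lambda>\<phi>. \<lambda>i\<in>{..<k}. \<sigma> (\<phi> i)) ` labellings k (fst G) \<subseteq> labellings k (fst H)"
      by (rule image_subsetI) (rule step[OF b c])
    show "(\<lambda>\<phi>. \<lambda>i\<in>{..<k}. ?\<tau> (\<phi> i)) ` labellings k (fst H) \<subseteq> labellings k (fst G)"
      by (rule image_subsetI) (rule step[OF b' c[symmetric]])
  qed
  have eq: "pullback r k H (\<lambda>i\<in>{..<k}. \<sigma> (\<phi> i)) = pullback r k G \<phi>" if \<phi>: "\<phi> \<in> labellings k (fst G)" for \<phi>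
    unfolding pullback_def
  proof (rule restrict_ext)
    fix i assume i: "i \<in> tuples r {..<k}"
    have "map (\<lambda>i\<in>{..<k}. \<sigma> (\<phi> i)) i = map \<sigma> (map \<phi> i)"
      using i by (auto simp: tuples_def)
    moreover have "map \<phi> i \<in> tuples r (fst G)"
      by (rule map_tuples[OF _ i]) (use \<phi> in \<open>auto simp: labellings_def\<close>)
    ultimately show "snd H (map (\<lambda>i\<in>{..<k}. \<sigma> (\<phi> i)) i) = snd G (map \<phi> i)" by (simp only: e)
  qed
  show "\<exists>\<beta>. bij_betw \<beta> (labellings k (fst G)) (labellings k (fst H)) \<and>
      (\<forall>s\<in>labellings k (fst G). pullback r k H (\<beta> s) = pullback r k G s)"
    by (rule exI[of _ "\<lambda>\<phi>. \<lambda>i\<in>{..<k}. \<sigma> (\<phi> i)"]) (use bij eq in simp)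
qed

subsection \<open>Labelled and unlabelled samples\<close>

text \<open>The labelling \<open>\<phi>\<close> is itself the isomorphism onto the induced
  sub-hypergraph.\<close>

lemma pullback_induced:
  assumes k: "1 \<le> k" and G: "G \<in> hypergraphs r UNIV" and \<phi>: "\<phi> \<in> {..<k} \<rightarrow>\<^sub>E fst G" "inj_on \<phi> {..<k}"
  shows "iso_class r ({..<k}, pullback r k G \<phi>) = iso_class r (induced r G (\<phi> ` {..<k}))"
proof -
  let ?P = "({..<k}, pullback r k G \<phi>)"
  have ne: "{..<k} \<noteq> {}" using k by (auto simp: lessThan_empty_iff)
  have P: "?P \<in> hypergraphs r UNIV" using ne by (simp add: pullback_def)
  have "induced r ?P {..<k} = ?P" by (simp add: induced_def pullback_def)
  moreover have "iso_class r (induced r G (\<phi> ` {..<k})) = iso_class r (induced r ?P {..<k})"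
    by (rule iso_class_induced[OF P G \<phi>(2)]) (use \<phi>(1) ne in \<open>auto simp: pullback_def\<close>)
  ultimately show ?thesis by simp
qed

text \<open>Each set of size \<open>k\<close> is the image of exactly \<open>k!\<close> injections
  from \<open>{..<k}\<close>; the product is \<open>k!\<close> in the form in which injections are
  counted.\<close>

lemma sum_injections_by_image:
  fixes g :: "nat set \<Rightarrow> real"
  assumes V: "finite V" and k: "k \<le> card V"
  shows "(\<Sum>\<phi> | \<phi> \<in> {..<k} \<rightarrow>\<^sub>E V \<and> inj_on \<phi> {..<k}. g (\<phi> ` {..<k})) =
    real (\<Prod>i = 0..<k. k - i) * (\<Sum>W | W \<subseteq> V \<and> card W = k. g W)"
proof -
  let ?I = "{\<phi>. \<phi> \<in> {..<k} \<rightarrow>\<^sub>E V \<and> inj_on \<phi> {..<k}}" and ?S = "{W. W \<subseteq> V \<and> card W = k}"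
  have finI: "finite ?I" by (rule finite_subset[OF _ finite_PiE[of "{..<k}" "\<lambda>_. V"]]) (use V in auto)
  have finS: "finite ?S" using V by simp
  have sub: "(\<lambda>\<phi>. \<phi> ` {..<k}) ` ?I \<subseteq> ?S"
  proof (rule image_subsetI)
    fix \<phi> assume "\<phi> \<in> ?I"
    then have \<phi>: "\<phi> \<in> {..<k} \<rightarrow>\<^sub>E V" "inj_on \<phi> {..<k}" by auto
    have "\<phi> ` {..<k} \<subseteq> V" using \<phi>(1) by auto
    then show "\<phi> ` {..<k} \<in> ?S" using card_image[OF \<phi>(2)] by simp
  qed
  have fibre: "card {\<phi>. \<phi> \<in> ?I \<and> \<phi> ` {..<k} = W} = (\<Prod>i = 0..<k. k - i)" if W: "W \<in> ?S" for W
  proof -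
    have fW: "finite W" by (rule finite_subset[OF _ V]) (use W in simp)
    have "{\<phi>. \<phi> \<in> ?I \<and> \<phi> ` {..<k} = W} = {\<phi> \<in> {..<k} \<rightarrow>\<^sub>E W. inj_on \<phi> {..<k}}"
    proof (intro equalityI subsetI)
      fix \<phi> assume "\<phi> \<in> {\<phi> \<in> {..<k} \<rightarrow>\<^sub>E W. inj_on \<phi> {..<k}}"
      then have \<phi>: "\<phi> \<in> {..<k} \<rightarrow>\<^sub>E W" "inj_on \<phi> {..<k}" by auto
      have "\<phi> ` {..<k} \<subseteq> W" using \<phi>(1) by auto
      then have "\<phi> ` {..<k} = W"
        using card_image[OF \<phi>(2)] W by (intro card_subset_eq fW) simp_all
      moreover have "\<phi> \<in> {..<k} \<rightarrow>\<^sub>E V" using \<phi>(1) W by (auto simp: PiE_iff)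
      ultimately show "\<phi> \<in> {\<phi>. \<phi> \<in> ?I \<and> \<phi> ` {..<k} = W}" using \<phi>(2) by simp
    qed (auto simp: PiE_iff)
    also have "card \<dots> = (\<Prod>i = 0..<k. k - i)"
      using card_inj_on_subset_funcset[of "{..<k}" W "{..<k}"] fW W by simp
    finally show ?thesis .
  qed
  have "(\<Sum>\<phi>\<in>?I. g (\<phi> ` {..<k})) = (\<Sum>W\<in>?S. \<Sum>\<phi> | \<phi> \<in> ?I \<and> \<phi> ` {..<k} = W. g (\<phi> ` {..<k}))"
    by (rule sum.group[OF finI finS sub, symmetric])
  also have "\<dots> = (\<Sum>W\<in>?S. real (\<Prod>i = 0..<k. k - i) * g W)"
  proof (rule sum.cong[OF refl])
    fix W assume W: "W \<in> ?S"
    have "(\<Sum>\<phi> | \<phi> \<in> ?I \<and> \<phi> ` {..<k} = W. g (\<phi> ` {..<k})) = (\<Sum>\<phi> | \<phi> \<in> ?I \<and> \<phi> ` {..<k} = W. g W)"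
      by (rule sum.cong) auto
    then show "(\<Sum>\<phi> | \<phi> \<in> ?I \<and> \<phi> ` {..<k} = W. g (\<phi> ` {..<k})) = real (\<Prod>i = 0..<k. k - i) * g W"
      unfolding sum_constant fibre[OF W] .
  qed
  finally show ?thesis by (simp only: sum_distrib_left)
qed

text \<open>A uniformly random injection has a uniformly random image, and the factor
  \<open>k!\<close> cancels. With fewer than \<open>k\<close> vertices the two schemes produce
  different numbers of vertices, hence \<open>large\<close>.\<close>

lemma average_subsets_eq_labellings:
  fixes f :: "'k::topological_space hypergraph set \<Rightarrow> real"
  assumes k: "1 \<le> k" and G: "G \<in> hypergraphs r UNIV" and large: "k \<le> card (fst G)"
  shows "(\<Sum>W\<in>subsets_of_size k (fst G). f (iso_class r (induced r G W))) / real (card (subsets_of_size k (fst G))) =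
    (\<Sum>\<phi>\<in>labellings k (fst G). f (iso_class r ({..<k}, pullback r k G \<phi>))) / real (card (labellings k (fst G)))"
proof -
  let ?g = "\<lambda>W. f (iso_class r (induced r G W))" and ?c = "real (\<Prod>i = 0..<k. k - i)"
  have V: "finite (fst G)" by (rule hypergraphsD(1)[OF G])
  have S: "subsets_of_size k (fst G) = {W. W \<subseteq> fst G \<and> card W = k}"
    using large by (simp add: subsets_of_size_def min_absorb1)
  have L: "labellings k (fst G) = {\<phi>. \<phi> \<in> {..<k} \<rightarrow>\<^sub>E fst G \<and> inj_on \<phi> {..<k}}"
    using labellings_large[OF large] .
  have "(\<Sum>\<phi>\<in>labellings k (fst G). f (iso_class r ({..<k}, pullback r k G \<phi>))) =
      (\<Sum>\<phi>\<in>labellings k (fst G). ?g (\<phi> ` {..<k}))"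
    by (rule sum.cong[OF refl]) (simp add: L pullback_induced[OF k G])
  also have "\<dots> = ?c * sum ?g (subsets_of_size k (fst G))"
    unfolding L S by (rule sum_injections_by_image[OF V large])
  finally have 1: "(\<Sum>\<phi>\<in>labellings k (fst G). f (iso_class r ({..<k}, pullback r k G \<phi>))) =
      ?c * sum ?g (subsets_of_size k (fst G))" .
  have "real (card (labellings k (fst G))) = (\<Sum>\<phi>\<in>labellings k (fst G). 1)" by simp
  also have "\<dots> = ?c * (\<Sum>W\<in>subsets_of_size k (fst G). 1)"
    unfolding L S by (rule sum_injections_by_image[OF V large, of "\<lambda>_. 1"])
  finally have 2: "real (card (labellings k (fst G))) = ?c * real (card (subsets_of_size k (fst G)))" by simp
  have "?c \<noteq> 0" by simp
  then show ?thesis unfolding 1 2 by simp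
qed

text \<open>Inside a sample with \<open>k\<close> vertices the injections are the permutations
  \<open>\<psi>\<close> of \<open>{..<k}\<close>. Composing with a fixed \<open>\<psi>\<close>
  permutes the labellings, so every \<open>\<psi>\<close> gives the same sum, and averaging over
  them changes nothing.\<close>

lemma average_lab_inj_density:
  fixes F :: "('k::topological_space \<Rightarrow>\<^sub>C real) hypergraph"
  assumes k: "1 \<le> k" and F: "fst F = {..<k}" and G: "G \<in> hypergraphs r UNIV" and large: "k \<le> card (fst G)"
  shows "(\<Sum>\<phi>\<in>labellings k (fst G). lab_inj_density r F ({..<k}, pullback r k G \<phi>)) /
    real (card (labellings k (fst G))) = lab_inj_density r F G"
proof -
  let ?L = "labellings k (fst G)" and ?P = "{\<psi> \<in> {..<k} \<rightarrow>\<^sub>E {..<k}. inj_on \<psi> {..<k}}"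
  let ?m = "\<lambda>\<phi>. \<Prod>i\<in>tuples r {..<k}. apply_bcontfun (snd F i) (snd G (map \<phi> i))"
  have L: "?L = {\<phi> \<in> {..<k} \<rightarrow>\<^sub>E fst G. inj_on \<phi> {..<k}}" by (rule labellings_large[OF large])
  have Pne: "real (card ?P) \<noteq> 0"
    using labellings_nonempty[of "{..<k}" k] finite_labellings[of "{..<k}" k] k labellings_large[of k "{..<k}"]
    by (auto simp: lessThan_empty_iff)
  have inner: "(\<Sum>\<phi>\<in>?L. ?m (\<lambda>i\<in>{..<k}. \<phi> (\<psi> i))) = (\<Sum>\<phi>\<in>?L. ?m \<phi>)" if \<psi>: "\<psi> \<in> ?P" for \<psi>
  proof -
    have im: "\<psi> ` {..<k} = {..<k}" using \<psi> by (intro endo_inj_surj) auto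
    have b: "bij_betw \<psi> {..<k} {..<k}" using \<psi> im by (simp add: bij_betw_def)
    let ?\<theta> = "inv_into {..<k} \<psi>"
    have b': "bij_betw ?\<theta> {..<k} {..<k}" by (rule bij_betw_inv_into[OF b])
    have step: "(\<lambda>i\<in>{..<k}. \<phi> (\<rho> i)) \<in> ?L" if \<rho>: "bij_betw \<rho> {..<k} {..<k}" and \<phi>: "\<phi> \<in> ?L" for \<rho> \<phi>
    proof -
      have r: "\<rho> i < k" if "i < k" for i using bij_betwE[OF \<rho>] that by auto
      have "inj_on (\<lambda>i\<in>{..<k}. \<phi> (\<rho> i)) {..<k}"
        using \<phi> bij_betw_imp_inj_on[OF \<rho>] r by (simp add: L inj_on_def)
      then show ?thesis using \<phi> r by (auto simp: L)
    qed
    have "bij_betw (\<lambda>\<phi>. \<lambda>i\<in>{..<k}. \<phi> (\<psi> i)) ?L ?L"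
    proof (rule bij_betw_byWitness[where f' = "\<lambda>\<phi>. \<lambda>i\<in>{..<k}. \<phi> (?\<theta> i)"])
      show "\<forall>\<phi>\<in>?L. (\<lambda>i\<in>{..<k}. (\<lambda>i\<in>{..<k}. \<phi> (\<psi> i)) (?\<theta> i)) = \<phi>"
      proof
        fix \<phi> assume "\<phi> \<in> ?L"
        then have \<phi>: "\<phi> \<in> {..<k} \<rightarrow>\<^sub>E fst G" by (simp add: L)
        show "(\<lambda>i\<in>{..<k}. (\<lambda>i\<in>{..<k}. \<phi> (\<psi> i)) (?\<theta> i)) = \<phi>"
          by (rule extensionalityI[of _ "{..<k}"])
             (use \<phi> bij_betw_inv_into_right[OF b] bij_betwE[OF b'] in \<open>auto simp: PiE_iff\<close>)
      qed
      show "\<forall>\<phi>\<in>?L. (\<lambda>i\<in>{..<k}. (\<lambda>i\<in>{..<k}. \<phi> (?\<theta> i)) (\<psi> i)) = \<phi>"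
      proof
        fix \<phi> assume "\<phi> \<in> ?L"
        then have \<phi>: "\<phi> \<in> {..<k} \<rightarrow>\<^sub>E fst G" by (simp add: L)
        show "(\<lambda>i\<in>{..<k}. (\<lambda>i\<in>{..<k}. \<phi> (?\<theta> i)) (\<psi> i)) = \<phi>"
          by (rule extensionalityI[of _ "{..<k}"])
             (use \<phi> bij_betw_inv_into_left[OF b] bij_betwE[OF b] in \<open>auto simp: PiE_iff\<close>)
      qed
      show "(\<lambda>\<phi>. \<lambda>i\<in>{..<k}. \<phi> (\<psi> i)) ` ?L \<subseteq> ?L" by (rule image_subsetI) (rule step[OF b])
      show "(\<lambda>\<phi>. \<lambda>i\<in>{..<k}. \<phi> (?\<theta> i)) ` ?L \<subseteq> ?L" by (rule image_subsetI) (rule step[OF b'])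
    qed
    then show ?thesis by (rule sum.reindex_bij_betw)
  qed
  have pull: "(\<Prod>i\<in>tuples r {..<k}. apply_bcontfun (snd F i) (pullback r k G \<phi> (map \<psi> i))) =
      ?m (\<lambda>i\<in>{..<k}. \<phi> (\<psi> i))" if \<psi>: "\<psi> \<in> ?P" for \<phi> \<psi>
  proof (rule prod.cong[OF refl])
    fix i assume i: "i \<in> tuples r {..<k}"
    have "map \<psi> i \<in> tuples r {..<k}" by (rule map_tuples[OF _ i]) (use \<psi> in auto)
    moreover have "map \<phi> (map \<psi> i) = map (\<lambda>i\<in>{..<k}. \<phi> (\<psi> i)) i" using i by (auto simp: tuples_def)
    ultimately show "apply_bcontfun (snd F i) (pullback r k G \<phi> (map \<psi> i)) =
      apply_bcontfun (snd F i) (snd G (map (\<lambda>i\<in>{..<k}. \<phi> (\<psi> i)) i))"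
      by (simp add: pullback_def del: map_map)
  qed
  have "(\<Sum>\<phi>\<in>?L. lab_inj_density r F ({..<k}, pullback r k G \<phi>)) =
      (\<Sum>\<phi>\<in>?L. (\<Sum>\<psi>\<in>?P. ?m (\<lambda>i\<in>{..<k}. \<phi> (\<psi> i))) / real (card ?P))"
    unfolding lab_inj_density_def Let_def hom_sum_def F fst_conv snd_conv
    by (intro sum.cong refl arg_cong2[of _ _ _ _ "(/)"] pull)
  also have "\<dots> = (\<Sum>\<psi>\<in>?P. \<Sum>\<phi>\<in>?L. ?m (\<lambda>i\<in>{..<k}. \<phi> (\<psi> i))) / real (card ?P)"
    unfolding sum_divide_distrib[symmetric] by (subst sum.swap) (rule refl)
  also have "(\<Sum>\<psi>\<in>?P. \<Sum>\<phi>\<in>?L. ?m (\<lambda>i\<in>{..<k}. \<phi> (\<psi> i))) = (\<Sum>\<psi>\<in>?P. \<Sum>\<phi>\<in>?L. ?m \<phi>)"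
    by (rule sum.cong[OF refl inner])
  also have "\<dots> / real (card ?P) = (\<Sum>\<phi>\<in>?L. ?m \<phi>)" using Pne by simp
  finally show ?thesis
    unfolding lab_inj_density_def Let_def hom_sum_def F L by simp
qed

text \<open>Moves the vertices to a set \<open>{..<k}\<close>, on which labelled samples
  live.\<close>

lemma canonical_representative:
  assumes "C \<in> unlabelled r UNIV"
  obtains k G where "1 \<le> k" "G \<in> hypergraphs r UNIV" "fst G = {..<k}" "C = iso_class r G"
proof -
  let ?H = "rep C"
  note H = rep_unlabelled[OF assms]
  define k where "k = card (fst ?H)"
  obtain \<sigma> where \<sigma>: "bij_betw \<sigma> {..<k} (fst ?H)"
    using ex_bij_betw_nat_finite[OF hypergraphsD(1)[OF H(1)]] unfolding k_def atLeast0LessThan ..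
  have k: "1 \<le> k" using hypergraphsD(4)[OF H(1)] by (simp add: k_def)
  define G where "G = ({..<k}, \<lambda>i\<in>tuples r {..<k}. snd ?H (map \<sigma> i))"
  have G: "G \<in> hypergraphs r UNIV" using k by (simp add: G_def lessThan_empty_iff)
  have e: "\<forall>i\<in>tuples r (fst G). snd ?H (map \<sigma> i) = snd G i" by (simp add: G_def)
  have "bij_betw \<sigma> (fst G) (fst ?H)" using \<sigma> by (simp add: G_def)
  with e have "\<exists>\<sigma>. bij_betw \<sigma> (fst G) (fst ?H) \<and> (\<forall>i\<in>tuples r (fst G). snd ?H (map \<sigma> i) = snd G i)"
    by (intro exI conjI)
  then have "(G, ?H) \<in> hypergraph_iso r"
    unfolding hypergraph_iso_def using G H(1) by simp
  from iso_class_eq[OF this] have "C = iso_class r G" using H(2) by simp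
  from that[OF k G _ this] show thesis by (simp add: G_def)
qed

subsection \<open>Convergence of the samples\<close>

text \<open>A point of a dense set that is closer to \<open>x\<close> than half of
  \<open>dist x y\<close> is farther from \<open>y\<close> than from \<open>x\<close>.\<close>

lemma countable_dense_distances:
  "\<exists>D :: 'k::polish_space set. countable D \<and> D \<noteq> {} \<and>
    (\<forall>x y. x \<noteq> y \<longrightarrow> (\<exists>d\<in>D. dist d x \<noteq> dist d y))"
proof -
  obtain D :: "'k set" where D: "countable D" "\<forall>X. open X \<longrightarrow> X \<noteq> {} \<longrightarrow> (\<exists>d\<in>D. d \<in> X)"
    using countable_dense_exists by blast
  have "D \<noteq> {}" using D(2)[rule_format, of UNIV] by auto
  moreover have "\<exists>d\<in>D. dist d x \<noteq> dist d y" if "x \<noteq> y" for x y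
  proof -
    have "0 < dist x y / 2" using that by simp
    then have "ball x (dist x y / 2) \<noteq> {}" by (simp add: ball_eq_empty)
    then obtain d where d: "d \<in> D" "d \<in> ball x (dist x y / 2)" using D(2) open_ball by blast
    have "dist d x \<noteq> dist d y"
    proof
      assume "dist d x = dist d y"
      then have "dist x y \<le> 2 * dist d x" using dist_triangle3[of x y d] by simp
      then show False using d(2) by (simp add: dist_commute)
    qed
    with d(1) show ?thesis by blast
  qed
  ultimately show ?thesis using D(1) by blast
qed

text \<open>The explicit form of \<open>g\<close> is kept because each of these functions must later
  be recognised as a combination of monomials.\<close>

lemma separated_arrays:
  assumes K: "compact (UNIV :: 'k::polish_space set)" and k: "1 \<le> k"
  obtains g where "separated_compact (arrays r {..<k} :: (nat list \<Rightarrow> 'k) topology) g"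
    "\<And>j. \<exists>i\<in>tuples r {..<k}. \<exists>d. g j = (\<lambda>x. dist d (x i))"
proof -
  from countable_dense_distances obtain D :: "'k set" where
    D: "countable D" "D \<noteq> {}" "\<forall>x y. x \<noteq> y \<longrightarrow> (\<exists>d\<in>D. dist d x \<noteq> dist d y)"
    by (elim exE conjE)
  let ?g = "\<lambda>(i, d) x. dist d (x i :: 'k)"
  define P where "P = tuples r {..<k} \<times> D"
  \<comment> \<open>At least one tuple exists, so that the countable set \<open>P\<close> is
    nonempty and can be enumerated.\<close>
  have "replicate r 0 \<in> tuples r {..<k}" using k by (auto simp: tuples_def)
  then have P: "countable P" "P \<noteq> {}"
    using D(1,2) by (auto simp: P_def intro!: countable_SIGMA countable_finite finite_tuples)
  have rng: "range (from_nat_into P) = P" by (rule range_from_nat_into[OF P(2,1)])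
  have inP: "from_nat_into P j \<in> P" for j by (rule from_nat_into[OF P(2)])
  define g where "g j = ?g (from_nat_into P j)" for j
  have form: "\<exists>i\<in>tuples r {..<k}. \<exists>d. g j = (\<lambda>x. dist d (x i))" for j
    using inP[of j] by (cases "from_nat_into P j") (auto simp: g_def P_def)
  have "separated_compact (arrays r {..<k} :: (nat list \<Rightarrow> 'k) topology) g"
  proof (rule separated_compact.intro)
    show "compact_space (arrays r {..<k} :: (nat list \<Rightarrow> 'k) topology)"
      unfolding compact_space_product_topology using K by (simp add: compact_space_def)
    show "continuous_map (arrays r {..<k}) euclideanreal (g j)" for j
    proof -
      obtain i d where i: "i \<in> tuples r {..<k}" and g: "g j = (\<lambda>x. dist d (x i))" using form[of j] by blast
      have "continuous_map euclidean euclideanreal (dist d)" by (simp add: continuous_on_dist)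
      from continuous_map_compose[OF continuous_map_product_projection[OF i, of "\<lambda>_. euclidean"] this]
      show ?thesis by (simp add: g comp_def)
    qed
    fix x y :: "nat list \<Rightarrow> 'k"
    assume x: "x \<in> topspace (arrays r {..<k})" and y: "y \<in> topspace (arrays r {..<k})" and ne: "x \<noteq> y"
    have "\<exists>i\<in>tuples r {..<k}. x i \<noteq> y i"
    proof (rule ccontr)
      assume "\<not> (\<exists>i\<in>tuples r {..<k}. x i \<noteq> y i)"
      then have "x = y" using x y by (intro extensionalityI[of _ "tuples r {..<k}"]) (auto simp: PiE_iff)
      with ne show False ..
    qed
    then obtain i where i: "i \<in> tuples r {..<k}" "x i \<noteq> y i" by blast
    obtain d where d: "d \<in> D" "dist d (x i) \<noteq> dist d (y i)" using D(3)[rule_format, OF i(2)] by blast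
    have "(i, d) \<in> range (from_nat_into P)" unfolding rng using i(1) d(1) by (simp add: P_def)
    then obtain j where j: "(i, d) = from_nat_into P j" by (rule rangeE)
    have "g j x \<noteq> g j y" using d(2) unfolding g_def j[symmetric] by simp
    then show "\<exists>j. g j x \<noteq> g j y" ..
  qed
  then show thesis using form by (rule that)
qed

section \<open>Polynomials in the entries of an array\<close>

text \<open>The summand of a density as a function of the sampled array. Averaged over injective
  labellings it is an injective density.\<close>

definition monomial :: "nat \<Rightarrow> nat \<Rightarrow> (nat list \<Rightarrow> ('k::topological_space \<Rightarrow>\<^sub>C real)) \<Rightarrow> (nat list \<Rightarrow> 'k) \<Rightarrow> real" where
  "monomial r k F x = (\<Prod>i\<in>tuples r {..<k}. apply_bcontfun (F i) (x i))"

inductive_set monomial_span :: "nat \<Rightarrow> nat \<Rightarrow> ((nat list \<Rightarrow> 'k::topological_space) \<Rightarrow> real) set" for r k where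
  zero: "(\<lambda>_. 0) \<in> monomial_span r k"
| step: "p \<in> monomial_span r k \<Longrightarrow> (\<lambda>x. p x + c * monomial r k F x) \<in> monomial_span r k"

lemma continuous_map_monomial: "continuous_map (arrays r {..<k}) euclideanreal (monomial r k F)"
  unfolding monomial_def[abs_def]
  by (intro continuous_map_prod finite_tuples continuous_map_apply_bcontfun continuous_map_product_projection) auto

lemma continuous_map_monomial_span:
  "p \<in> monomial_span r k \<Longrightarrow> continuous_map (arrays r {..<k}) euclideanreal p"
  by (induction rule: monomial_span.induct)
     (simp_all add: continuous_map_add continuous_map_real_mult_left continuous_map_monomial)

lemma monomial_span_add:
  "q \<in> monomial_span r k \<Longrightarrow> p \<in> monomial_span r k \<Longrightarrow> (\<lambda>x. p x + q x) \<in> monomial_span r k"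
proof (induction rule: monomial_span.induct)
  case (step q c F)
  then show ?case using monomial_span.step[where p = "\<lambda>x. p x + q x" and c = c and F = F] by (simp add: add.assoc)
qed simp

lemma bcontfun_of_continuous:
  assumes "compact (UNIV :: 'k::topological_space set)" "continuous_on UNIV (f :: 'k \<Rightarrow> real)"
  shows "\<exists>F. \<forall>x. apply_bcontfun F x = f x"
proof -
  have "compact (range f)" by (rule compact_continuous_image[OF assms(2,1)])
  then have "f \<in> bcontfun" using assms(2) by (simp add: bcontfun_def compact_imp_bounded)
  then obtain F where "f = apply_bcontfun F" by (rule bcontfunE)
  then show ?thesis by (intro exI[of _ F]) simp
qed

text \<open>Both monomials read the same array, so factors at the same tuple multiply; in contrast
  to products of densities, no disjoint union arises. Compactness is used to see the pointwise
  products as bounded continuous functions again.\<close>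

lemma monomial_mult:
  assumes K: "compact (UNIV :: 'k::topological_space set)"
  shows "\<exists>F''. \<forall>x :: nat list \<Rightarrow> 'k. monomial r k F'' x = monomial r k F x * monomial r k F' x"
proof -
  have "\<exists>H. \<forall>x. apply_bcontfun H x = apply_bcontfun (F i) x * apply_bcontfun (F' i) x" for i
  proof -
    have "continuous_on UNIV (\<lambda>x. apply_bcontfun (F i) x * apply_bcontfun (F' i) x)"
      by (intro continuous_on_mult continuous_on_apply_bcontfun)
    from bcontfun_of_continuous[OF K this] show ?thesis .
  qed
  then obtain F'' where F'': "\<And>i x. apply_bcontfun (F'' i) x = apply_bcontfun (F i) x * apply_bcontfun (F' i) x"
    by metis
  show ?thesis by (rule exI[of _ F'']) (simp add: monomial_def F'' prod.distrib)
qed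

lemma monomial_span_mult_monomial:
  assumes K: "compact (UNIV :: 'k::topological_space set)" and "p \<in> monomial_span r k"
  shows "(\<lambda>x :: nat list \<Rightarrow> 'k. p x * (c * monomial r k F x)) \<in> monomial_span r k"
  using assms(2)
proof (induction rule: monomial_span.induct)
  case zero
  then show ?case using monomial_span.zero by simp
next
  case (step p c' F')
  obtain F'' where F'': "\<And>x :: nat list \<Rightarrow> 'k. monomial r k F'' x = monomial r k F' x * monomial r k F x"
    using monomial_mult[OF K, of r k F' F] by blast
  show ?case using monomial_span.step[OF step.IH, where c = "c' * c" and F = F''] by (simp add: F'' algebra_simps)
qed

lemma monomial_span_mult:
  assumes K: "compact (UNIV :: 'k::topological_space set)" and q: "q \<in> monomial_span r k" and p: "p \<in> monomial_span r k"
  shows "(\<lambda>x :: nat list \<Rightarrow> 'k. p x * q x) \<in> monomial_span r k"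
  using q
proof (induction rule: monomial_span.induct)
  case zero
  then show ?case using monomial_span.zero by simp
next
  case (step q c F)
  show ?case
    using monomial_span_add[OF monomial_span_mult_monomial[OF K p, of c F] step.IH]
    by (simp add: distrib_left)
qed

lemma monomial_span_const: "(\<lambda>_. c) \<in> monomial_span r k"
  using monomial_span.step[OF monomial_span.zero, where c = c and F = "\<lambda>_. const_bcontfun 1" and r = r and k = k] by (simp add: monomial_def)

lemma monomial_span_coordinate:
  assumes K: "compact (UNIV :: 'k::topological_space set)" and f: "continuous_on UNIV f"
    and i: "i \<in> tuples r {..<k}"
  shows "(\<lambda>x :: nat list \<Rightarrow> 'k. f (x i)) \<in> monomial_span r k"
proof -
  obtain F where F: "\<And>x. apply_bcontfun F x = f x" using bcontfun_of_continuous[OF K f] by blast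
  have "monomial r k ((\<lambda>_. const_bcontfun 1)(i := F)) x = f (x i)" for x :: "nat list \<Rightarrow> 'k"
    unfolding monomial_def by (simp add: prod.remove[OF finite_tuples[OF finite_lessThan] i] F)
  then show ?thesis
    using monomial_span.step[OF monomial_span.zero,
        where c = 1 and F = "(\<lambda>_. const_bcontfun 1)(i := F)" and r = r and k = k] by simp
qed

section \<open>Samples from the random hypergraphs\<close>

context random_hypergraphs
begin

definition lab_average :: "nat \<Rightarrow> ((nat list \<Rightarrow> 'k) \<Rightarrow> real) \<Rightarrow> 'k hypergraph set \<Rightarrow> real" where
  "lab_average k = sampling_scheme.average (labellings k) (pullback r k)"

definition sub_average :: "nat \<Rightarrow> ('k hypergraph set \<Rightarrow> real) \<Rightarrow> 'k hypergraph set \<Rightarrow> real" where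
  "sub_average k = sampling_scheme.average (subsets_of_size k) (\<lambda>G W. iso_class r (induced r G W))"

lemma lab_average_eq:
  "lab_average k p C = (\<Sum>\<phi>\<in>labellings k (fst (rep C)). p (pullback r k (rep C) \<phi>)) /
    real (card (labellings k (fst (rep C))))"
  unfolding lab_average_def by (rule sampling_scheme.average_def[OF sampling_labellings])

lemma sub_average_eq:
  assumes "1 \<le> k"
  shows "sub_average k f C =
    (\<Sum>W\<in>subsets_of_size k (fst (rep C)). f (iso_class r (induced r (rep C) W))) /
    real (card (subsets_of_size k (fst (rep C))))"
  unfolding sub_average_def by (rule sampling_scheme.average_def[OF sampling_subsets[OF assms]])

text \<open>With fewer than \<open>k\<close> vertices, \<open>1 \<le> k * inv_size\<close>, so a
  discrepancy of at most \<open>B\<close> is bounded by \<open>B * k * inv_size\<close> and is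
  negligible in expectation.\<close>

lemma expect_eventually_eq:
  assumes p: "test_fun p" and q: "test_fun q"
    and eq: "\<And>C. C \<in> hyps \<Longrightarrow> k \<le> num_vertices C \<Longrightarrow> p C = q C"
  shows "(\<lambda>n. expect n p - expect n q) \<longlonglongrightarrow> 0"
proof -
  have t: "test_fun (\<lambda>C. p C - q C)" by (rule test_fun_diff[OF p q])
  obtain B where B: "0 \<le> B" "\<forall>C\<in>hyps. \<bar>p C - q C\<bar> \<le> B" using test_fun_bound[OF t] by blast
  have "(\<lambda>n. expect n (\<lambda>C. p C - q C)) \<longlonglongrightarrow> 0"
  proof (rule expect_negligible[OF t])
    fix e :: real assume e: "0 < e"
    have "\<bar>p C - q C\<bar> \<le> e + B * real k * inv_size C" if C: "C \<in> hyps" for C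
    proof (cases "k \<le> num_vertices C")
      case True
      then show ?thesis using eq[OF C True] e B(1) inv_size_bounds(1)[of C] by simp
    next
      case False
      have "1 \<le> real k * inv_size C"
        using False num_vertices_pos[OF C] by (simp add: inv_size_def)
      then have "B * 1 \<le> B * (real k * inv_size C)" using B(1) by (rule mult_left_mono)
      then show ?thesis using bspec[OF B(2) C] e by (simp add: mult.assoc)
    qed
    then show "\<exists>D. \<forall>C\<in>hyps. \<bar>p C - q C\<bar> \<le> e + D * inv_size C" by blast
  qed
  then show ?thesis by (simp add: expect_diff[OF p q])
qed

lemma conv_eventually_eq:
  assumes p: "test_fun p" and q: "conv q"
    and eq: "\<And>C. C \<in> hyps \<Longrightarrow> k \<le> num_vertices C \<Longrightarrow> p C = q C"
  shows "conv p"
proof -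
  have tq: "test_fun q" and cq: "convergent (\<lambda>n. expect n q)" using q by (simp_all add: conv_def)
  have "convergent (\<lambda>n. (expect n p - expect n q) + expect n q)"
    by (rule convergent_add[OF _ cq]) (use expect_eventually_eq[OF p tq eq] in \<open>auto simp: convergent_def\<close>)
  then show ?thesis using p by (simp add: conv_def)
qed

lemma test_fun_average:
  assumes sch: "sampling_scheme r S h T2" and f: "continuous_map T2 euclideanreal f"
    and B: "\<And>x. x \<in> topspace T2 \<Longrightarrow> \<bar>f x\<bar> \<le> B" and B0: "0 \<le> B"
  shows "test_fun (sampling_scheme.average S h f)"
  by (rule test_funI[OF sampling_scheme.continuous_map_average[OF sch f]
        sampling_scheme.abs_average_bound[OF sch _ B B0]])

lemma kernel_X_measurable:
  assumes "sampling_scheme r S h T2"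
  shows "(\<lambda>\<omega>. sampling_scheme.kernel S h T2 (X n \<omega>)) \<in> measurable (M n) (subprob_algebra (borel_of T2))"
  by (rule measurable_compose[OF X_measurable sampling_scheme.kernel_measurable[OF assms]])

lemma prob_bind_kernel:
  assumes sch: "sampling_scheme r S h T2"
  shows "prob_space (M n \<bind> (\<lambda>\<omega>. sampling_scheme.kernel S h T2 (X n \<omega>)))"
  by (rule prob_space.prob_space_bind[OF prob_M _ kernel_X_measurable[OF sch]])
     (intro AE_I2 sampling_scheme.prob_kernel[OF sch] X_in)

lemma sets_bind_kernel:
  assumes sch: "sampling_scheme r S h T2"
  shows "sets (M n \<bind> (\<lambda>\<omega>. sampling_scheme.kernel S h T2 (X n \<omega>))) = sets (borel_of T2)"
  by (rule sets_bind_measurable[OF kernel_X_measurable[OF sch] prob_space.not_empty[OF prob_M]])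

text \<open>Integrating out the sampling turns a function of the sample into a function of the
  hypergraph, to which the results on expectations apply.\<close>

lemma integral_bind_kernel:
  assumes sch: "sampling_scheme r S h T2" and f: "continuous_map T2 euclideanreal f"
    and B: "\<And>x. x \<in> topspace T2 \<Longrightarrow> \<bar>f x\<bar> \<le> B"
  shows "(\<integral>x. f x \<partial>(M n \<bind> (\<lambda>\<omega>. sampling_scheme.kernel S h T2 (X n \<omega>)))) =
    expect n (sampling_scheme.average S h f)"
proof -
  have fm: "f \<in> borel_measurable (borel_of T2)" by (rule continuous_map_borel_measurable[OF f])
  have "(\<integral>x. f x \<partial>(M n \<bind> (\<lambda>\<omega>. sampling_scheme.kernel S h T2 (X n \<omega>)))) =
      (\<integral>\<omega>. \<integral>x. f x \<partial>sampling_scheme.kernel S h T2 (X n \<omega>) \<partial>M n)"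
  proof (rule integral_bind[OF fm _ kernel_X_measurable[OF sch] prob_space.finite_measure[OF prob_M]])
    show "\<bar>f x\<bar> \<le> B" if "x \<in> space (borel_of T2)" for x using B that by simp
    show "AE \<omega> in M n. emeasure (sampling_scheme.kernel S h T2 (X n \<omega>))
        (space (sampling_scheme.kernel S h T2 (X n \<omega>))) \<le> ennreal 1"
      using prob_space.emeasure_space_1[OF sampling_scheme.prob_kernel[OF sch X_in]]
      by (intro AE_I2) simp
  qed
  also have "\<dots> = expect n (sampling_scheme.average S h f)"
    unfolding expect_def
    by (rule Bochner_Integration.integral_cong[OF refl])
       (rule sampling_scheme.integral_kernel[OF sch X_in fm])
  finally show ?thesis .
qed

lemma arrays_bounded:
  assumes "continuous_map (arrays r {..<k} :: (nat list \<Rightarrow> 'k) topology) euclideanreal p"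
  shows "\<exists>B\<ge>0. \<forall>x\<in>topspace (arrays r {..<k} :: (nat list \<Rightarrow> 'k) topology). \<bar>p x\<bar> \<le> B"
proof -
  have "compact_space (arrays r {..<k} :: (nat list \<Rightarrow> 'k) topology)"
    unfolding compact_space_product_topology using compact_K by (simp add: compact_space_def)
  then have "bounded (p ` topspace (arrays r {..<k} :: (nat list \<Rightarrow> 'k) topology))"
    using image_compactin[OF _ assms, of "topspace (arrays r {..<k})"]
    unfolding compact_space_def by (simp add: compact_imp_bounded)
  then obtain B where B: "\<forall>x\<in>topspace (arrays r {..<k} :: (nat list \<Rightarrow> 'k) topology). \<bar>p x\<bar> \<le> B"
    unfolding bounded_iff by auto
  have "\<bar>p x\<bar> \<le> max 0 B" if "x \<in> topspace (arrays r {..<k} :: (nat list \<Rightarrow> 'k) topology)" for x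
    using bspec[OF B that] by (rule order_trans) simp
  then show ?thesis by (intro exI[of _ "max 0 B"]) simp
qed

lemma test_fun_lab_average:
  assumes p: "continuous_map (arrays r {..<k}) euclideanreal p"
  shows "test_fun (lab_average k p)"
proof -
  obtain B where B: "0 \<le> B" "\<forall>x\<in>topspace (arrays r {..<k} :: (nat list \<Rightarrow> 'k) topology). \<bar>p x\<bar> \<le> B"
    using arrays_bounded[OF p] by blast
  show ?thesis unfolding lab_average_def
    by (rule test_fun_average[OF sampling_labellings p bspec[OF B(2)] B(1)])
qed

lemma lab_average_monomial:
  assumes C: "C \<in> hyps" and large: "k \<le> num_vertices C"
  shows "lab_average k (monomial r k F) C =
    lab_inj_density r ({..<k}, \<lambda>i\<in>tuples r {..<k}. F i) (rep C)"
proof -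
  have L: "labellings k (fst (rep C)) = {\<phi> \<in> {..<k} \<rightarrow>\<^sub>E fst (rep C). inj_on \<phi> {..<k}}"
    using large by (intro labellings_large) (simp add: num_vertices_def)
  have "monomial r k F (pullback r k (rep C) \<phi>) =
      (\<Prod>i\<in>tuples r {..<k}. apply_bcontfun ((\<lambda>i\<in>tuples r {..<k}. F i) i) (snd (rep C) (map \<phi> i)))" for \<phi>
    unfolding monomial_def pullback_def by (rule prod.cong) simp_all
  then show ?thesis
    unfolding lab_average_eq lab_inj_density_def Let_def hom_sum_def fst_conv snd_conv L by simp
qed

text \<open>\<open>moments_converge\<close> speaks of all continuous decorations, which is what the
  arbitrary entries \<open>F\<close> require.\<close>

lemma conv_lab_average_monomial:
  assumes mc: moments_converge and k: "1 \<le> k"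
  shows "conv (lab_average k (monomial r k F))"
proof (rule conv_eventually_eq[OF test_fun_lab_average[OF continuous_map_monomial]])
  let ?F = "({..<k}, \<lambda>i\<in>tuples r {..<k}. F i)"
  have F: "?F \<in> hypergraphs r UNIV" using k by (simp add: lessThan_empty_iff)
  show "conv (inj_density r (iso_class r ?F))"
    using mc conv_inj_iff_hom[OF iso_class_in[OF F]] iso_class_in[OF F] by (simp add: moments_converge_def)
  show "lab_average k (monomial r k F) C = inj_density r (iso_class r ?F) C"
    if C: "C \<in> hyps" and large: "k \<le> num_vertices C" for C
    using lab_average_monomial[OF C large, of F] inj_density_iso_class[OF F rep_unlabelled(1)[OF C]]
      rep_unlabelled(2)[OF C] by simp
qed

lemma lab_average_add: "lab_average k (\<lambda>x. p x + q x) C = lab_average k p C + lab_average k q C"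
  unfolding lab_average_eq by (simp add: sum.distrib add_divide_distrib)

lemma lab_average_mult: "lab_average k (\<lambda>x. c * p x) C = c * lab_average k p C"
  unfolding lab_average_eq by (simp add: sum_distrib_left[symmetric])

lemma conv_lab_average:
  assumes mc: moments_converge and k: "1 \<le> k" and p: "p \<in> monomial_span r k"
  shows "conv (lab_average k p)"
  using p
proof (induction rule: monomial_span.induct)
  case zero
  have "lab_average k (\<lambda>_. 0) = (\<lambda>_. 0)" by (rule ext) (simp add: lab_average_eq)
  then show ?case using conv_const[of 0] by simp
next
  case (step p c F)
  have "lab_average k (\<lambda>x. p x + c * monomial r k F x) =
      (\<lambda>C. lab_average k p C + c * lab_average k (monomial r k F) C)"
    by (rule ext) (simp only: lab_average_add lab_average_mult)
  then show ?case using conv_add[OF step.IH conv_mult[OF conv_lab_average_monomial[OF mc k]]] by simp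
qed

lemma sub_average_eq_lab_average:
  assumes k: "1 \<le> k" and C: "C \<in> hyps" and large: "k \<le> num_vertices C"
  shows "sub_average k f C = lab_average k (\<lambda>x. f (iso_class r ({..<k}, x))) C"
  unfolding sub_average_eq[OF k] lab_average_eq
  by (rule average_subsets_eq_labellings[OF k rep_unlabelled(1)[OF C]])
     (use large in \<open>simp add: num_vertices_def\<close>)

lemma continuous_map_iso_class_arrays:
  assumes "1 \<le> k"
  shows "continuous_map (arrays r {..<k}) (unlabelled_topology r) (\<lambda>x. iso_class r ({..<k}, x))"
proof -
  have "{..<k} \<noteq> {}" using assms by (simp add: lessThan_empty_iff)
  from continuous_map_compose[OF continuous_map_labelled_inject[OF finite_lessThan this] continuous_map_iso_class]
  show ?thesis by (simp add: comp_def)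
qed

text \<open>Unlabelled hypergraphs do not form a compact space, so the limit is found for labelled
  samples in the compact space of arrays and then pushed forward by forgetting the labels. The two
  kinds of sample are matched only when there are at least \<open>k\<close> vertices, which suffices
  in the limit.\<close>

theorem moments_imp_samples:
  assumes mc: moments_converge and k: "1 \<le> k"
  shows "\<exists>N. weak_limit (unlabelled_topology r) (\<lambda>n. M n \<bind> (\<lambda>\<omega>. sample r k (X n \<omega>))) N"
proof -
  let ?A = "arrays r {..<k} :: (nat list \<Rightarrow> 'k) topology"
  let ?U = "unlabelled_topology r :: 'k hypergraph set topology"
  let ?\<iota> = "\<lambda>x. iso_class r ({..<k}, x) :: 'k hypergraph set"
  define \<mu> where "\<mu> n = M n \<bind> (\<lambda>\<omega>. sampling_scheme.kernel (labellings k) (pullback r k) ?A (X n \<omega>))" for n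
  obtain g where sep: "separated_compact ?A g"
    and g: "\<And>j. \<exists>i\<in>tuples r {..<k}. \<exists>d. g j = (\<lambda>x. dist d (x i))"
    using separated_arrays[OF compact_K k] by metis
  have int: "(\<integral>x. p x \<partial>\<mu> n) = expect n (lab_average k p)" if p: "continuous_map ?A euclideanreal p" for p n
  proof -
    obtain B where B: "0 \<le> B" "\<forall>x\<in>topspace ?A. \<bar>p x\<bar> \<le> B" using arrays_bounded[OF p] by blast
    show ?thesis unfolding \<mu>_def lab_average_def
      by (rule integral_bind_kernel[OF sampling_labellings p bspec[OF B(2)]])
  qed
  have "\<exists>N. weak_limit ?A \<mu> N"
  proof (rule separated_compact.method_of_moments[OF sep, where R = "monomial_span r k"])
    show "(\<lambda>_. c) \<in> monomial_span r k" for c by (rule monomial_span_const)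
    show "continuous_map ?A euclideanreal p" if "p \<in> monomial_span r k" for p
      by (rule continuous_map_monomial_span[OF that])
    show "(\<lambda>x. p x + q x) \<in> monomial_span r k" if "p \<in> monomial_span r k" "q \<in> monomial_span r k"
      for p q :: "(nat list \<Rightarrow> 'k) \<Rightarrow> real" by (rule monomial_span_add[OF that(2,1)])
    show "(\<lambda>x. p x * q x) \<in> monomial_span r k" if "p \<in> monomial_span r k" "q \<in> monomial_span r k"
      for p q :: "(nat list \<Rightarrow> 'k) \<Rightarrow> real" by (rule monomial_span_mult[OF compact_K that(2,1)])
    show "g j \<in> monomial_span r k" for j
    proof -
      obtain i d where i: "i \<in> tuples r {..<k}" and gj: "g j = (\<lambda>x. dist d (x i))" using g[of j] by blast
      have "continuous_on UNIV (dist d)" by (intro continuous_intros)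
      from monomial_span_coordinate[OF compact_K this i] show ?thesis unfolding gj .
    qed
    show "prob_space (\<mu> n)" for n unfolding \<mu>_def by (rule prob_bind_kernel[OF sampling_labellings])
    show "sets (\<mu> n) = sets (borel_of ?A)" for n
      unfolding \<mu>_def by (rule sets_bind_kernel[OF sampling_labellings])
    show "convergent (\<lambda>n. \<integral>x. p x \<partial>\<mu> n)" if "p \<in> monomial_span r k" for p
      using conv_lab_average[OF mc k that] by (simp add: int[OF continuous_map_monomial_span[OF that]] conv_def)
  qed
  then obtain N' where N': "weak_limit ?A \<mu> N'" by blast
  then have pN': "prob_space N'" and sN': "sets N' = sets (borel_of ?A)" by (simp_all add: weak_limit_def)
  have \<iota>m: "?\<iota> \<in> measurable N' (borel_of ?U)"
    using continuous_map_measurable[OF continuous_map_iso_class_arrays[OF k]]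
    by (simp add: measurable_cong_sets[OF sN' refl])
  define N where "N = distr N' (borel_of ?U) ?\<iota>"
  have "weak_limit ?U (\<lambda>n. M n \<bind> (\<lambda>\<omega>. sample r k (X n \<omega>))) N"
    unfolding weak_limit_def
  proof (intro conjI allI impI)
    show "prob_space N" unfolding N_def by (rule prob_space.prob_space_distr[OF pN' \<iota>m])
    show "sets N = sets (borel_of ?U)" by (simp add: N_def)
    fix f assume f': "continuous_map ?U euclideanreal f \<and> bounded (f ` topspace ?U)"
    then have f: "continuous_map ?U euclideanreal f" by simp
    from f' obtain B where B: "\<forall>x\<in>topspace ?U. \<bar>f x\<bar> \<le> B" unfolding bounded_iff by auto
    have B': "\<bar>f x\<bar> \<le> max 0 B" if "x \<in> topspace ?U" for x
      using bspec[OF B that] by (rule order_trans) simp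
    have f\<iota>: "continuous_map ?A euclideanreal (\<lambda>x. f (?\<iota> x))"
      using continuous_map_compose[OF continuous_map_iso_class_arrays[OF k] f] by (simp add: comp_def)
    have s: "(\<integral>x. f x \<partial>(M n \<bind> (\<lambda>\<omega>. sample r k (X n \<omega>)))) = expect n (sub_average k f)" for n
      unfolding sample_eq_kernel[OF k] sub_average_def
      by (rule integral_bind_kernel[OF sampling_subsets[OF k] f B'])
    have t1: "test_fun (sub_average k f)"
      unfolding sub_average_def by (rule test_fun_average[OF sampling_subsets[OF k] f B']) simp_all
    have t2: "test_fun (lab_average k (\<lambda>x. f (?\<iota> x)))" by (rule test_fun_lab_average[OF f\<iota>])
    have "bounded ((\<lambda>x. f (?\<iota> x)) ` topspace ?A)"
      using arrays_bounded[OF f\<iota>] unfolding bounded_iff by auto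
    then have "(\<lambda>n. expect n (lab_average k (\<lambda>x. f (?\<iota> x)))) \<longlonglongrightarrow> (\<integral>x. f (?\<iota> x) \<partial>N')"
      using N' f\<iota> int[OF f\<iota>] unfolding weak_limit_def by auto
    \<comment> \<open>The expectations over subset samples and over labelled samples differ by a
      null sequence.\<close>
    from tendsto_add[OF expect_eventually_eq[OF t1 t2 sub_average_eq_lab_average[OF k]] this]
    have "(\<lambda>n. expect n (sub_average k f)) \<longlonglongrightarrow> (\<integral>x. f (?\<iota> x) \<partial>N')" by simp
    moreover have "(\<integral>x. f x \<partial>N) = (\<integral>x. f (?\<iota> x) \<partial>N')"
      unfolding N_def by (rule integral_distr[OF \<iota>m continuous_map_borel_measurable[OF f]])
    ultimately show "(\<lambda>n. \<integral>x. f x \<partial>(M n \<bind> (\<lambda>\<omega>. sample r k (X n \<omega>)))) \<longlonglongrightarrow> (\<integral>x. f x \<partial>N)"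
      by (simp add: s)
  qed
  then show ?thesis ..
qed

theorem samples_imp_moments:
  assumes samples: "\<And>k. 1 \<le> k \<Longrightarrow>
    \<exists>N. weak_limit (unlabelled_topology r) (\<lambda>n. M n \<bind> (\<lambda>\<omega>. sample r k (X n \<omega>))) N"
  shows moments_converge
  unfolding moments_converge_def
proof
  fix F :: "('k \<Rightarrow>\<^sub>C real) hypergraph set" assume F: "F \<in> unlabelled r UNIV"
  obtain k F0 where k: "1 \<le> k" and F0: "F0 \<in> hypergraphs r UNIV" "fst F0 = {..<k}" "F = iso_class r F0"
    using canonical_representative[OF F] .
  let ?U = "unlabelled_topology r :: 'k hypergraph set topology"
  let ?f = "inj_density r F :: 'k hypergraph set \<Rightarrow> real"
  have f: "continuous_map ?U euclideanreal ?f" by (rule continuous_map_inj_density[OF F])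
  have B: "\<bar>?f x\<bar> \<le> weight_bound r (rep F)" for x by (rule abs_inj_density_le)
  obtain N where N: "weak_limit ?U (\<lambda>n. M n \<bind> (\<lambda>\<omega>. sample r k (X n \<omega>))) N"
    using samples[OF k] by blast
  have "bounded (?f ` topspace ?U)" unfolding bounded_iff using B by auto
  then have "(\<lambda>n. \<integral>x. ?f x \<partial>(M n \<bind> (\<lambda>\<omega>. sample r k (X n \<omega>)))) \<longlonglongrightarrow> (\<integral>x. ?f x \<partial>N)"
    using N f unfolding weak_limit_def by blast
  moreover have "(\<integral>x. ?f x \<partial>(M n \<bind> (\<lambda>\<omega>. sample r k (X n \<omega>)))) = expect n (sub_average k ?f)" for n
    unfolding sample_eq_kernel[OF k] sub_average_def
    by (rule integral_bind_kernel[OF sampling_subsets[OF k] f B])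
  ultimately have "convergent (\<lambda>n. expect n (sub_average k ?f))" unfolding convergent_def by auto
  moreover have "test_fun (sub_average k ?f)"
    unfolding sub_average_def
    by (rule test_fun_average[OF sampling_subsets[OF k] f B weight_bound_nonneg])
  ultimately have "conv (sub_average k ?f)" by (simp add: conv_def)
  then have "conv ?f"
  proof (rule conv_eventually_eq[OF test_fun_inj[OF F]])
    \<comment> \<open>Once there are \<open>k\<close> vertices, the average of the injective density
      over samples is that density itself; smaller hypergraphs are negligible.\<close>
    fix C :: "'k hypergraph set" assume C: "C \<in> hyps" and large: "k \<le> num_vertices C"
    note G = rep_unlabelled[OF C]
    have P: "({..<k}, pullback r k (rep C) \<phi>) \<in> hypergraphs r UNIV" for \<phi>
      using k by (simp add: pullback_def lessThan_empty_iff)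
    have "sub_average k ?f C = lab_average k (\<lambda>x. ?f (iso_class r ({..<k}, x))) C"
      by (rule sub_average_eq_lab_average[OF k C large])
    also have "\<dots> = lab_inj_density r F0 (rep C)"
      unfolding lab_average_eq F0(3) inj_density_iso_class[OF F0(1) P]
      by (rule average_lab_inj_density[OF k F0(2) G(1)]) (use large in \<open>simp add: num_vertices_def\<close>)
    also have "\<dots> = ?f C"
      using inj_density_iso_class[OF F0(1) G(1)] G(2) F0(3) by simp
    finally show "?f C = sub_average k ?f C" ..
  qed
  then show "conv (hom_density r F)" using conv_inj_iff_hom[OF F] by blast
qed

subsection \<open>Deterministic sequences\<close>

lemma expect_deterministic:
  assumes H: "H n \<in> hyps" "AE \<omega> in M n. X n \<omega> = H n" and p: "test_fun p"
  shows "expect n p = p (H n)"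
proof -
  have "expect n p = (\<integral>\<omega>. p (H n) \<partial>M n)"
    unfolding expect_def
    by (rule integral_cong_AE) (use H(2) test_measurable[OF p] in auto)
  then show ?thesis using prob_space.prob_space[OF prob_M] by simp
qed

lemma conv_deterministic:
  assumes H: "\<And>n. H n \<in> hyps" "\<And>n. AE \<omega> in M n. X n \<omega> = H n" and p: "test_fun p"
  shows "conv p \<longleftrightarrow> convergent (\<lambda>n. p (H n))"
  unfolding conv_def using expect_deterministic[of H, OF H p] p by simp

lemma limitin_interval:
  fixes x :: "nat \<Rightarrow> real"
  assumes "x \<longlonglongrightarrow> l" "\<And>n. x n \<in> {a..b}"
  shows "limitin (top_of_set {a..b}) x l sequentially"
proof -
  have "a \<le> l" by (rule LIMSEQ_le_const[OF assms(1)]) (use assms(2) in auto)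
  moreover have "l \<le> b" by (rule LIMSEQ_le_const2[OF assms(1)]) (use assms(2) in auto)
  ultimately show ?thesis using assms by (simp add: limitin_subtopology)
qed

text \<open>For deterministic hypergraphs an expectation is a value, so convergent moments give a
  limit coordinate by coordinate. It lies in the space of limits because a closure is closed under
  limits.\<close>

lemma limitin_deterministic:
  assumes H: "\<And>n. H n \<in> hyps" "\<And>n. AE \<omega> in M n. X n \<omega> = H n"
  shows "(\<exists>\<Gamma>. limitin T (\<lambda>n. tau (H n)) \<Gamma> sequentially) \<longleftrightarrow> moments_converge"
proof
  assume "\<exists>\<Gamma>. limitin T (\<lambda>n. tau (H n)) \<Gamma> sequentially"
  then obtain \<Gamma> where \<Gamma>: "limitin T (\<lambda>n. tau (H n)) \<Gamma> sequentially" by blast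
  show moments_converge
  proof (rule moments_convergeI)
    fix F assume F: "F \<in> unlabelled r \<F>"
    then have F': "F \<in> unlabelled r UNIV" using F_sub by auto
    from continuous_map_limit[OF continuous_map_coordinate[OF F] \<Gamma>]
    have "(\<lambda>n. hom_density r F (H n)) \<longlonglongrightarrow> fst \<Gamma> F" by (simp add: comp_def tau_coordinate[OF F])
    then show "conv (hom_density r F)"
      unfolding conv_deterministic[of H, OF H test_fun_hom[OF F']] convergent_def by blast
  qed
next
  assume mc: moments_converge
  \<comment> \<open>The last coordinate 0 is the limit of \<open>1 / |V|\<close>.\<close>
  define \<Gamma> where "\<Gamma> = (\<lambda>F\<in>unlabelled r \<F>. lim (\<lambda>n. hom_density r F (H n)), 0::real)"
  have hom_lim: "(\<lambda>n. hom_density r F (H n)) \<longlonglongrightarrow> fst \<Gamma> F" if F: "F \<in> unlabelled r \<F>" for F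
  proof -
    have F': "F \<in> unlabelled r UNIV" using F F_sub by auto
    have "convergent (\<lambda>n. hom_density r F (H n))"
      using mc F' conv_deterministic[of H, OF H test_fun_hom[OF F']] by (simp add: moments_converge_def)
    then show ?thesis using F by (simp add: \<Gamma>_def convergent_LIMSEQ_iff)
  qed
  have size_lim: "(\<lambda>n. inv_size (H n)) \<longlonglongrightarrow> 0"
    using expect_inv_size expect_deterministic[of H, OF H test_fun_inv_size] by simp
  have "limitin (cube_topology r \<F>) (\<lambda>n. tau (H n)) \<Gamma> sequentially"
    unfolding cube_topology_def limitin_pairwise
  proof
    show "limitin (product_topology (\<lambda>_. top_of_set {-1..1}) (unlabelled r \<F>)) (fst \<circ> (\<lambda>n. tau (H n))) (fst \<Gamma>) sequentially"
      unfolding limitin_componentwise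
    proof (intro conjI ballI)
      show "fst \<Gamma> \<in> extensional (unlabelled r \<F>)" by (simp add: \<Gamma>_def)
      have "tau (H n) \<in> (unlabelled r \<F> \<rightarrow>\<^sub>E {-1..1}) \<times> {0..1}" for n
        using tau_in_cube[OF H(1)] by (simp add: topspace_cube)
      then show "\<forall>\<^sub>F n in sequentially. (fst \<circ> (\<lambda>n. tau (H n))) n \<in>
          topspace (product_topology (\<lambda>_. top_of_set {-1..1}) (unlabelled r \<F>))"
        by (simp add: mem_Times_iff)
      fix F assume F: "F \<in> unlabelled r \<F>"
      show "limitin (top_of_set {-1..1}) (\<lambda>n. (fst \<circ> (\<lambda>n. tau (H n))) n F) (fst \<Gamma> F) sequentially"
      proof (rule limitin_interval)
        show "(\<lambda>n. (fst \<circ> (\<lambda>n. tau (H n))) n F) \<longlonglongrightarrow> fst \<Gamma> F"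
          using hom_lim[OF F] by (simp add: tau_coordinate[OF F])
        show "(fst \<circ> (\<lambda>n. tau (H n))) n F \<in> {-1..1}" for n
          using abs_hom_density_le_1[OF F norm_F, of "H n"] by (simp add: tau_coordinate[OF F] abs_le_iff)
      qed
    qed
    show "limitin (top_of_set {0..1}) (snd \<circ> (\<lambda>n. tau (H n))) (snd \<Gamma>) sequentially"
      using size_lim inv_size_bounds
      by (intro limitin_interval) (simp_all add: snd_tau \<Gamma>_def comp_def)
  qed
  moreover have "\<forall>\<^sub>F n in sequentially. tau (H n) \<in> cube_topology r \<F> closure_of tau_image r \<F>"
    using tau_in_T[OF H(1)] by (simp add: topspace_T)
  moreover from calculation have "\<Gamma> \<in> cube_topology r \<F> closure_of tau_image r \<F>"
    by (intro limitin_closedin[OF _ closedin_closure_of]) auto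
  ultimately have "limitin T (\<lambda>n. tau (H n)) \<Gamma> sequentially"
    unfolding limit_topology_def limitin_subtopology by simp
  then show "\<exists>\<Gamma>. limitin T (\<lambda>n. tau (H n)) \<Gamma> sequentially" by blast
qed

section \<open>The conditions in terms of moments\<close>

lemma limit_iff_moments: "(\<exists>N. weak_limit T law N) \<longleftrightarrow> moments_converge"
proof
  assume "\<exists>N. weak_limit T law N"
  then obtain N where N: "weak_limit T law N" by blast
  have t: "density_like (hom_density r)" by (simp add: density_like_def)
  show moments_converge
    by (rule densities_imp_moments[OF t limit_imp_densities[OF N t]]) (use F_sub in auto)
qed (rule limit_exists)

text \<open>Any \<open>A\<close> containing \<open>\<F>\<close> is allowed, so as to cover both
  classes of decorations. Passing from expectations back to laws of single densities needs the limit
  law on the whole space.\<close>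

lemma densities_iff_moments:
  assumes t: "density_like t" and A: "\<F> \<subseteq> A"
  shows "(\<forall>F\<in>unlabelled r A. real_converges_in_distribution M (\<lambda>n \<omega>. t F (X n \<omega>))) \<longleftrightarrow> moments_converge"
proof
  assume "\<forall>F\<in>unlabelled r A. real_converges_in_distribution M (\<lambda>n \<omega>. t F (X n \<omega>))"
  then show moments_converge using unlabelled_mono[OF A, of r] by (intro densities_imp_moments[OF t]) auto
next
  assume moments_converge
  then obtain N where N: "weak_limit T law N" using limit_exists by blast
  show "\<forall>F\<in>unlabelled r A. real_converges_in_distribution M (\<lambda>n \<omega>. t F (X n \<omega>))"
    using limit_imp_densities[OF N t] unlabelled_mono[of A UNIV r] by auto
qed

lemma samples_iff_moments:
  "(\<forall>k\<ge>1. \<exists>N. weak_limit (unlabelled_topology r) (\<lambda>n. M n \<bind> (\<lambda>\<omega>. sample r k (X n \<omega>))) N)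
    \<longleftrightarrow> moments_converge"
proof
  assume "\<forall>k\<ge>1. \<exists>N. weak_limit (unlabelled_topology r) (\<lambda>n. M n \<bind> (\<lambda>\<omega>. sample r k (X n \<omega>))) N"
  then show moments_converge by (intro samples_imp_moments) simp
next
  assume mc: moments_converge
  show "\<forall>k\<ge>1. \<exists>N. weak_limit (unlabelled_topology r) (\<lambda>n. M n \<bind> (\<lambda>\<omega>. sample r k (X n \<omega>))) N"
    by (intro allI impI moments_imp_samples[OF mc])
qed

lemma numerical_iff_moments:
  assumes H: "\<And>n. H n \<in> hyps" "\<And>n. AE \<omega> in M n. X n \<omega> = H n"
    and t: "density_like t" and A: "\<F> \<subseteq> A"
  shows "(\<forall>F\<in>unlabelled r A. convergent (\<lambda>n. t F (H n))) \<longleftrightarrow> moments_converge"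
proof -
  have eq: "convergent (\<lambda>n. t F (H n)) \<longleftrightarrow> conv (hom_density r F)" if F: "F \<in> unlabelled r UNIV" for F
    using conv_deterministic[of H, OF H density_like_test[OF t F]] density_like_conv[OF t F] by simp
  have sub: "unlabelled r \<F> \<subseteq> unlabelled r A" "unlabelled r A \<subseteq> unlabelled r UNIV"
    by (rule unlabelled_mono[OF A], rule unlabelled_mono) simp
  show ?thesis
  proof
    assume c: "\<forall>F\<in>unlabelled r A. convergent (\<lambda>n. t F (H n))"
    show moments_converge
    proof (rule moments_convergeI)
      fix F assume "F \<in> unlabelled r \<F>"
      then have "F \<in> unlabelled r A" "F \<in> unlabelled r UNIV" using sub by auto
      then show "conv (hom_density r F)" using c eq by blast
    qed
  next
    assume moments_converge
    then show "\<forall>F\<in>unlabelled r A. convergent (\<lambda>n. t F (H n))"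
      using eq sub(2) by (auto simp: moments_converge_def)
  qed
qed

end

theorem theorem2:
  fixes r :: nat
    and \<F> :: "('k::polish_space \<Rightarrow>\<^sub>C real) set"
    and M :: "nat \<Rightarrow> 'w measure"
    and X :: "nat \<Rightarrow> 'w \<Rightarrow> 'k hypergraph set"
  assumes "1 \<le> r"
    and "compact (UNIV :: 'k set)"
    and "countable \<F>"
    and "\<And>f. f \<in> \<F> \<Longrightarrow> norm f \<le> 1"
    and "closure (span \<F>) = UNIV"
    and "\<And>n. prob_space (M n)"
    and "\<And>n. X n \<in> measurable (M n) (borel_of (unlabelled_topology r))"
    and "\<And>m::nat. (\<lambda>n. measure (M n) {\<omega> \<in> space (M n). m \<le> num_vertices (X n \<omega>)}) \<longlonglongrightarrow> 1"
  shows
    "let \<C> = (UNIV :: ('k \<Rightarrow>\<^sub>C real) set);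
         tau_limit = weak_limit (limit_topology r \<F>)
           (\<lambda>n. distr (M n) (borel_of (limit_topology r \<F>)) (\<lambda>\<omega>. tau_plus r \<F> (X n \<omega>)));
         cond1 = (\<exists>N. tau_limit N);
         densities_converge = (\<lambda>t A. \<forall>F\<in>unlabelled r A.
           real_converges_in_distribution M (\<lambda>n \<omega>. t r F (X n \<omega>)));
         cond4 = (\<forall>k\<ge>1. \<exists>N. weak_limit (unlabelled_topology r)
           (\<lambda>n. M n \<bind> (\<lambda>\<omega>. sample r k (X n \<omega>))) N);
         limits_are = (\<lambda>t N.
           (\<forall>F\<in>unlabelled r \<F>.
              weak_conv_m (\<lambda>n. distr (M n) borel (\<lambda>\<omega>. t r F (X n \<omega>)))
                (distr N borel (\<lambda>\<Gamma>. fst \<Gamma> F))) \<and>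
           (\<forall>F\<in>unlabelled r \<C>.
              weak_conv_m (\<lambda>n. distr (M n) borel (\<lambda>\<omega>. t r F (X n \<omega>)))
                (distr N borel (density_ext r \<F> F))))
     in
       (\<forall>t\<in>{hom_density, inj_density}.
          (cond1 \<longleftrightarrow> densities_converge t \<F>) \<and>
          (densities_converge t \<F> \<longleftrightarrow> densities_converge t \<C>) \<and>
          (densities_converge t \<C> \<longleftrightarrow> cond4) \<and>
          (cond1 \<or> densities_converge t \<F> \<or> densities_converge t \<C> \<or> cond4 \<longrightarrow>
             (\<exists>N. tau_limit N) \<and>
             (\<forall>N. tau_limit N \<longrightarrow> limits_are t N \<and> (AE \<Gamma> in N. \<Gamma> \<notin> tau_image r \<F>)))) \<and>
       (\<forall>H. (\<forall>n. H n \<in> unlabelled r UNIV \<and> (AE \<omega> in M n. X n \<omega> = H n)) \<longrightarrow>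
          (\<forall>t\<in>{hom_density, inj_density}.
             ((\<exists>\<Gamma>. limitin (limit_topology r \<F>) (\<lambda>n. tau_plus r \<F> (H n)) \<Gamma> sequentially)
                \<longleftrightarrow> (\<forall>F\<in>unlabelled r \<F>. convergent (\<lambda>n. t r F (H n)))) \<and>
             ((\<forall>F\<in>unlabelled r \<F>. convergent (\<lambda>n. t r F (H n)))
                \<longleftrightarrow> (\<forall>F\<in>unlabelled r \<C>. convergent (\<lambda>n. t r F (H n)))) \<and>
             ((\<forall>F\<in>unlabelled r \<C>. convergent (\<lambda>n. t r F (H n))) \<longleftrightarrow> cond4)))"
proof -
  interpret R: random_hypergraphs r \<F> M X
    by (rule random_hypergraphs.intro) (fact assms)+
  have law: "(\<lambda>n. distr (M n) (borel_of (limit_topology r \<F>)) (\<lambda>\<omega>. tau_plus r \<F> (X n \<omega>))) = R.law"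
    by (rule ext) (simp add: R.law_def)
  have t: "R.density_like (t r)" if "t \<in> {hom_density, inj_density}" for t
    using that by (auto simp: R.density_like_def)
  show ?thesis
    unfolding Let_def law R.samples_iff_moments
  proof ((rule conjI; intro ballI allI impI), goal_cases)
    case (1 t)
    \<comment> \<open>Each condition becomes \<open>moments_converge\<close>, so the equivalences
      are trivial and only the description of the limits is left.\<close>
    show ?case
      unfolding R.densities_iff_moments[OF t[OF 1] subset_refl]
        R.densities_iff_moments[OF t[OF 1] subset_UNIV] R.limit_iff_moments
      using R.weak_conv_coordinate[OF _ t[OF 1]] R.weak_conv_extension[OF _ t[OF 1]] R.limit_not_in_image
      by blast
  next
    case (2 H t)
    have H: "H n \<in> unlabelled r UNIV" "AE \<omega> in M n. X n \<omega> = H n" for n using 2(1) by auto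
    show ?case
      unfolding R.limitin_deterministic[of H, OF H]
        R.numerical_iff_moments[of H, OF H t[OF 2(2)] subset_refl]
        R.numerical_iff_moments[of H, OF H t[OF 2(2)] subset_UNIV]
      by simp
  qed
qed

end
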